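(* Let $p$ and $q$ be split monic polynomials with degree $2$ in $\mathbb{F}[t]$, both with simple roots, such that $p(0)q(0)\neq 0$. Set $\delta:=p(0)q(0)^{-1}$. Let $u$ be an endomorphism of a finite-dimensional vector space $V$ over $\mathbb{F}$. Then, the following conditions are equivalent: (i) $u$ is a q-exceptional $(p,q)$-quotient. (ii) $u$ is triangularizable with all its eigenvalues in $\operatorname{Root}(p)\operatorname{Root}(q)^{-1}$ and, for every $z\in\operatorname{Root}(p)\operatorname{Root}(q)^{-1}$ such that $z\neq\delta z^{-1}$, the sequences $\bigl(n_k(u,z)\bigr)_{k\geq 1}$ and $\bigl(n_k(u,\delta z^{-1})\bigr)_{k\geq 1}$ are $1$-intertwined. (iii) Every invariant factor $r$ of $u$ is split with all its roots in $\operatorname{Root}(p)\operatorname{Root}(q)^{-1}$ and, for every $z\in\operatorname{Root}(p)\operatorname{Root}(q)^{-1}$ such that $z\neq\delta z^{-1}$, the respective multiplicities $m$ and $n$ of $z$ and $\delta z^{-1}$ as roots of $r$ satisfy $|m-n|\leq 1$. (iv) In some basis of $V$, the endomorphism $u$ is represented by a block-diagonal matrix in which every diagonal block equals either $C\bigl((t-z)^n\bigr)$ for some positive integer $n$ and some $z\in\operatorname{Root}(p)\operatorname{Root}(q)^{-1}$ such that $z=\delta z^{-1}$, or $C\bigl((t-z)^{n+\epsilon}\bigr)\oplus C\bigl((t-\delta z^{-1})^n\bigr)$ for some integer $n\geq 0$, some $\epsilon\in\{0,1\}$ and some $z\in\operatorname{Root}(p)\operatorname{Root}(q)^{-1}$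 such that $z\neq\delta z^{-1}$.
   Context: $\mathbb{F}$ is an arbitrary field with algebraic closure $\overline{\mathbb{F}}$. $\operatorname{Root}(p)$ is the set of roots of $p$ in $\overline{\mathbb{F}}$, and $\operatorname{Root}(p)\operatorname{Root}(q)^{-1}=\{xy^{-1}: x\in\operatorname{Root}(p),\,y\in\operatorname{Root}(q)\}$. An endomorphism $u$ of $V$ is a $(p,q)$-quotient if $u=ab^{-1}$ for some automorphisms $a,b$ of $V$ with $p(a)=0$ and $q(b)=0$. It is q-exceptional with respect to $(p,q)$ if all its eigenvalues in $\overline{\mathbb{F}}$ belong to $\operatorname{Root}(p)\operatorname{Root}(q)^{-1}$; a q-exceptional $(p,q)$-quotient is a $(p,q)$-quotient that is q-exceptional with respect to $(p,q)$. For $\lambda\in\mathbb{F}$ and a positive integer $k$, $n_k(u,\lambda):=\dim\ker(u-\lambda\,\mathrm{id}_V)^k-\dim\ker(u-\lambda\,\mathrm{id}_V)^{k-1}$. For a positive integer $s$, two non-increasing sequences $(a_n)_{n\geq1}$ and $(b_n)_{n\geq 1}$ of non-negative integers are $s$-intertwined if $a_{n+s}\leq b_n$ and $b_{n+s}\leq a_n$ for all $n\geq 1$. $C(r)$ is the companion matrix of the monic polynomial $r$ ($C(1)$ is the $0\times0$ matrix), and $\oplus$ is block-diagonal sum. The invariant factors of $u$ are the monic polynomials $r_1,r_2,\dots$ with $r_{i+1}\mid r_i$ such that $u$ is represented in some basis by $C(r_1)\oplus C(r_2)\oplus\cdots$; the finite list of nonconstant ones is extended to an infinite sequence by $r_i=1$.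 *)

theory Defs
  imports
    "HOL-Algebra.Algebraic_Closure_Type"
    "Jordan_Normal_Form.Char_Poly"
begin

definition split_poly :: "'a::field poly \<Rightarrow> bool" where
  "split_poly p \<longleftrightarrow>
     p \<noteq> 0 \<and> (\<exists>xs. p = smult (lead_coeff p) (\<Prod>x\<leftarrow>xs. [:- x, 1:]))"

definition Root :: "'a::field poly \<Rightarrow> 'a alg_closure set" where
  "Root p = {x. poly (map_poly to_ac p) x = 0}"

definition Root_quot :: "'a::field poly \<Rightarrow> 'a poly \<Rightarrow> 'a alg_closure set" where
  "Root_quot p q = {x * inverse y | x y. x \<in> Root p \<and> y \<in> Root q}"

text \<open>The vector space \<open>V\<close> is the whole type \<open>'b\<close>, with scalar multiplication \<open>scale\<close>.
  Only finite-dimensional \<open>V\<close> are of interest below.\<close>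

definition poly_endo ::
  "('a::field \<Rightarrow> 'b::ab_group_add \<Rightarrow> 'b) \<Rightarrow> 'a poly \<Rightarrow> ('b \<Rightarrow> 'b) \<Rightarrow> 'b \<Rightarrow> 'b" where
  "poly_endo scale p f v = (\<Sum>i\<le>degree p. scale (Polynomial.coeff p i) ((f ^^ i) v))"

definition automorphism ::
  "('a::field \<Rightarrow> 'b::ab_group_add \<Rightarrow> 'b) \<Rightarrow> ('b \<Rightarrow> 'b) \<Rightarrow> bool" where
  "automorphism scale f \<longleftrightarrow> Vector_Spaces.linear scale scale f \<and> bij f"

definition pq_quotient ::
  "('a::field \<Rightarrow> 'b::ab_group_add \<Rightarrow> 'b) \<Rightarrow> 'a poly \<Rightarrow> 'a poly \<Rightarrow> ('b \<Rightarrow> 'b) \<Rightarrow> bool" where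
  "pq_quotient scale p q u \<longleftrightarrow>
     (\<exists>a b. automorphism scale a \<and> automorphism scale b \<and>
        (\<forall>v. poly_endo scale p a v = 0) \<and> (\<forall>v. poly_endo scale q b v = 0) \<and>
        u = a \<circ> inv_into UNIV b)"

text \<open>\<open>M\<close> is the matrix of \<open>u\<close> in the ordered basis \<open>bs\<close>, for some \<open>bs\<close>; the columns of \<open>M\<close>
  hold the coordinates of the images of the basis vectors.\<close>

definition represents ::
  "('a::field \<Rightarrow> 'b::ab_group_add \<Rightarrow> 'b) \<Rightarrow> ('b \<Rightarrow> 'b) \<Rightarrow> 'a mat \<Rightarrow> bool" where
  "represents scale u M \<longleftrightarrow>
     (\<exists>bs. distinct bs \<and> \<not> module.dependent scale (set bs) \<and> module.span scale (set bs) = UNIV \<and>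
        M \<in> carrier_mat (length bs) (length bs) \<and>
        (\<forall>j<length bs. u (bs ! j) = (\<Sum>i<length bs. scale (M $$ (i, j)) (bs ! i))))"

definition triangularizable ::
  "('a::field \<Rightarrow> 'b::ab_group_add \<Rightarrow> 'b) \<Rightarrow> ('b \<Rightarrow> 'b) \<Rightarrow> bool" where
  "triangularizable scale u \<longleftrightarrow> (\<exists>M. represents scale u M \<and> upper_triangular M)"

text \<open>Eigenvalues of \<open>u\<close> in the algebraic closure are those of its extension of scalars; they
  do not depend on the chosen matrix \<open>M\<close> of \<open>u\<close>.\<close>

definition ac_eigenvalue ::
  "('a::field \<Rightarrow> 'b::ab_group_add \<Rightarrow> 'b) \<Rightarrow> ('b \<Rightarrow> 'b) \<Rightarrow> 'a alg_closure \<Rightarrow> bool" where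
  "ac_eigenvalue scale u x \<longleftrightarrow> (\<exists>M. represents scale u M \<and> eigenvalue (map_mat to_ac M) x)"

definition q_exceptional ::
  "('a::field \<Rightarrow> 'b::ab_group_add \<Rightarrow> 'b) \<Rightarrow> 'a poly \<Rightarrow> 'a poly \<Rightarrow> ('b \<Rightarrow> 'b) \<Rightarrow> bool" where
  "q_exceptional scale p q u \<longleftrightarrow> (\<forall>x. ac_eigenvalue scale u x \<longrightarrow> x \<in> Root_quot p q)"

text \<open>\<open>n_seq scale u c k\<close> is meant for \<open>k \<ge> 1\<close>. The natural-number subtraction does not
  truncate, since the kernels increase with \<open>k\<close>.\<close>

definition n_seq ::
  "('a::field \<Rightarrow> 'b::ab_group_add \<Rightarrow> 'b) \<Rightarrow> ('b \<Rightarrow> 'b) \<Rightarrow> 'a \<Rightarrow> nat \<Rightarrow> nat" where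
  "n_seq scale u c k =
     vector_space.dim scale {v. ((\<lambda>w. u w - scale c w) ^^ k) v = 0} -
     vector_space.dim scale {v. ((\<lambda>w. u w - scale c w) ^^ (k - 1)) v = 0}"

text \<open>Sequences are indexed from 1; the value at 0 is irrelevant.\<close>

definition intertwined :: "nat \<Rightarrow> (nat \<Rightarrow> nat) \<Rightarrow> (nat \<Rightarrow> nat) \<Rightarrow> bool" where
  "intertwined s a b \<longleftrightarrow> (\<forall>n\<ge>1. a (n + s) \<le> b n \<and> b (n + s) \<le> a n)"

text \<open>Convention: ones below the diagonal, the negated coefficients of \<open>r\<close> in the last column.\<close>

definition companion_mat :: "'a::field poly \<Rightarrow> 'a mat" where
  "companion_mat r = mat (degree r) (degree r)
     (\<lambda>(i, j). if Suc j = degree r then - Polynomial.coeff r i else if i = Suc j then 1 else 0)"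

text \<open>The sequence of invariant factors, indexed from 0 and eventually constant 1. As
  \<open>companion_mat 1\<close> is the \<open>0 \<times> 0\<close> matrix, the cut-off \<open>N\<close> is immaterial.\<close>

definition invariant_factor_seq ::
  "('a::field \<Rightarrow> 'b::ab_group_add \<Rightarrow> 'b) \<Rightarrow> ('b \<Rightarrow> 'b) \<Rightarrow> (nat \<Rightarrow> 'a poly) \<Rightarrow> bool" where
  "invariant_factor_seq scale u r \<longleftrightarrow>
     (\<forall>i. lead_coeff (r i) = 1) \<and> (\<forall>i. r (Suc i) dvd r i) \<and>
     (\<exists>N. (\<forall>i\<ge>N. r i = 1) \<and>
        represents scale u (diag_block_mat (map (\<lambda>i. companion_mat (r i)) [0..<N])))"

definition invariant_factor ::
  "('a::field \<Rightarrow> 'b::ab_group_add \<Rightarrow> 'b) \<Rightarrow> ('b \<Rightarrow> 'b) \<Rightarrow> 'a poly \<Rightarrow> bool" where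
  "invariant_factor scale u r \<longleftrightarrow> (\<exists>rs i. invariant_factor_seq scale u rs \<and> r = rs i)"

definition all_equivalent :: "bool list \<Rightarrow> bool" where
  "all_equivalent Ps \<longleftrightarrow> (\<forall>P\<in>set Ps. \<forall>Q\<in>set Ps. P \<longleftrightarrow> Q)"

end

theory Submission
  imports Defs
begin

text \<open>(i) to (ii): let \<open>u = a b\<^sup>-\<^sup>1\<close>. Both \<open>a\<close> and \<open>b\<close> are quadratic, so \<open>u + \<delta> u\<^sup>-\<^sup>1\<close> commutes with
  \<open>a\<close>, and the commutator \<open>c = u a - a u\<close> satisfies \<open>c u = \<delta> u\<^sup>-\<^sup>1 c\<close> while \<open>u\<^sup>2 c\<^sup>2\<close> is \<open>p(0)\<close> times
  the product of \<open>u - x / y\<close> over all roots \<open>x\<close> of \<open>p\<close> and \<open>y\<close> of \<open>q\<close>. Hence \<open>c\<close> exchanges the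
  generalized eigenspaces of \<open>z\<close> and \<open>\<delta> z\<^sup>-\<^sup>1\<close>, and \<open>c\<^sup>2\<close> is there \<open>u - z\<close> up to a unit, so Jordan
  cells at \<open>z\<close> and \<open>\<delta> z\<^sup>-\<^sup>1\<close> pair up with sizes differing by at most one.
  (ii) to (iii): \<open>n\<^sub>k(u, z)\<close> counts the invariant factors divisible by \<open>(t - z)\<^sup>k\<close>.
  (iii) to (iv): the invariant factors, which exist by the cyclic decomposition theorem, are split
  by the Chinese remainder theorem.
  (iv) to (i): a cyclic endomorphism with minimal polynomial \<open>(t - z)\<^sup>n\<^sup>+\<^sup>\<epsilon> (t - \<delta> z\<^sup>-\<^sup>1)\<^sup>n\<close> is a
  quotient of two block-diagonal matrices whose blocks, of size at most 2, are shifted against each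
  other by one.\<close>

section \<open>Polynomials of an endomorphism\<close>

text \<open>Conjugation explains the formulas behind the commutator. Let \<open>s\<close>,
  \<open>t\<close> be the sums of the roots of \<open>p\<close>, \<open>q\<close>, and put
  \<open>a' = s - a\<close>, \<open>b' = t - b\<close>. Then \<open>a a' = p(0)\<close> and
  \<open>b b' = q(0)\<close>, and since conjugation reverses products, the conjugate of
  \<open>u = a b^-1\<close> is \<open>us = q(0)^-1 b (s - a)\<close>, with
  \<open>u us = \<delta>\<close>. On quotients of roots this is \<open>z = x / y\<close> going to
  \<open>x' / y'\<close>, where both roots are exchanged for the other ones. So the four quotients
  form the pairs \<open>x1 / y1, x2 / y2\<close> and \<open>x1 / y2, x2 / y1\<close>. Values from
  different pairs share a numerator or a denominator, hence always differ. A pair may collapse to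
  one point; there the product in \<open>u^2 c^2\<close> contains \<open>(u - z)^2\<close> instead
  of \<open>u - z\<close>, and no condition on the cells remains. Two encodings shape the rest.
  Direct sums of cyclic submodules are recorded by generators, annihilators and a degree count, and
  directness comes from counting. Eigenvalues in the algebraic closure are reached through additive
  maps from \<open>V\<close> into the closure, so \<open>V\<close> itself is never extended.\<close>

locale fd_endo = finite_dimensional_vector_space scale Basis
  for scale :: "'a::field \<Rightarrow> 'b::ab_group_add \<Rightarrow> 'b" (infixr "*s" 75) and Basis +
  fixes u :: "'b \<Rightarrow> 'b"
  assumes lin: "Vector_Spaces.linear scale scale u"
begin

abbreviation act :: "'a poly \<Rightarrow> 'b \<Rightarrow> 'b" where "act f \<equiv> poly_endo scale f u"

lemma hom: "module_hom scale scale u"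
  using lin by (simp add: linear_iff_module_hom)

lemmas u_add = module_hom.add[OF hom] and u_scale = module_hom.scale[OF hom]
  and u_0 = module_hom.zero[OF hom] and u_diff = module_hom.diff[OF hom]
  and u_sum = module_hom.sum[OF hom]

lemma pow_hom: "module_hom scale scale (u ^^ k)"
proof (induction k)
  case 0
  show ?case using module_hom_ident by (simp add: id_def linear_iff_module_hom)
next
  case (Suc k)
  then show ?case using module_hom_compose[OF Suc hom] by (simp add: comp_def)
qed

lemma act_altdef:
  assumes "degree f \<le> n"
  shows "act f x = (\<Sum>i\<le>n. Polynomial.coeff f i *s (u ^^ i) x)"
proof -
  have "(\<Sum>i\<le>degree f. Polynomial.coeff f i *s (u ^^ i) x) = (\<Sum>i\<le>n. Polynomial.coeff f i *s (u ^^ i) x)"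
    by (rule sum.mono_neutral_left) (use assms in \<open>auto simp: coeff_eq_0 not_le\<close>)
  then show ?thesis by (simp add: poly_endo_def)
qed

lemma act_altdef_less:
  assumes "f = 0 \<or> degree f < n"
  shows "act f x = (\<Sum>i<n. Polynomial.coeff f i *s (u ^^ i) x)"
proof -
  have "act f x = (\<Sum>i\<le>n. Polynomial.coeff f i *s (u ^^ i) x)"
    using assms by (intro act_altdef) auto
  also have "\<dots> = (\<Sum>i<n. Polynomial.coeff f i *s (u ^^ i) x)"
    using assms by (intro sum.mono_neutral_right) (auto simp: coeff_eq_0 not_less)
  finally show ?thesis .
qed

lemma act_0 [simp]: "act 0 x = 0"
  by (simp add: poly_endo_def)

lemma act_pCons: "act (pCons c f) x = c *s x + act f (u x)"
proof -
  have "act (pCons c f) x = (\<Sum>i\<le>Suc (degree f). Polynomial.coeff (pCons c f) i *s (u ^^ i) x)"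
    by (rule act_altdef) (rule degree_pCons_le)
  also have "\<dots> = c *s x + (\<Sum>i\<le>degree f. Polynomial.coeff f i *s (u ^^ i) (u x))"
    by (subst sum.atMost_Suc_shift) (simp add: funpow_swap1)
  finally show ?thesis by (simp add: poly_endo_def)
qed

lemma act_1 [simp]: "act 1 x = x"
  by (simp add: one_pCons act_pCons)

lemma act_add: "act (f + g) x = act f x + act g x"
proof -
  let ?n = "max (degree f) (degree g)"
  have "act (f + g) x = (\<Sum>i\<le>?n. Polynomial.coeff (f + g) i *s (u ^^ i) x)"
    by (rule act_altdef) (simp add: degree_add_le)
  then show ?thesis
    by (simp add: act_altdef[of f ?n] act_altdef[of g ?n] sum.distrib scale_left_distrib)
qed

lemma act_smult: "act (smult c f) x = c *s act f x"
  by (simp add: act_altdef[of "smult c f" "degree f"] poly_endo_def scale_sum_right)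

lemma act_uminus: "act (- f) x = - act f x"
  using act_add[of "- f" f x] by (simp add: eq_neg_iff_add_eq_0)

lemma act_diff: "act (f - g) x = act f x - act g x"
  using act_add[of f "- g" x] by (simp add: act_uminus)

lemma act_commute:
  assumes T: "module_hom scale scale T" and c: "\<And>x. T (u x) = u (T x)"
  shows "T (act f x) = act f (T x)"
proof -
  have "T ((u ^^ i) x) = (u ^^ i) (T x)" for i
    by (induction i) (simp_all add: c)
  then show ?thesis
    by (simp add: poly_endo_def module_hom.sum[OF T] module_hom.scale[OF T])
qed

lemma act_u: "act f (u x) = u (act f x)"
  by (rule act_commute[OF hom refl, symmetric])

lemma act_mult: "act (f * g) x = act f (act g x)"
proof (induction f arbitrary: x)
  case (pCons c f)
  then show ?case
    by (simp add: mult_pCons_left act_add act_smult act_pCons act_u)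
qed simp

lemma act_linear: "module_hom scale scale (act f)"
proof (intro module_hom.intro module_hom_axioms.intro)
  show "act f (x + y) = act f x + act f y" for x y
    by (simp add: poly_endo_def module_hom.add[OF pow_hom] scale_right_distrib sum.distrib)
  show "act f (c *s x) = c *s act f x" for c x
    by (simp add: poly_endo_def module_hom.scale[OF pow_hom] scale_sum_right mult.commute)
qed (rule module_axioms)+

lemmas act_plus = module_hom.add[OF act_linear] and act_scale = module_hom.scale[OF act_linear]
  and act_zero [simp] = module_hom.zero[OF act_linear]
  and act_sum = module_hom.sum[OF act_linear]

lemma act_mult_commute: "act f (act g x) = act g (act f x)"
  by (metis act_mult mult.commute)

lemma act_monom: "act (Polynomial.monom c n) x = c *s (u ^^ n) x"
proof (induction n arbitrary: x)
  case (Suc n)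
  then show ?case by (simp add: monom_Suc act_pCons funpow_swap1)
qed (simp add: monom_0 act_pCons)

lemma act_lin: "act [:- c, 1:] x = u x - c *s x"
  by (simp add: act_pCons)

lemma act_poly_sum: "act (\<Sum>i\<in>I. f i) x = (\<Sum>i\<in>I. act (f i) x)"
  by (induction I rule: infinite_finite_induct) (simp_all add: act_add)

lemma act_mod:
  assumes "act r x = 0"
  shows "act (f mod r) x = act f x"
proof -
  have "act f x = act (f div r * r + f mod r) x" by simp
  also have "\<dots> = act (f mod r) x"
    using assms by (simp only: act_add act_mult) simp
  finally show ?thesis by simp
qed

lemma act_dvd:
  assumes "r dvd f" "act r x = 0"
  shows "act f x = 0"
  using assms by (auto elim!: dvdE simp: act_mult act_mult_commute[of r])

lemma act_lin_power: "act ([:- c, 1:] ^ k) x = ((\<lambda>w. u w - c *s w) ^^ k) x"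
proof (induction k arbitrary: x)
  case (Suc k)
  have "act ([:- c, 1:] ^ Suc k) x = act [:- c, 1:] (act ([:- c, 1:] ^ k) x)"
    by (simp only: power_Suc act_mult)
  then show ?case by (simp only: act_lin Suc) simp
qed simp

text \<open>Write \<open>f = c + t h\<close> with \<open>c \<noteq> 0\<close>: then \<open>- h(u) / c\<close> is inverse to \<open>u\<close>.\<close>

lemma bij_if_annihilated:
  assumes ann: "\<And>x. act f x = 0" and f0: "poly f 0 \<noteq> 0"
  shows "bij u"
proof -
  obtain c h where f: "f = pCons c h" by (cases f)
  with f0 have c: "c \<noteq> 0" by simp
  have eq: "c *s x + act h (u x) = 0" for x
    using ann[of x] by (simp add: f act_pCons)
  show ?thesis
  proof (intro bijI injI)
    fix x y assume "u x = u y"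
    then have "u (x - y) = 0" by (simp add: u_diff)
    then have "c *s (x - y) = 0" using eq[of "x - y"] by simp
    with c show "x = y" by simp
  next
    have "u (- inverse c *s act h x) = x" for x
    proof -
      have "u (- inverse c *s act h x) = - inverse c *s act h (u x)"
        by (simp only: u_scale act_u)
      also have "\<dots> = - inverse c *s (- (c *s x))"
        using eq[of x] by (simp add: add_eq_0_iff)
      finally show ?thesis using c by simp
    qed
    then show "surj u" by (rule surjI)
  qed
qed

end

section \<open>Spanning and independence of families indexed by a finite set\<close>

context finite_dimensional_vector_space
begin

text \<open>Spanning needs at least \<open>dim W\<close> distinct vectors, so a family of at most
  that size can have neither a repetition nor a relation. Independence of a candidate basis is
  usually obtained below in this way, by a span and a count.\<close>

lemma family_basis:
  assumes fin: "finite I" and sp: "W \<subseteq> span (g ` I)" and card: "card I \<le> dim W"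
  shows "inj_on g I \<and> independent (g ` I)"
proof -
  have "dim W \<le> dim (g ` I)" using sp by (rule dim_mono)
  also have "\<dots> \<le> card (g ` I)" using fin by (intro dim_le_card') simp
  finally have le: "dim W \<le> card (g ` I)" .
  moreover have "card (g ` I) \<le> card I" using fin by (rule card_image_le)
  ultimately have eq: "card (g ` I) = card I" using card by simp
  then have "inj_on g I" using fin by (simp add: eq_card_imp_inj_on)
  moreover have "card (g ` I) \<le> dim (g ` I)"
    using \<open>dim W \<le> dim (g ` I)\<close> eq card by simp
  then have "independent (g ` I)" using fin by (intro card_le_dim_spanning[of _ "g ` I"]) (auto simp: span_base)
  ultimately show ?thesis by blast
qed

lemma family_indepD:
  assumes fin: "finite I" and inj: "inj_on g I" and ind: "independent (g ` I)"
    and s: "(\<Sum>i\<in>I. scale (c i) (g i)) = 0" and i: "i \<in> I"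
  shows "c i = 0"
proof -
  have "(\<Sum>v\<in>g ` I. scale (c (the_inv_into I g v)) v) = 0"
    using s by (simp add: sum.reindex[OF inj] the_inv_into_f_f[OF inj])
  then have "c (the_inv_into I g (g i)) = 0"
    using ind fin i by (intro independentD[OF ind]) auto
  then show ?thesis using inj i by (simp add: the_inv_into_f_f)
qed

lemma family_indepI:
  assumes fin: "finite I"
    and s: "\<And>c. (\<Sum>i\<in>I. scale (c i) (g i)) = 0 \<Longrightarrow> \<forall>i\<in>I. c i = 0"
  shows "inj_on g I \<and> independent (g ` I)"
proof -
  have inj: "inj_on g I"
  proof (rule inj_onI, rule ccontr)
    fix i j assume ij: "i \<in> I" "j \<in> I" "g i = g j" "i \<noteq> j"
    let ?c = "\<lambda>k. if k = i then 1 else if k = j then - 1 else (0::'a)"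
    have "(\<Sum>k\<in>I. scale (?c k) (g k)) = (\<Sum>k\<in>{i, j}. scale (?c k) (g k))"
      using fin ij by (intro sum.mono_neutral_right) auto
    also have "\<dots> = 0" using ij by simp
    finally have "\<forall>i\<in>I. ?c i = 0" by (rule s)
    then have "?c i = 0" using ij(1) by (rule bspec)
    then show False by simp
  qed
  moreover have "independent (g ` I)"
  proof (rule independent_if_scalars_zero)
    show "finite (g ` I)" using fin by simp
    fix f x assume f: "(\<Sum>x\<in>g ` I. scale (f x) x) = 0" and x: "x \<in> g ` I"
    have "(\<Sum>i\<in>I. scale (f (g i)) (g i)) = 0"
      using f by (simp add: sum.reindex[OF inj])
    then have "\<forall>i\<in>I. f (g i) = 0" using s[of "f \<circ> g"] by simp
    then show "f x = 0" using x by blast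
  qed
  ultimately show ?thesis by blast
qed

lemma family_dim:
  assumes fin: "finite I"
    and s: "\<And>c. (\<Sum>i\<in>I. scale (c i) (g i)) = 0 \<Longrightarrow> \<forall>i\<in>I. c i = 0"
    and sp: "span (g ` I) = W"
  shows "dim W = card I"
proof -
  have *: "inj_on g I" "independent (g ` I)" using family_indepI[OF fin s] by auto
  have "dim W = dim (g ` I)" using sp by (metis dim_span)
  also have "\<dots> = card (g ` I)" using * by (intro dim_eq_card_independent)
  also have "\<dots> = card I" using * by (intro card_image)
  finally show ?thesis .
qed

lemma span_family:
  assumes "finite I"
  shows "x \<in> span (g ` I) \<longleftrightarrow> (\<exists>c. x = (\<Sum>i\<in>I. scale (c i) (g i)))"
proof
  assume "x \<in> span (g ` I)"
  then show "\<exists>c. x = (\<Sum>i\<in>I. scale (c i) (g i))"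
  proof (induction rule: span_induct_alt)
    case base
    then show ?case by (intro exI[of _ "\<lambda>_. 0"]) simp
  next
    case (step c y z)
    then obtain i d where i: "i \<in> I" "y = g i" and d: "z = (\<Sum>i\<in>I. scale (d i) (g i))" by blast
    have "scale c y + z = (\<Sum>k\<in>I. scale (d k + (if k = i then c else 0)) (g k))"
      using i assms
      by (simp add: d scale_left_distrib sum.distrib if_distrib[of "\<lambda>c. scale c _"] sum.delta' add.commute cong: if_cong)
    then show ?case by (intro exI)
  qed
qed (auto intro: span_sum span_scale span_base)

end

section \<open>Cyclic decomposition with divisibility chain\<close>

text \<open>Coprimality in Bezout form: the coefficients \<open>s\<close>, \<open>t\<close> are what
  later splits a vector into two components.\<close>

definition comaximal :: "'a::comm_ring_1 \<Rightarrow> 'a \<Rightarrow> bool" where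
  "comaximal f g \<longleftrightarrow> (\<exists>s t. s * f + t * g = 1)"

lemma comaximal_commute: "comaximal f g \<longleftrightarrow> comaximal g f"
  unfolding comaximal_def by (metis add.commute)

lemma comaximal_1 [simp]: "comaximal f 1"
  unfolding comaximal_def by (rule exI[of _ 0], rule exI[of _ 1]) simp

lemma comaximal_mult:
  assumes "comaximal f g" "comaximal f h"
  shows "comaximal f (g * h)"
proof -
  obtain s t where 1: "s * f + t * g = 1" using assms(1) by (auto simp: comaximal_def)
  obtain s' t' where 2: "s' * f + t' * h = 1" using assms(2) by (auto simp: comaximal_def)
  have "(s * (s' * f + t' * h) + t * g * s') * f + (t * t') * (g * h) = (s * f + t * g) * (s' * f + t' * h)"
    by (simp add: algebra_simps)
  then show ?thesis using 1 2 unfolding comaximal_def by (metis mult_1)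
qed

lemma comaximal_power: "comaximal f g \<Longrightarrow> comaximal f (g ^ k)"
  by (induction k) (auto intro: comaximal_mult)

lemma comaximal_powers: "comaximal f g \<Longrightarrow> comaximal (f ^ j) (g ^ k)"
  by (metis comaximal_commute comaximal_power)

lemma comaximal_dvd_mult:
  assumes "comaximal f g" "f dvd g * h"
  shows "f dvd h"
proof -
  obtain s t where "s * f + t * g = 1" using assms(1) by (auto simp: comaximal_def)
  then have "h = (s * f + t * g) * h" by simp
  also have "\<dots> = f * (s * h) + t * (g * h)" by (simp add: algebra_simps)
  finally show ?thesis using assms(2) by (metis dvd_add dvd_mult dvd_triv_left)
qed

lemma comaximal_mult_dvd:
  assumes "comaximal f g" "f dvd h" "g dvd h"
  shows "f * g dvd h"
proof -
  obtain k where k: "h = g * k" using assms(3) by blast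
  then have "f dvd k" using assms comaximal_dvd_mult by blast
  then obtain j where "k = f * j" by blast
  with k have "h = f * g * j" by (simp add: mult_ac)
  then show ?thesis by simp
qed

lemma comaximal_linear:
  fixes a b :: "'a::field"
  assumes "a \<noteq> b"
  shows "comaximal [:- a, 1:] [:- b, 1:]"
proof -
  have "[:inverse (b - a):] * [:- a, 1:] + [:- inverse (b - a):] * [:- b, 1:] = [:inverse (b - a) * (b - a):]"
    by (simp add: algebra_simps)
  also have "\<dots> = 1" using assms by (simp add: one_pCons)
  finally show ?thesis unfolding comaximal_def by blast
qed

text \<open>A nonzero combination of \<open>f\<close> and \<open>g\<close> of least degree divides
  every combination, because the remainder would be a combination of smaller degree.\<close>

lemma poly_bezout:
  fixes f g :: "'a::field poly"
  assumes "f \<noteq> 0"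
  shows "\<exists>d s t. d = s * f + t * g \<and> d \<noteq> 0 \<and> d dvd f \<and> d dvd g"
proof -
  let ?P = "\<lambda>d. d \<noteq> 0 \<and> (\<exists>s t. d = s * f + t * g)"
  have "?P f" using assms by (metis add.right_neutral mult_1 mult_zero_left)
  then obtain d where d: "?P d" and min: "\<And>d'. ?P d' \<Longrightarrow> degree d \<le> degree d'"
    using ex_has_least_nat[of ?P f degree] by blast
  obtain s t where st: "d = s * f + t * g" using d by blast
  have "d dvd s' * f + t' * g" for s' t'
  proof (rule ccontr)
    let ?h = "s' * f + t' * g"
    assume "\<not> d dvd ?h"
    then have nz: "?h mod d \<noteq> 0" by (simp add: mod_eq_0_iff_dvd)
    define c where "c = ?h div d"
    have "?h mod d = ?h - c * d" by (simp add: c_def minus_div_mult_eq_mod)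
    also have "\<dots> = (s' - c * s) * f + (t' - c * t) * g"
      by (simp add: st algebra_simps)
    finally have "degree d \<le> degree (?h mod d)" using nz min by blast
    then show False using degree_mod_less[of d ?h] d nz by auto
  qed
  from this[of 1 0] this[of 0 1] show ?thesis using d st by auto
qed

lemma split_power:
  fixes f p :: "'a::field poly"
  assumes "f \<noteq> 0" "degree p > 0"
  shows "\<exists>k g. f = p ^ k * g \<and> \<not> p dvd g"
  using assms(1)
proof (induction "degree f" arbitrary: f rule: less_induct)
  case less
  show ?case
  proof (cases "p dvd f")
    case True
    then obtain h where h: "f = p * h" by blast
    with less.prems have "degree h < degree f" "h \<noteq> 0"
      using assms(2) by (auto simp: degree_mult_eq)
    then obtain k g where "h = p ^ k * g \<and> \<not> p dvd g" using less.hyps by blast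
    with h show ?thesis by (intro exI[of _ "Suc k"] exI[of _ g]) simp
  next
    case False
    then show ?thesis by (intro exI[of _ 0] exI[of _ f]) simp
  qed
qed

text \<open>A nonconstant divisor of \<open>h\<close> of least degree works: a nonconstant common
  divisor of \<open>p\<close> and \<open>g\<close> has at least the degree of \<open>p\<close>, so
  it is associated to \<open>p\<close>, and then \<open>p\<close> divides \<open>g\<close>.
  Irreducibility is used below only in this form.\<close>

lemma ex_prime_factor:
  fixes h :: "'a::field poly"
  assumes "degree h > 0"
  shows "\<exists>p. degree p > 0 \<and> p dvd h \<and> (\<forall>g. \<not> p dvd g \<longrightarrow> comaximal p g)"
proof -
  let ?P = "\<lambda>p. degree p > 0 \<and> p dvd h"
  obtain p where p: "?P p" and min: "\<And>p'. ?P p' \<Longrightarrow> degree p \<le> degree p'"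
    using ex_has_least_nat[of ?P h degree] assms dvd_refl by blast
  have "comaximal p g" if "\<not> p dvd g" for g
  proof -
    obtain d s t where d: "d = s * p + t * g" "d \<noteq> 0" "d dvd p" "d dvd g"
      using poly_bezout[of p g] p by (metis degree_0 less_irrefl)
    have "degree d = 0"
    proof (rule ccontr)
      assume "degree d \<noteq> 0"
      then have "degree p \<le> degree d" using min[of d] d p by (auto intro: dvd_trans)
      moreover obtain k where k: "p = d * k" using d by blast
      moreover have "k \<noteq> 0" using p k by auto
      ultimately have "degree k = 0" using d(2) by (simp add: degree_mult_eq)
      then obtain c where "k = [:c:]" by (rule degree_eq_zeroE)
      with k \<open>k \<noteq> 0\<close> have "p dvd d" by (simp add: smult_dvd_iff)
      with d that show False by (meson dvd_trans)
    qed
    then obtain c where c: "d = [:c:]" by (rule degree_eq_zeroE)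
    then have "c \<noteq> 0" using d(2) by (metis pCons_0_0)
    have "smult (inverse c) s * p + smult (inverse c) t * g = smult (inverse c) d"
      by (simp add: d(1) smult_add_right)
    also have "\<dots> = 1" using c \<open>c \<noteq> 0\<close> by (simp add: one_pCons)
    finally show ?thesis unfolding comaximal_def by blast
  qed
  with p show ?thesis by blast
qed

lemma coeff_sum_monom_less:
  "Polynomial.coeff (\<Sum>i<n. Polynomial.monom (c i) i) k = (if k < n then c k else 0)"
  by (simp add: coeff_sum if_distrib cong: if_cong)

lemma degree_sum_monom_less:
  "(\<Sum>i<n. Polynomial.monom (c i) i) = 0 \<or> degree (\<Sum>i<n. Polynomial.monom (c i) i) < n"
proof (cases "(\<Sum>i<n. Polynomial.monom (c i) i) = 0")
  case False
  then have "Polynomial.coeff (\<Sum>i<n. Polynomial.monom (c i) i) (degree (\<Sum>i<n. Polynomial.monom (c i) i)) \<noteq> 0"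
    by simp
  then show ?thesis unfolding coeff_sum_monom_less by (metis (no_types))
qed simp

lemma monic_dvd_eq:
  fixes f g :: "'a::field poly"
  assumes "g dvd f" "f = 0 \<or> degree f < degree g"
  shows "f = 0"
  using assms dvd_imp_degree_le leD by blast

section \<open>Cyclic submodules, orders of vectors and complements\<close>

context fd_endo
begin

definition invariant :: "'b set \<Rightarrow> bool" where
  "invariant W \<longleftrightarrow> subspace W \<and> (\<forall>x\<in>W. u x \<in> W)"

text \<open>The submodule generated by \<open>S\<close> when the space is a module over the
  polynomial ring, with the indeterminate acting as \<open>u\<close>.\<close>

definition gspan :: "'b set \<Rightarrow> 'b set" where
  "gspan S = span {act f e | f e. e \<in> S}"

text \<open>An internal direct sum of cyclic submodules. Neither directness nor minimality of the
  annihilators \<open>r\<close> is stated: the generators yield \<open>W\<close> and the degrees add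
  up to \<open>dim W\<close>, which forces both (see \<open>dec_indep\<close>). Trivial summands
  with \<open>r = 1\<close> and \<open>e = 0\<close> are allowed.\<close>

definition dec :: "('b \<times> 'a poly) list \<Rightarrow> 'b set \<Rightarrow> bool" where
  "dec ers W \<longleftrightarrow> (\<forall>(e, r)\<in>set ers. lead_coeff r = 1 \<and> act r e = 0) \<and>
     gspan (fst ` set ers) = W \<and> (\<Sum>(e, r)\<leftarrow>ers. degree r) = dim W"

definition ord_poly :: "'b \<Rightarrow> 'a poly \<Rightarrow> bool" where
  "ord_poly e m \<longleftrightarrow> lead_coeff m = 1 \<and> (\<forall>f. act f e = 0 \<longleftrightarrow> m dvd f)"

lemma invariant_act:
  assumes "invariant W" "x \<in> W"
  shows "act f x \<in> W"
proof -
  have "(u ^^ i) x \<in> W" for i using assms by (induction i) (auto simp: invariant_def)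
  then show ?thesis using assms unfolding poly_endo_def invariant_def
    by (intro subspace_sum subspace_scale) auto
qed

lemma gspan_base: "e \<in> S \<Longrightarrow> act f e \<in> gspan S"
  unfolding gspan_def by (rule span_base) blast

lemma gspan_superset: "S \<subseteq> gspan S"
  using gspan_base[of _ S 1] by auto

lemma gspan_invariant: "invariant (gspan S)"
  unfolding invariant_def
proof (intro conjI ballI)
  show "subspace (gspan S)" by (simp add: gspan_def)
  fix x assume "x \<in> gspan S"
  then show "u x \<in> gspan S"
    unfolding gspan_def
  proof (induction rule: span_induct_alt)
    case base
    then show ?case by (simp add: u_0 span_zero)
  next
    case (step c y z)
    then obtain f e where "y = act f e" "e \<in> S" by blast
    then have "u y = act ([:0, 1:] * f) e" by (simp only: act_mult) (simp add: act_pCons u_0)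
    with \<open>e \<in> S\<close> have "u y \<in> span {act f e | f e. e \<in> S}" by (intro span_base) blast
    with step show ?case by (simp add: u_add u_scale span_add span_scale)
  qed
qed

lemma gspan_minimal:
  assumes "S \<subseteq> W" "invariant W"
  shows "gspan S \<subseteq> W"
  unfolding gspan_def
  by (rule span_minimal) (use assms invariant_act in \<open>auto simp: invariant_def\<close>)

lemma gspan_le: "S \<subseteq> gspan T \<Longrightarrow> gspan S \<subseteq> gspan T"
  by (rule gspan_minimal[OF _ gspan_invariant])

lemma gspan_mono: "S \<subseteq> T \<Longrightarrow> gspan S \<subseteq> gspan T"
  using gspan_le gspan_superset by blast

lemma gspan_add: "x \<in> gspan S \<Longrightarrow> y \<in> gspan S \<Longrightarrow> x + y \<in> gspan S"
  by (simp add: gspan_def span_add)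

lemma act_sum_monom: "act (\<Sum>i<n. Polynomial.monom (c i) i) x = (\<Sum>i<n. c i *s (u ^^ i) x)"
  by (simp add: act_poly_sum act_monom)

text \<open>One more iterate of \<open>x\<close> than the dimension cannot be independent, and a
  relation between iterates is an annihilating polynomial.\<close>

lemma ex_annihilator: "\<exists>f. f \<noteq> 0 \<and> act f x = 0"
proof (rule ccontr)
  assume no: "\<not> ?thesis"
  let ?n = "Suc (card Basis)"
  have "inj_on (\<lambda>i. (u ^^ i) x) {..<?n} \<and> independent ((\<lambda>i. (u ^^ i) x) ` {..<?n})"
  proof (rule family_indepI, simp, intro ballI)
    fix c i assume s: "(\<Sum>i<?n. c i *s (u ^^ i) x) = 0" and i: "i \<in> {..<?n}"
    then have "(\<Sum>i<?n. Polynomial.monom (c i) i) = 0" using no by (metis act_sum_monom)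
    then show "c i = 0" using coeff_sum_monom_less[of c ?n i] i by simp
  qed
  then have "?n \<le> dim (UNIV :: 'b set)"
    using independent_card_le_dim[of "(\<lambda>i. (u ^^ i) x) ` {..<?n}" UNIV] card_image by fastforce
  then show False by simp
qed

lemma ex_ord_poly: "\<exists>m. ord_poly e m"
proof -
  let ?P = "\<lambda>f. f \<noteq> 0 \<and> act f e = 0"
  obtain f0 where "?P f0" using ex_annihilator by blast
  then obtain f where f: "?P f" and min: "\<And>g. ?P g \<Longrightarrow> degree f \<le> degree g"
    using ex_has_least_nat[of ?P f0 degree] by blast
  let ?m = "smult (inverse (lead_coeff f)) f"
  have "?m dvd g" if "act g e = 0" for g
  proof -
    have "act (g mod f) e = 0" using that f act_mod by simp
    then have "g mod f = 0" using min[of "g mod f"] degree_mod_less[of f g] f by force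
    then show ?thesis using f by (simp add: smult_dvd_iff mod_eq_0_iff_dvd)
  qed
  moreover have "act g e = 0" if "?m dvd g" for g
    using f by (intro act_dvd[OF that]) (simp add: act_smult)
  ultimately have "ord_poly e ?m"
    using f by (auto simp: ord_poly_def)
  then show ?thesis ..
qed

lemma ord_poly_nonzero: "ord_poly e m \<Longrightarrow> m \<noteq> 0"
  by (auto simp: ord_poly_def)

lemma ord_poly_indep:
  assumes m: "ord_poly e m" and d: "d = degree m" and s: "(\<Sum>i<d. c i *s (u ^^ i) e) = 0"
  shows "\<forall>i\<in>{..<d}. c i = 0"
proof
  fix i assume "i \<in> {..<d}"
  have "m dvd (\<Sum>i<d. Polynomial.monom (c i) i)"
    using m s by (simp add: ord_poly_def act_sum_monom flip: act_sum_monom)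
  then have "(\<Sum>i<d. Polynomial.monom (c i) i) = 0"
    by (rule monic_dvd_eq) (use degree_sum_monom_less[of c d] d in simp)
  then show "c i = 0" using coeff_sum_monom_less[of c d i] \<open>i \<in> _\<close> by simp
qed

lemma ord_poly_degree_le:
  assumes "ord_poly e m"
  shows "degree m \<le> dim (UNIV :: 'b set)"
proof -
  let ?g = "\<lambda>i. (u ^^ i) e"
  have "inj_on ?g {..<degree m} \<and> independent (?g ` {..<degree m})"
    by (rule family_indepI) (use ord_poly_indep[OF assms refl] in auto)
  then show ?thesis
    using independent_card_le_dim[of "?g ` {..<degree m}" UNIV] card_image by fastforce
qed

lemma act_in_span_powers:
  assumes "act r e = 0" "r \<noteq> 0"
  shows "act f e \<in> span ((\<lambda>i. (u ^^ i) e) ` {..<degree r})"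
proof -
  have "act f e = act (f mod r) e" using act_mod assms by simp
  also have "\<dots> = (\<Sum>i<degree r. Polynomial.coeff (f mod r) i *s (u ^^ i) e)"
    using degree_mod_less[of r f] assms(2) by (intro act_altdef_less) auto
  finally show ?thesis by (auto intro: span_sum span_scale span_base)
qed

lemma gspan_single:
  assumes "act r e = 0" "r \<noteq> 0"
  shows "gspan {e} = span ((\<lambda>i. (u ^^ i) e) ` {..<degree r})"
proof
  show "gspan {e} \<subseteq> span ((\<lambda>i. (u ^^ i) e) ` {..<degree r})"
    unfolding gspan_def by (rule span_minimal) (use act_in_span_powers[OF assms] in auto)
  have "(u ^^ i) e \<in> gspan {e}" for i
    using gspan_base[of e "{e}" "Polynomial.monom 1 i"] by (simp add: act_monom)
  then show "span ((\<lambda>i. (u ^^ i) e) ` {..<degree r}) \<subseteq> gspan {e}"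
    using gspan_invariant by (intro span_minimal) (auto simp: invariant_def)
qed

lemma gspan_single_cases: "x \<in> gspan {e} \<longleftrightarrow> (\<exists>f. x = act f e)"
proof
  assume "x \<in> gspan {e}"
  then show "\<exists>f. x = act f e" unfolding gspan_def
  proof (induction rule: span_induct_alt)
    case base
    show ?case by (rule exI[of _ 0]) simp
  next
    case (step c y z)
    then obtain f g where "y = act f e" "z = act g e" by blast
    then show ?case by (intro exI[of _ "smult c f + g"]) (simp add: act_add act_smult)
  qed
qed (auto intro: gspan_base)

text \<open>If \<open>m\<close> did not annihilate some \<open>v\<close>, some prime power would divide the order of \<open>v\<close> to a
  higher exponent than that of \<open>e\<close>, and trading the \<open>p\<close>-parts would give a vector of larger order.\<close>

lemma max_ord_poly_annihilates:
  assumes W: "invariant W" and e: "e \<in> W" and m: "ord_poly e m"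
    and max: "\<And>e' m'. e' \<in> W \<Longrightarrow> ord_poly e' m' \<Longrightarrow> degree m' \<le> degree m"
    and v: "v \<in> W"
  shows "act m v = 0"
proof (rule ccontr)
  assume nz: "act m v \<noteq> 0"
  obtain n where n: "ord_poly v n" using ex_ord_poly by blast
  with nz have nm: "\<not> n dvd m" by (simp add: ord_poly_def)
  obtain d s t where d: "d = s * n + t * m" "d \<noteq> 0" "d dvd n" "d dvd m"
    using poly_bezout[OF ord_poly_nonzero[OF n]] by blast
  obtain h where h: "n = d * h" using d by blast
  \<comment> \<open>Up to a unit, \<open>d\<close> is the gcd of \<open>n\<close> and
    \<open>m\<close>. As \<open>n\<close> does not divide \<open>m\<close>, the quotient
    \<open>h = n / d\<close> is not constant, and a prime factor of it occurs in \<open>n\<close> to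
    a higher power than in \<open>m\<close>.\<close>
  have "degree h > 0"
  proof (rule ccontr)
    assume "\<not> degree h > 0"
    then obtain c where "h = [:c:]" by (auto elim: degree_eq_zeroE)
    moreover have "h \<noteq> 0" using h ord_poly_nonzero[OF n] by auto
    ultimately have "n dvd d" using h by (simp add: smult_dvd_iff)
    with d nm show False by (meson dvd_trans)
  qed
  then obtain p where p: "degree p > 0" "p dvd h" and co: "\<And>g. \<not> p dvd g \<Longrightarrow> comaximal p g"
    using ex_prime_factor by blast
  obtain k m1 where m1: "m = p ^ k * m1" "\<not> p dvd m1"
    using split_power[OF ord_poly_nonzero[OF m] p(1)] by blast
  obtain l n1 where n1: "n = p ^ l * n1" "\<not> p dvd n1"
    using split_power[OF ord_poly_nonzero[OF n] p(1)] by blast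
  have p0: "p \<noteq> 0" using p by auto
  have "k < l"
  proof (rule ccontr)
    assume "\<not> k < l"
    then have "p ^ l dvd m" using m1 by (simp add: dvd_mult2 le_imp_power_dvd)
    moreover have "p ^ l dvd n" using n1 by simp
    ultimately have "p ^ l dvd d" using d by simp
    with p have "p ^ l * p dvd n" using h by (simp add: mult_dvd_mono)
    with n1 p0 show False by simp
  qed
  \<comment> \<open>\<open>e'\<close> has order \<open>m1\<close> and \<open>v'\<close> has order
    \<open>p ^ l\<close>. These are coprime, so every annihilator of \<open>e' + v'\<close> is a
    multiple of \<open>m1 * p ^ l\<close>, whose degree exceeds that of \<open>m\<close> because
    \<open>k < l\<close>.\<close>
  define e' where "e' = act (p ^ k) e"
  define v' where "v' = act n1 v"
  have mono: "comaximal m1 (p ^ l)"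
    using co[OF m1(2)] by (metis comaximal_commute comaximal_power)
  obtain f where f: "ord_poly (e' + v') f" using ex_ord_poly by blast
  have "e' + v' \<in> W"
    unfolding e'_def v'_def using W e v invariant_act by (auto simp: invariant_def intro: subspace_add)
  then have "degree f \<le> degree m" using max f by blast
  moreover have "act f (e' + v') = 0" using f by (simp add: ord_poly_def)
  then have fe: "act f e' + act f v' = 0" by (simp add: act_plus)
  have v'0: "act (p ^ l) v' = 0" unfolding v'_def
    using n n1 by (simp add: ord_poly_def flip: act_mult)
  have e'0: "act m1 e' = 0" unfolding e'_def
    using m m1 by (simp add: ord_poly_def mult.commute flip: act_mult)
  have "m1 dvd f"
  proof -
    have "act (p ^ l) (act f e' + act f v') = 0" by (simp add: fe)
    then have "act (p ^ l) (act f e') = 0"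
      by (simp add: act_plus act_mult_commute[of "p ^ l" f v'] v'0)
    then have "act (p ^ l * f * p ^ k) e = 0" by (simp add: e'_def act_mult)
    then have "m dvd p ^ l * f * p ^ k" using m by (simp add: ord_poly_def)
    then have "p ^ k * m1 dvd p ^ k * (p ^ l * f)" by (simp add: m1 mult_ac)
    then have "m1 dvd p ^ l * f" using p0 by simp
    then show ?thesis using mono comaximal_dvd_mult by blast
  qed
  moreover have "p ^ l dvd f"
  proof -
    have "act m1 (act f e' + act f v') = 0" by (simp add: fe)
    then have "act m1 (act f v') = 0"
      by (simp add: act_plus act_mult_commute[of m1 f e'] e'0)
    then have "act (m1 * f * n1) v = 0" by (simp add: v'_def act_mult)
    then have "n dvd m1 * f * n1" using n by (simp add: ord_poly_def)
    then have "n1 * p ^ l dvd n1 * (m1 * f)" by (simp add: n1 mult_ac)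
    moreover have "n1 \<noteq> 0" using n1 by auto
    ultimately have "p ^ l dvd m1 * f" by simp
    then show ?thesis using mono comaximal_dvd_mult comaximal_commute by blast
  qed
  ultimately have "m1 * p ^ l dvd f" using mono comaximal_mult_dvd by blast
  then have "degree (m1 * p ^ l) \<le> degree f"
    using ord_poly_nonzero[OF f] by (rule dvd_imp_degree_le)
  moreover have "m1 \<noteq> 0" using m1 by auto
  then have "degree (m1 * p ^ l) = degree m1 + l * degree p" "degree m = k * degree p + degree m1"
    using p0 by (simp_all add: m1(1) degree_mult_eq degree_power_eq)
  moreover have "k * degree p < l * degree p" using \<open>k < l\<close> p(1) by simp
  ultimately show False using \<open>degree f \<le> degree m\<close> by linarith
qed

text \<open>The coordinate of the highest independent iterate of \<open>e\<close>, in a basis that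
  extends the iterates. The values of \<open>\<phi>\<close> on \<open>(u ^^ (i + j)) e\<close> then
  form an anti-triangular, hence invertible, matrix, which is what makes a complement of
  \<open>gspan {e}\<close> possible.\<close>

lemma ex_cyclic_functional:
  assumes m: "ord_poly e m" and d: "degree m = Suc d"
  shows "\<exists>\<phi>. (\<forall>x y. \<phi> (x + y) = \<phi> x + \<phi> y) \<and> (\<forall>c x. \<phi> (c *s x) = c * \<phi> x) \<and>
    \<phi> ((u ^^ d) e) = 1 \<and> (\<forall>i<d. \<phi> ((u ^^ i) e) = 0)"
proof -
  let ?g = "\<lambda>i. (u ^^ i) e"
  have g: "inj_on ?g {..<Suc d} \<and> independent (?g ` {..<Suc d})"
    by (rule family_indepI) (use ord_poly_indep[OF m d[symmetric]] in auto)
  define B where "B = extend_basis (?g ` {..<Suc d})"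
  have B: "independent B" "span B = UNIV" "?g ` {..<Suc d} \<subseteq> B"
    unfolding B_def using g by (auto simp: independent_extend_basis extend_basis_superset subset_iff
      dest: subsetD[OF extend_basis_superset])
  define \<phi> where "\<phi> x = representation B x (?g d)" for x
  have "\<phi> (x + y) = \<phi> x + \<phi> y" "\<phi> (c *s x) = c * \<phi> x" for x y c
    using B by (simp_all add: \<phi>_def representation_add representation_scale)
  moreover have "\<phi> (?g i) = (if i = d then 1 else 0)" if "i < Suc d" for i
  proof -
    have "?g i \<in> B" using that B by blast
    moreover have "?g d = ?g i \<longleftrightarrow> i = d" using g that by (auto dest: inj_onD)
    ultimately show ?thesis using B by (simp add: \<phi>_def representation_basis)
  qed
  ultimately show ?thesis by (intro exI[of _ \<phi>]) simp
qed

text \<open>The complement is the largest invariant subspace of \<open>W\<close> inside the kernel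
  of \<open>\<phi>\<close>. Since \<open>m\<close> kills \<open>W\<close>, the conditions with
  \<open>i \<le> d\<close> imply all the others, so there are exactly as many as the dimension of
  \<open>gspan {e}\<close>.\<close>

lemma cyclic_complement:
  assumes W: "invariant W" and e: "e \<in> W" and m: "ord_poly e m" and d: "degree m = Suc d"
    and ann: "\<And>x. x \<in> W \<Longrightarrow> act m x = 0"
  shows "\<exists>W'. invariant W' \<and> W' \<subseteq> W \<and> gspan {e} \<inter> W' = {0} \<and>
    W = {x + y | x y. x \<in> gspan {e} \<and> y \<in> W'}"
proof -
  obtain \<phi> where add: "\<And>x y. \<phi> (x + y) = \<phi> x + \<phi> y" and scale: "\<And>c x. \<phi> (c *s x) = c * \<phi> x"
    and 1: "\<phi> ((u ^^ d) e) = 1" and 0: "\<And>i. i < d \<Longrightarrow> \<phi> ((u ^^ i) e) = 0"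
    using ex_cyclic_functional[OF m d] by blast
  have zero: "\<phi> 0 = 0" using scale[of 0 0] by simp
  have sum: "\<phi> (\<Sum>i\<in>I. f i) = (\<Sum>i\<in>I. \<phi> (f i))" for I and f :: "nat \<Rightarrow> 'b"
    by (induction I rule: infinite_finite_induct) (simp_all add: zero add)
  have diff: "\<phi> (x - y) = \<phi> x - \<phi> y" for x y
    using add[of "x - y" y] by simp
  define W' where "W' = {x \<in> W. \<forall>i. \<phi> ((u ^^ i) x) = 0}"
  have sW: "subspace W" using W by (simp add: invariant_def)
  have powadd: "(u ^^ i) (x + y) = (u ^^ i) x + (u ^^ i) y"
    and powscale: "(u ^^ i) (c *s x) = c *s (u ^^ i) x"
    and powdiff: "(u ^^ i) (x - y) = (u ^^ i) x - (u ^^ i) y"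
    and pow0: "(u ^^ i) 0 = 0" for i x y c
    using module_hom.add[OF pow_hom] module_hom.scale[OF pow_hom] module_hom.diff[OF pow_hom]
      module_hom.zero[OF pow_hom] by auto
  have inv: "invariant W'"
    unfolding invariant_def
  proof (intro conjI ballI)
    show "subspace W'"
      by (rule subspaceI) (use sW in \<open>auto simp: W'_def pow0 zero powadd add powscale scale
        intro: subspace_0 subspace_add subspace_scale\<close>)
    fix x assume "x \<in> W'"
    then have "\<phi> ((u ^^ Suc i) x) = 0" for i unfolding W'_def by blast
    then have "\<phi> ((u ^^ i) (u x)) = 0" for i by (simp add: funpow_swap1)
    then show "u x \<in> W'" using W \<open>x \<in> W'\<close> by (simp add: W'_def invariant_def)
  qed
  have int: "x = 0" if "x \<in> gspan {e}" "x \<in> W'" for x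
  proof -
    obtain f0 where "x = act f0 e" using \<open>x \<in> gspan {e}\<close> gspan_single_cases by blast
    define f where "f = f0 mod m"
    have xf: "x = act f e"
      using m by (simp add: f_def \<open>x = _\<close> act_mod ord_poly_def)
    have fd: "f = 0 \<or> degree f < degree m"
      using degree_mod_less[of m f0] ord_poly_nonzero[OF m] by (auto simp: f_def)
    show ?thesis
    proof (cases "f = 0")
      case False
      let ?j = "degree f"
      have j: "?j \<le> d" using fd False d by simp
      \<comment> \<open>The shift by \<open>d - ?j\<close> moves the leading term of
        \<open>f\<close> to the \<open>d\<close>-th iterate, the only one on which
        \<open>\<phi>\<close> does not vanish, so \<open>\<phi>\<close> reads off the leading
        coefficient.\<close>
      have "(u ^^ (d - ?j)) x = act (Polynomial.monom 1 (d - ?j)) (act f e)"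
        by (simp add: act_monom xf)
      also have "\<dots> = act f ((u ^^ (d - ?j)) e)"
        by (subst act_mult_commute) (simp add: act_monom)
      also have "\<dots> = (\<Sum>i\<le>?j. Polynomial.coeff f i *s (u ^^ (i + (d - ?j))) e)"
        by (simp add: poly_endo_def funpow_add)
      finally have "\<phi> ((u ^^ (d - ?j)) x) = (\<Sum>i\<le>?j. Polynomial.coeff f i * \<phi> ((u ^^ (i + (d - ?j))) e))"
        by (simp add: sum scale)
      also have "\<dots> = (\<Sum>i\<in>{?j}. Polynomial.coeff f i * \<phi> ((u ^^ (i + (d - ?j))) e))"
        using j by (intro sum.mono_neutral_right) (auto intro!: 0)
      also have "\<dots> = lead_coeff f" using j 1 by simp
      finally have "lead_coeff f = 0" using that by (simp add: W'_def)
      with False show ?thesis by simp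
    qed (simp add: xf)
  qed
  \<comment> \<open>The conditions are solved one after the other: a term of degree
    \<open>d - k\<close> corrects the \<open>k\<close>-th and leaves the earlier ones alone, since
    \<open>i + (d - k) < d\<close> for \<open>i < k\<close>.\<close>
  have solve: "\<exists>f. \<forall>i<k. \<phi> ((u ^^ i) (x - act f e)) = 0" if "k \<le> Suc d" for k x
    using that
  proof (induction k)
    case (Suc k)
    then obtain f where f: "\<And>i. i < k \<Longrightarrow> \<phi> ((u ^^ i) (x - act f e)) = 0" by auto
    define c where "c = \<phi> ((u ^^ k) (x - act f e))"
    let ?f = "f + Polynomial.monom c (d - k)"
    have step: "(u ^^ i) (x - act ?f e) = (u ^^ i) (x - act f e) - c *s (u ^^ (i + (d - k))) e" for i
      by (simp add: act_add act_monom powdiff powadd powscale funpow_add diff_diff_eq)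
    have "\<phi> ((u ^^ i) (x - act ?f e)) = 0" if i: "i < Suc k" for i
    proof (cases "i = k")
      case True
      then show ?thesis using Suc.prems 1 by (simp add: step diff scale flip: c_def)
    next
      case False
      with i have "i < k" by simp
      with Suc.prems have "i + (d - k) < d" by simp
      then show ?thesis using f[OF \<open>i < k\<close>] 0 by (simp add: step diff scale)
    qed
    then show ?case by blast
  qed simp
  have "\<exists>y\<in>gspan {e}. \<exists>z\<in>W'. x = y + z" if x: "x \<in> W" for x
  proof -
    obtain f where f: "\<And>i. i < Suc d \<Longrightarrow> \<phi> ((u ^^ i) (x - act f e)) = 0" using solve[of "Suc d" x] by auto
    let ?t = "x - act f e"
    have t: "?t \<in> W" using W x e sW by (auto intro: subspace_diff invariant_act)
    \<comment> \<open>Reduction modulo \<open>m\<close>, which kills \<open>?t\<close>, expresses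
      every iterate by the first \<open>Suc d\<close> ones.\<close>
    have "\<phi> ((u ^^ i) ?t) = 0" for i
    proof -
      have "(u ^^ i) ?t = act (Polynomial.monom 1 i mod m) ?t"
        using ann[OF t] by (simp only: act_mod) (simp add: act_monom)
      also have "\<dots> = (\<Sum>j<Suc d. Polynomial.coeff (Polynomial.monom 1 i mod m) j *s (u ^^ j) ?t)"
        using degree_mod_less[of m "Polynomial.monom 1 i"] ord_poly_nonzero[OF m] d
        by (intro act_altdef_less) auto
      finally show ?thesis using f by (simp add: sum scale del: sum.lessThan_Suc)
    qed
    with t have "?t \<in> W'" by (simp add: W'_def)
    moreover have "act f e \<in> gspan {e}" by (rule gspan_base) simp
    ultimately show ?thesis by (metis add.commute diff_add_cancel)
  qed
  moreover have "W' \<subseteq> W" by (auto simp: W'_def)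
  moreover have "gspan {e} \<subseteq> W" using e W by (intro gspan_minimal) auto
  ultimately have "W = {x + y | x y. x \<in> gspan {e} \<and> y \<in> W'}"
    by (intro equalityI subsetI) (blast, use sW subspace_add in blast)
  moreover have "gspan {e} \<inter> W' = {0}"
    using int inv gspan_invariant[of "{e}"] by (auto simp: invariant_def intro: subspace_0)
  ultimately show ?thesis using inv \<open>W' \<subseteq> W\<close> by blast
qed

text \<open>A vector whose order \<open>m\<close> has maximal degree is split off, and the
  complement is treated by induction on the dimension. As \<open>m\<close> annihilates all of
  \<open>W\<close>, it is a multiple of every order found later, which gives the divisibility
  chain.\<close>

theorem ex_invariant_decomposition:
  assumes "invariant W"
  shows "\<exists>ers. dec ers W \<and> (\<forall>(e, r)\<in>set ers. ord_poly e r) \<and>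
    sorted_wrt (\<lambda>x y. snd y dvd snd x) ers"
  using assms
proof (induction "dim W" arbitrary: W rule: less_induct)
  case less
  have W: "invariant W" and sW: "subspace W" using less.prems by (auto simp: invariant_def)
  show ?case
  proof (cases "W = {0}")
    case True
    have "dec [] W" using True dim_insert[of 0 "{}"] by (simp add: dec_def gspan_def)
    then show ?thesis by (intro exI[of _ "[]"]) simp
  next
    case False
    let ?P = "\<lambda>x. fst x \<in> W \<and> ord_poly (fst x) (snd x)"
    obtain m0 where "ord_poly 0 m0" using ex_ord_poly by blast
    then have "?P (0, m0)" using sW by (simp add: subspace_0)
    moreover have "\<forall>y. ?P y \<longrightarrow> degree (snd y) < Suc (dim (UNIV :: 'b set))"
      using ord_poly_degree_le by (auto simp: less_Suc_eq_le)
    ultimately obtain em where em: "?P em" and max: "\<And>y. ?P y \<Longrightarrow> degree (snd y) \<le> degree (snd em)"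
      using ex_has_greatest_nat[of ?P _ "\<lambda>x. degree (snd x)"] by blast
    obtain e m where "em = (e, m)" by (cases em)
    with em max have e: "e \<in> W" and m: "ord_poly e m"
      and max: "\<And>e' m'. e' \<in> W \<Longrightarrow> ord_poly e' m' \<Longrightarrow> degree m' \<le> degree m"
      by auto
    have ann: "act m x = 0" if "x \<in> W" for x
      by (rule max_ord_poly_annihilates[OF W e m max that])
    have "degree m \<noteq> 0"
    proof
      assume "degree m = 0"
      then have "m = 1" using m by (metis ord_poly_def monic_degree_0)
      with ann have "W \<subseteq> {0}" by auto
      with False sW subspace_0 show False by blast
    qed
    then obtain d where d: "degree m = Suc d" by (cases "degree m") auto
    obtain W' where W': "invariant W'" "W' \<subseteq> W" and int: "gspan {e} \<inter> W' = {0}"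
      and sum: "W = {x + y | x y. x \<in> gspan {e} \<and> y \<in> W'}"
      using cyclic_complement[OF W e m d ann] by blast
    have me: "act m e = 0" using ann e by blast
    have dimE: "dim (gspan {e}) = degree m"
      by (subst family_dim[of "{..<degree m}" "\<lambda>i. (u ^^ i) e"])
         (use ord_poly_indep[OF m refl] gspan_single[OF me ord_poly_nonzero[OF m]] in auto)
    have "dim W + dim {0} = dim (gspan {e}) + dim W'"
      using dim_sums_Int[of "gspan {e}" W'] gspan_invariant[of "{e}"] W'
      by (simp add: sum[symmetric] int invariant_def)
    then have dim: "dim W = degree m + dim W'" by (simp add: dimE)
    then obtain ers where ers: "dec ers W'" "\<forall>(e, r)\<in>set ers. ord_poly e r"
      "sorted_wrt (\<lambda>x y. snd y dvd snd x) ers"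
      using less.hyps[of W'] W' d by auto
    have gW': "gspan (fst ` set ers) = W'" using ers by (simp add: dec_def)
    have "gspan (insert e (fst ` set ers)) = W"
    proof
      show "gspan (insert e (fst ` set ers)) \<subseteq> W"
        using W e W' gspan_superset[of "fst ` set ers"] gW' by (intro gspan_minimal) auto
      have "gspan {e} \<subseteq> gspan (insert e (fst ` set ers))" "W' \<subseteq> gspan (insert e (fst ` set ers))"
        using gW' gspan_mono[of "{e}" "insert e (fst ` set ers)"]
          gspan_mono[of "fst ` set ers" "insert e (fst ` set ers)"] by auto
      then show "W \<subseteq> gspan (insert e (fst ` set ers))"
        using sum by (auto intro: gspan_add)
    qed
    then have "dec ((e, m) # ers) W"
      using ers m dim by (auto simp: dec_def ord_poly_def)
    moreover have "r dvd m" if "(e', r) \<in> set ers" for e' r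
    proof -
      have "e' \<in> W" using that W' gW' gspan_superset[of "fst ` set ers"] by force
      then have "act m e' = 0" by (rule ann)
      then show ?thesis using ers(2) that by (auto simp: ord_poly_def)
    qed
    ultimately show ?thesis using ers m by (intro exI[of _ "(e, m) # ers"]) auto
  qed
qed

end

section \<open>Block-diagonal matrices of companion matrices\<close>

lemma sum_lessThan_add:
  fixes h :: "nat \<Rightarrow> 'a::comm_monoid_add"
  shows "(\<Sum>i<m + n. h i) = (\<Sum>i<m. h i) + (\<Sum>i<n. h (m + i))"
  by (induction n) (simp_all add: add.assoc)

lemma companion_mat_carrier: "companion_mat r \<in> carrier_mat (degree r) (degree r)"
  by (simp add: companion_mat_def)

context fd_endo
begin

definition pow_index :: "('b \<times> 'a poly) list \<Rightarrow> (nat \<times> nat) set" where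
  "pow_index ers = (SIGMA i:{..<length ers}. {..<degree (snd (ers ! i))})"

definition pow_family :: "('b \<times> 'a poly) list \<Rightarrow> nat \<times> nat \<Rightarrow> 'b" where
  "pow_family ers = (\<lambda>(i, j). (u ^^ j) (fst (ers ! i)))"

lemma decD:
  assumes "dec ers W" "i < length ers"
  shows "lead_coeff (snd (ers ! i)) = 1" "act (snd (ers ! i)) (fst (ers ! i)) = 0" "snd (ers ! i) \<noteq> 0"
proof -
  obtain e r where er: "ers ! i = (e, r)" by (cases "ers ! i")
  then have "(e, r) \<in> set ers" using assms(2) by (metis nth_mem)
  then have "lead_coeff r = 1 \<and> act r e = 0" using assms(1) by (auto simp: dec_def)
  then show "lead_coeff (snd (ers ! i)) = 1" "act (snd (ers ! i)) (fst (ers ! i)) = 0" "snd (ers ! i) \<noteq> 0"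
    by (auto simp: er)
qed

lemma finite_pow_index: "finite (pow_index ers)"
  by (simp add: pow_index_def)

lemma span_pow_family:
  assumes "dec ers W"
  shows "span (pow_family ers ` pow_index ers) = W"
proof
  have W: "gspan (fst ` set ers) = W" using assms by (simp add: dec_def)
  have "pow_family ers k \<in> W" if k: "k \<in> pow_index ers" for k
  proof -
    obtain i j where k: "k = (i, j)" "i < length ers"
      using k by (auto simp: pow_index_def)
    have "act (Polynomial.monom 1 j) (fst (ers ! i)) \<in> gspan (fst ` set ers)"
      using k by (intro gspan_base) simp
    then show ?thesis using W by (simp add: k pow_family_def act_monom)
  qed
  then show "span (pow_family ers ` pow_index ers) \<subseteq> W"
    using gspan_invariant[of "fst ` set ers"] W by (intro span_minimal) (auto simp: invariant_def)
  have "act f e \<in> span (pow_family ers ` pow_index ers)" if e: "e \<in> fst ` set ers" for f e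
  proof -
    obtain i where i: "i < length ers" "e = fst (ers ! i)"
      using e by (metis imageE in_set_conv_nth)
    have "act f e \<in> span ((\<lambda>j. (u ^^ j) e) ` {..<degree (snd (ers ! i))})"
      using decD[OF assms i(1)] i(2) by (intro act_in_span_powers) auto
    also have "\<dots> \<subseteq> span (pow_family ers ` pow_index ers)"
    proof (rule span_mono, safe)
      fix j assume "j < degree (snd (ers ! i))"
      then have "(i, j) \<in> pow_index ers" using i by (simp add: pow_index_def)
      moreover have "(u ^^ j) e = pow_family ers (i, j)" by (simp add: i pow_family_def)
      ultimately show "(u ^^ j) e \<in> pow_family ers ` pow_index ers" by blast
    qed
    finally show ?thesis .
  qed
  then have "gspan (fst ` set ers) \<subseteq> span (pow_family ers ` pow_index ers)"
    unfolding gspan_def by (intro span_minimal) auto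
  then show "W \<subseteq> span (pow_family ers ` pow_index ers)" using W by simp
qed

lemma card_pow_index:
  assumes "dec ers W"
  shows "card (pow_index ers) = dim W"
proof -
  have "card (pow_index ers) = (\<Sum>i<length ers. degree (snd (ers ! i)))"
    by (simp add: pow_index_def)
  also have "\<dots> = (\<Sum>(e, r)\<leftarrow>ers. degree r)"
    by (simp add: sum_list_sum_nth case_prod_beta atLeast0LessThan)
  finally show ?thesis using assms by (simp add: dec_def)
qed

lemma sum_pow_index:
  "(\<Sum>k\<in>pow_index ers. c k *s pow_family ers k) =
     (\<Sum>i<length ers. \<Sum>j<degree (snd (ers ! i)). c (i, j) *s (u ^^ j) (fst (ers ! i)))"
  unfolding pow_index_def
  by (subst sum.Sigma) (auto simp: pow_family_def intro!: sum.cong)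

text \<open>The iterates counted by the degrees span \<open>W\<close> and number
  \<open>dim W\<close>, so they form a basis. After reduction of each \<open>f i\<close> modulo its
  annihilator, the hypothesis becomes a relation in that basis. This recovers the directness
  implicit in \<open>dec\<close>.\<close>

lemma dec_indep:
  assumes d: "dec ers W" and s: "(\<Sum>i<length ers. act (f i) (fst (ers ! i))) = 0"
    and i: "i < length ers"
  shows "snd (ers ! i) dvd f i"
proof -
  let ?r = "\<lambda>i. snd (ers ! i)" and ?e = "\<lambda>i. fst (ers ! i)"
  define c where "c = (\<lambda>(i, j). Polynomial.coeff (f i mod ?r i) j)"
  have g: "inj_on (pow_family ers) (pow_index ers) \<and> independent (pow_family ers ` pow_index ers)"
    by (rule family_basis[where W = W])
       (simp_all add: finite_pow_index span_pow_family[OF d] card_pow_index[OF d])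
  have mod: "act (f i) (?e i) = (\<Sum>j<degree (?r i). c (i, j) *s (u ^^ j) (?e i))"
    if "i < length ers" for i
  proof -
    have "act (f i) (?e i) = act (f i mod ?r i) (?e i)"
      using decD[OF d that] by (simp add: act_mod)
    also have "\<dots> = (\<Sum>j<degree (?r i). c (i, j) *s (u ^^ j) (?e i))"
      using degree_mod_less[of "?r i" "f i"] decD[OF d that]
      by (subst act_altdef_less[of _ "degree (?r i)"]) (auto simp: c_def)
    finally show ?thesis .
  qed
  have "(\<Sum>k\<in>pow_index ers. c k *s pow_family ers k) = 0"
    using s mod by (simp add: sum_pow_index)
  then have c0: "c k = 0" if "k \<in> pow_index ers" for k
    using family_indepD[OF finite_pow_index _ _ _ that] g by blast
  have "f i mod ?r i = 0"
  proof (rule ccontr)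
    assume nz: "f i mod ?r i \<noteq> 0"
    then have "degree (f i mod ?r i) < degree (?r i)"
      using degree_mod_less[of "?r i" "f i"] decD[OF d i] by auto
    then have "c (i, degree (f i mod ?r i)) = 0" using i by (intro c0) (simp add: pow_index_def)
    then show False using nz by (simp add: c_def)
  qed
  then show ?thesis by (simp add: mod_eq_0_iff_dvd)
qed

lemma dec_ex_coeffs:
  assumes "dec ers UNIV"
  shows "\<exists>f. x = (\<Sum>i<length ers. act (f i) (fst (ers ! i)))"
proof -
  have "x \<in> span (pow_family ers ` pow_index ers)" using span_pow_family[OF assms] by simp
  then obtain c where "x = (\<Sum>k\<in>pow_index ers. c k *s pow_family ers k)"
    using span_family[OF finite_pow_index] by blast
  then have "x = (\<Sum>i<length ers. act (\<Sum>j<degree (snd (ers ! i)). Polynomial.monom (c (i, j)) j) (fst (ers ! i)))"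
    by (simp add: sum_pow_index act_sum_monom)
  then show ?thesis
    by (intro exI[of _ "\<lambda>i. \<Sum>j<degree (snd (ers ! i)). Polynomial.monom (c (i, j)) j"])
qed

text \<open>Each summand may be refined on its own: old and new generators must generate each other
  and the degrees must add up. This serves for the Chinese remainder splitting and for the removal
  of trivial summands.\<close>

lemma dec_refine:
  assumes d: "dec ers W"
    and F: "\<And>e r. (e, r) \<in> set ers \<Longrightarrow>
      (\<forall>(e', r')\<in>set (F (e, r)). lead_coeff r' = 1 \<and> act r' e' = 0 \<and> e' \<in> gspan {e}) \<and>
      e \<in> gspan (fst ` set (F (e, r))) \<and> (\<Sum>(e', r')\<leftarrow>F (e, r). degree r') = degree r"
  shows "dec (concat (map F ers)) W"
proof -
  have W: "gspan (fst ` set ers) = W" using d by (simp add: dec_def)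
  let ?G = "gspan (fst ` set (concat (map F ers)))"
  have "e' \<in> W" if "x \<in> set ers" "(e', r') \<in> set (F x)" for x e' r'
  proof -
    obtain e r where x: "x = (e, r)" by (cases x)
    then have "e' \<in> gspan {e}" using F[of e r] that by blast
    also have "\<dots> \<subseteq> W" unfolding W[symmetric] using that x by (intro gspan_mono) force
    finally show ?thesis .
  qed
  then have "?G \<subseteq> W" using gspan_invariant[of "fst ` set ers"] W by (intro gspan_minimal) auto
  moreover have "e \<in> ?G" if "(e, r) \<in> set ers" for e r
  proof -
    have "e \<in> gspan (fst ` set (F (e, r)))" using F[OF that] by blast
    also have "\<dots> \<subseteq> ?G" using that by (intro gspan_mono) force
    finally show ?thesis .
  qed
  then have "W \<subseteq> ?G" unfolding W[symmetric] by (intro gspan_le) auto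
  moreover have "(\<Sum>(e, r)\<leftarrow>concat (map F ers). degree r) = dim W"
  proof -
    have "map (\<lambda>x. \<Sum>(e, r)\<leftarrow>F x. degree r) ers = map (\<lambda>(e, r). degree r) ers"
      using F by (intro map_cong) auto
    moreover have "(\<Sum>(e, r)\<leftarrow>concat (map F ers). degree r) = (\<Sum>x\<leftarrow>ers. \<Sum>(e, r)\<leftarrow>F x. degree r)"
      by (induction ers) simp_all
    ultimately have "(\<Sum>(e, r)\<leftarrow>concat (map F ers). degree r) = (\<Sum>(e, r)\<leftarrow>ers. degree r)"
      by (simp only:)
    then show ?thesis using d by (simp add: dec_def)
  qed
  moreover have "\<forall>(e', r')\<in>set (concat (map F ers)). lead_coeff r' = 1 \<and> act r' e' = 0"
    using F by fastforce
  ultimately show ?thesis unfolding dec_def by blast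
qed

lemma gspan_comaximal_split:
  assumes "comaximal f g"
  shows "e \<in> gspan {act g e, act f e}"
proof -
  obtain s t where st: "s * f + t * g = 1" using assms by (auto simp: comaximal_def)
  have "e = act (s * f + t * g) e" by (simp add: st)
  also have "\<dots> = act s (act f e) + act t (act g e)" by (simp add: act_add act_mult)
  also have "\<dots> \<in> gspan {act g e, act f e}" by (intro gspan_add gspan_base) auto
  finally show ?thesis .
qed

text \<open>With \<open>s * r1 + t * r2 = 1\<close>, the polynomial \<open>t * r2\<close> acts as
  the identity on \<open>e1\<close> and kills \<open>e2\<close>, and \<open>s * r1\<close> does the
  opposite.\<close>

lemma gspan_comaximal_merge:
  assumes co: "comaximal r1 r2" and 1: "act r1 e1 = 0" and 2: "act r2 e2 = 0"
  shows "e1 \<in> gspan {e1 + e2}" "e2 \<in> gspan {e1 + e2}"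
proof -
  obtain s t where st: "s * r1 + t * r2 = 1" using co by (auto simp: comaximal_def)
  have "e1 = act (s * r1 + t * r2) e1" by (simp add: st)
  also have "\<dots> = act (t * r2) (e1 + e2)" by (simp add: act_add act_mult act_plus 1 2)
  finally show "e1 \<in> gspan {e1 + e2}" by (metis gspan_base singletonI)
  have "e2 = act (s * r1 + t * r2) e2" by (simp add: st)
  also have "\<dots> = act (s * r1) (e1 + e2)" by (simp add: act_add act_mult act_plus 1 2)
  finally show "e2 \<in> gspan {e1 + e2}" by (metis gspan_base singletonI)
qed

text \<open>The matrix relation alone, without a condition on \<open>bs\<close>, so that it passes
  to the segments of a basis that belong to the blocks of a matrix.\<close>

definition rep_on :: "'b list \<Rightarrow> 'a mat \<Rightarrow> bool" where
  "rep_on bs M \<longleftrightarrow> M \<in> carrier_mat (length bs) (length bs) \<and>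
     (\<forall>j<length bs. u (bs ! j) = (\<Sum>i<length bs. M $$ (i, j) *s bs ! i))"

lemma list_basis:
  assumes "span (set bs) = UNIV" "length bs = dim (UNIV :: 'b set)"
  shows "distinct bs" "independent (set bs)"
proof -
  have *: "(!) bs ` {..<length bs} = set bs" by (auto simp: set_conv_nth)
  then have "inj_on ((!) bs) {..<length bs} \<and> independent ((!) bs ` {..<length bs})"
    by (intro family_basis[where W = UNIV]) (use assms in auto)
  then show "distinct bs" "independent (set bs)"
    unfolding * by (auto simp: distinct_conv_nth dest: inj_onD)
qed

text \<open>Distinctness and independence are traded for a length condition, which is additive under
  concatenation of blocks.\<close>

lemma represents_iff:
  "represents scale u M \<longleftrightarrow>
     (\<exists>bs. rep_on bs M \<and> span (set bs) = UNIV \<and> length bs = dim (UNIV :: 'b set))"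
proof
  assume "represents scale u M"
  then obtain bs where bs: "distinct bs" "independent (set bs)" "span (set bs) = UNIV" "rep_on bs M"
    unfolding represents_def rep_on_def by blast
  moreover have "length bs = dim (UNIV :: 'b set)"
    using bs distinct_card dim_eq_card_independent dim_span by metis
  ultimately show "\<exists>bs. rep_on bs M \<and> span (set bs) = UNIV \<and> length bs = dim (UNIV :: 'b set)"
    by blast
next
  assume "\<exists>bs. rep_on bs M \<and> span (set bs) = UNIV \<and> length bs = dim (UNIV :: 'b set)"
  then show "represents scale u M"
    unfolding represents_def rep_on_def using list_basis by blast
qed

lemma rep_on_four_block:
  assumes "length bs1 = n1" "length bs2 = n2" and M: "M1 \<in> carrier_mat n1 n1" "M2 \<in> carrier_mat n2 n2"
  shows "rep_on (bs1 @ bs2) (four_block_mat M1 (0\<^sub>m n1 n2) (0\<^sub>m n2 n1) M2) \<longleftrightarrow>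
    rep_on bs1 M1 \<and> rep_on bs2 M2"
proof -
  let ?M = "four_block_mat M1 (0\<^sub>m n1 n2) (0\<^sub>m n2 n1) M2" and ?bs = "bs1 @ bs2"
  have sum1: "(\<Sum>i<n1 + n2. ?M $$ (i, j) *s ?bs ! i) = (\<Sum>i<n1. M1 $$ (i, j) *s bs1 ! i)" if "j < n1" for j
    using that assms by (simp add: sum_lessThan_add nth_append)
  have sum2: "(\<Sum>i<n1 + n2. ?M $$ (i, n1 + j) *s ?bs ! i) = (\<Sum>i<n2. M2 $$ (i, j) *s bs2 ! i)" if "j < n2" for j
    using that assms by (simp add: sum_lessThan_add nth_append)
  have bs1: "?bs ! j = bs1 ! j" if "j < n1" for j using that assms(1) by (simp add: nth_append)
  have bs2: "?bs ! (n1 + j) = bs2 ! j" for j using assms(1) by (simp add: nth_append)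
  have "(\<forall>j<n1 + n2. P j) \<longleftrightarrow> (\<forall>j<n1. P j) \<and> (\<forall>j<n2. P (n1 + j))" for P
    by (metis add_less_cancel_left le_add_diff_inverse not_less trans_less_add1)
  then have "(\<forall>j<n1 + n2. u (?bs ! j) = (\<Sum>i<n1 + n2. ?M $$ (i, j) *s ?bs ! i)) \<longleftrightarrow>
    (\<forall>j<n1. u (bs1 ! j) = (\<Sum>i<n1. M1 $$ (i, j) *s bs1 ! i)) \<and>
    (\<forall>j<n2. u (bs2 ! j) = (\<Sum>i<n2. M2 $$ (i, j) *s bs2 ! i))"
    by (simp add: sum1 sum2 bs1 bs2)
  then show ?thesis using assms by (simp add: rep_on_def)
qed

lemma rep_on_diag_block:
  "list_all2 rep_on bss Bs \<Longrightarrow> rep_on (concat bss) (diag_block_mat Bs)"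
proof (induction rule: list_all2_induct)
  case Nil
  then show ?case by (simp add: rep_on_def)
next
  case (Cons bs bss B Bs)
  then have "B \<in> carrier_mat (length bs) (length bs)"
    "diag_block_mat Bs \<in> carrier_mat (length (concat bss)) (length (concat bss))"
    by (simp_all add: rep_on_def)
  then show ?case using Cons rep_on_four_block[OF refl refl, of B bs "diag_block_mat Bs" "concat bss"]
    by (simp add: Let_def)
qed

lemma rep_on_diag_blockD:
  assumes "\<And>B. B \<in> set Bs \<Longrightarrow> square_mat B" "rep_on bs (diag_block_mat Bs)"
  shows "\<exists>bss. bs = concat bss \<and> list_all2 rep_on bss Bs"
  using assms
proof (induction Bs arbitrary: bs)
  case Nil
  then have "(diag_block_mat [] :: 'a mat) \<in> carrier_mat (length bs) (length bs)"
    unfolding rep_on_def by blast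
  from carrier_matD(1)[OF this, symmetric] have "bs = []" by simp
  then show ?case by (intro exI[of _ "[]"]) simp
next
  case (Cons B Bs)
  let ?D = "diag_block_mat Bs"
  define n1 n2 where "n1 = dim_row B" and "n2 = dim_row ?D"
  have B: "B \<in> carrier_mat n1 n1" using Cons.prems(1)[of B] by (auto simp: n1_def)
  have D: "?D \<in> carrier_mat n2 n2"
    using diag_block_mat_square[of Bs] Cons.prems(1) by (auto simp: n2_def)
  have rep: "rep_on bs (four_block_mat B (0\<^sub>m n1 n2) (0\<^sub>m n2 n1) ?D)"
    using Cons.prems(2) B D by (simp add: Let_def)
  then have "four_block_mat B (0\<^sub>m n1 n2) (0\<^sub>m n2 n1) ?D \<in> carrier_mat (length bs) (length bs)"
    unfolding rep_on_def by blast
  from carrier_matD(1)[OF this, symmetric] have len: "length bs = n1 + n2" using B D by simp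
  define bs1 bs2 where "bs1 = take n1 bs" and "bs2 = drop n1 bs"
  have rep12: "rep_on bs1 B" "rep_on bs2 ?D"
    using rep_on_four_block[of bs1 n1 bs2 n2 B ?D] B D rep len by (simp_all add: bs1_def bs2_def)
  obtain bss where bss: "bs2 = concat bss" "list_all2 rep_on bss Bs"
    using Cons.IH[OF _ rep12(2)] Cons.prems(1) by auto
  have "bs = bs1 @ bs2" by (simp add: bs1_def bs2_def)
  then have "bs = concat (bs1 # bss)" by (simp add: bss(1))
  moreover have "list_all2 rep_on (bs1 # bss) (B # Bs)" using rep12(1) bss(2) by simp
  ultimately show ?case by blast
qed

lemma represents_diag_block_iff:
  assumes "\<And>B. B \<in> set Bs \<Longrightarrow> square_mat B"
  shows "represents scale u (diag_block_mat Bs) \<longleftrightarrow>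
    (\<exists>bss. list_all2 rep_on bss Bs \<and> span (set (concat bss)) = UNIV \<and>
       length (concat bss) = dim (UNIV :: 'b set))"
  unfolding represents_iff using rep_on_diag_block rep_on_diag_blockD[OF assms] by metis

definition powers :: "'b \<Rightarrow> nat \<Rightarrow> 'b list" where
  "powers e n = map (\<lambda>j. (u ^^ j) e) [0..<n]"

lemma length_powers [simp]: "length (powers e n) = n"
  by (simp add: powers_def)

lemma set_powers: "set (powers e n) = (\<lambda>j. (u ^^ j) e) ` {..<n}"
  by (simp add: powers_def atLeast0LessThan)

lemma act_monic:
  assumes "lead_coeff r = 1"
  shows "act r e = (\<Sum>i<degree r. Polynomial.coeff r i *s (u ^^ i) e) + (u ^^ degree r) e"
  using assms by (simp add: poly_endo_def lessThan_Suc_atMost[symmetric])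

lemma rep_on_companion:
  assumes r: "lead_coeff r = 1" and e: "act r e = 0"
  shows "rep_on (powers e (degree r)) (companion_mat r)"
  unfolding rep_on_def length_powers
proof (intro conjI allI impI)
  show "companion_mat r \<in> carrier_mat (degree r) (degree r)" by (rule companion_mat_carrier)
  fix j assume j: "j < degree r"
  show "u (powers e (degree r) ! j) = (\<Sum>i<degree r. companion_mat r $$ (i, j) *s powers e (degree r) ! i)"
  proof (cases "Suc j = degree r")
    case True
    have "u ((u ^^ j) e) = (u ^^ Suc j) e" by simp
    also have "\<dots> = (u ^^ degree r) e" by (simp only: True)
    also have "\<dots> = - (\<Sum>i<degree r. Polynomial.coeff r i *s (u ^^ i) e)"
      using e act_monic[OF r] by (simp add: add_eq_0_iff add.commute)
    finally show ?thesis using j True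
      by (simp add: powers_def companion_mat_def sum_negf)
  next
    case False
    have "(\<Sum>i<degree r. companion_mat r $$ (i, j) *s powers e (degree r) ! i) =
      (\<Sum>i\<in>{Suc j}. companion_mat r $$ (i, j) *s powers e (degree r) ! i)"
      using j False by (intro sum.mono_neutral_right) (auto simp: companion_mat_def)
    then show ?thesis using j False by (simp add: powers_def companion_mat_def)
  qed
qed

text \<open>The ones below the diagonal make each vector the image of its predecessor, so the list
  consists of the iterates of its head; the last column then says that \<open>r\<close> kills the
  head.\<close>

lemma rep_on_companionD:
  assumes r: "lead_coeff r = 1" and rep: "rep_on bs (companion_mat r)"
  shows "\<exists>e. bs = powers e (degree r) \<and> act r e = 0"
proof (cases "degree r = 0")
  case True
  then have "r = 1" using r by (rule monic_degree_0[THEN iffD1, rotated])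
  moreover have "bs = []" using rep True companion_mat_carrier[of r]
    by (metis carrier_matD(1) length_0_conv rep_on_def)
  \<comment> \<open>For \<open>r = 1\<close> the list is empty and the condition
    \<open>act r e = 0\<close> leaves only the witness 0.\<close>
  ultimately show ?thesis by (intro exI[of _ 0]) (simp add: powers_def)
next
  case False
  let ?d = "degree r"
  have len: "length bs = ?d" using rep companion_mat_carrier[of r] by (metis carrier_matD(1) rep_on_def)
  have u: "u (bs ! j) = (\<Sum>i<?d. companion_mat r $$ (i, j) *s bs ! i)" if "j < ?d" for j
    using rep that len by (simp add: rep_on_def)
  define e where "e = bs ! 0"
  have pow: "bs ! j = (u ^^ j) e" if "j < ?d" for j
    using that
  proof (induction j)
    case (Suc j)
    have "u (bs ! j) = (\<Sum>i\<in>{Suc j}. companion_mat r $$ (i, j) *s bs ! i)"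
      using Suc.prems by (subst u, simp, intro sum.mono_neutral_right) (auto simp: companion_mat_def)
    then show ?case using Suc by (simp add: companion_mat_def)
  qed (simp add: e_def)
  obtain d where d: "?d = Suc d" using False by (cases ?d) auto
  have "(u ^^ ?d) e = u (bs ! d)" using d pow[of d] by simp
  also have "\<dots> = - (\<Sum>i<?d. Polynomial.coeff r i *s (u ^^ i) e)"
    using d pow by (subst u) (simp_all add: companion_mat_def sum_negf[symmetric] del: sum.lessThan_Suc)
  finally have "act r e = 0" by (simp add: act_monic[OF r])
  moreover have "bs = powers e ?d"
    by (rule nth_equalityI) (use len pow in \<open>auto simp: powers_def\<close>)
  ultimately show ?thesis by blast
qed

lemma powers_subset_gspan: "set (powers e n) \<subseteq> gspan {e}"
proof -
  have "(u ^^ j) e \<in> gspan {e}" for j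
    using gspan_base[of e "{e}" "Polynomial.monom 1 j"] by (simp add: act_monom)
  then show ?thesis by (auto simp: set_powers)
qed

text \<open>The basis vectors of a block only have to lie in the cyclic submodule of its generator;
  the two size conditions then supply the degree count.\<close>

lemma dec_from_blocks:
  assumes sp: "span (set (concat bss)) = UNIV" and len: "length (concat bss) = dim (UNIV :: 'b set)"
    and b: "\<And>i. i < length bss \<Longrightarrow> lead_coeff (r i) = 1 \<and> act (r i) (e i) = 0 \<and>
      set (bss ! i) \<subseteq> gspan {e i} \<and> degree (r i) = length (bss ! i)"
  shows "dec (map (\<lambda>i. (e i, r i)) [0..<length bss]) UNIV"
proof -
  let ?ers = "map (\<lambda>i. (e i, r i)) [0..<length bss]"
  have "set (concat bss) \<subseteq> gspan (fst ` set ?ers)"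
  proof
    fix x assume "x \<in> set (concat bss)"
    then obtain bs where "bs \<in> set bss" "x \<in> set bs" by auto
    then obtain i where i: "i < length bss" "x \<in> set (bss ! i)" by (metis in_set_conv_nth)
    then have "x \<in> gspan {e i}" using b by blast
    also have "\<dots> \<subseteq> gspan (fst ` set ?ers)" using i by (intro gspan_mono) force
    finally show "x \<in> gspan (fst ` set ?ers)" .
  qed
  then have "span (set (concat bss)) \<subseteq> gspan (fst ` set ?ers)"
    using gspan_invariant by (intro span_minimal) (auto simp: invariant_def)
  then have "gspan (fst ` set ?ers) = UNIV" using sp by auto
  moreover have "map (\<lambda>i. degree (r i)) [0..<length bss] = map length bss"
    using b by (intro nth_equalityI) auto
  then have "(\<Sum>(e, r)\<leftarrow>?ers. degree r) = dim (UNIV :: 'b set)"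
    using len by (simp add: comp_def length_concat)
  moreover have "\<forall>(e, r)\<in>set ?ers. lead_coeff r = 1 \<and> act r e = 0"
    using b[THEN conjunct1] b[THEN conjunct2, THEN conjunct1] by auto
  ultimately show ?thesis unfolding dec_def by blast
qed

lemma dec_to_blocks:
  assumes d: "dec ers UNIV"
    and b: "list_all2 (\<lambda>(e, r) bs. gspan {e} \<subseteq> span (set bs) \<and> length bs = degree r) ers bss"
  shows "span (set (concat bss)) = UNIV" "length (concat bss) = dim (UNIV :: 'b set)"
proof -
  show "length (concat bss) = dim (UNIV :: 'b set)"
  proof -
    have "map length bss = map (\<lambda>(e, r). degree r) ers"
      using b by (induction rule: list_all2_induct) auto
    then show ?thesis using d by (simp add: dec_def length_concat)
  qed
  have "gspan {e} \<subseteq> span (set (concat bss))" if "(e, r) \<in> set ers" for e r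
    using b that
  proof (induction rule: list_all2_induct)
    case (Cons x xs bs bss)
    have "span (set bs) \<subseteq> span (set (concat (bs # bss)))" "span (set (concat bss)) \<subseteq> span (set (concat (bs # bss)))"
      by (auto intro!: span_mono)
    with Cons show ?case by auto
  qed simp
  then have "act f e \<in> span (set (concat bss))" if "e \<in> fst ` set ers" for f e
    using that gspan_base[of e "{e}" f] by fastforce
  then have "gspan (fst ` set ers) \<subseteq> span (set (concat bss))"
    unfolding gspan_def by (intro span_minimal) blast+
  then show "span (set (concat bss)) = UNIV" using d by (auto simp: dec_def)
qed

end

section \<open>Kernels, eigenvalues and triangular forms\<close>

abbreviation ac_eval :: "'a::field poly \<Rightarrow> 'a alg_closure \<Rightarrow> 'a alg_closure" where
  "ac_eval f x \<equiv> poly (map_poly to_ac f) x"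

lemma ac_eval_pCons: "ac_eval (pCons c f) x = to_ac c + x * ac_eval f x"
  by (subst Polynomial.map_poly_pCons) simp_all

lemma ac_eval_add: "ac_eval (f + g) x = ac_eval f x + ac_eval g x"
  by (induction f g rule: poly_induct2) (simp_all add: ac_eval_pCons algebra_simps)

lemma ac_eval_smult: "ac_eval (smult c f) x = to_ac c * ac_eval f x"
  by (induction f) (simp_all add: ac_eval_pCons algebra_simps)

lemma ac_eval_mult: "ac_eval (f * g) x = ac_eval f x * ac_eval g x"
  by (induction f) (simp_all add: ac_eval_pCons ac_eval_add ac_eval_smult algebra_simps)

lemma ac_eval_diff: "ac_eval (f - g) x = ac_eval f x - ac_eval g x"
  using ac_eval_add[of "f - g" g x] by simp

lemma ac_eval_1: "ac_eval 1 x = 1"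
  by (simp add: map_poly_1')

lemma ac_eval_power: "ac_eval (f ^ n) x = ac_eval f x ^ n"
  by (induction n) (simp_all add: ac_eval_mult ac_eval_1)

lemma ac_eval_linear: "ac_eval [:- c, 1:] x = x - to_ac c"
  by (simp add: ac_eval_pCons)

lemma ac_eval_to_ac: "ac_eval f (to_ac c) = to_ac (poly f c)"
  by (induction f) (simp_all add: ac_eval_pCons)

lemma ac_eval_dvd: "f dvd g \<Longrightarrow> ac_eval f x = 0 \<Longrightarrow> ac_eval g x = 0"
  by (auto elim!: dvdE simp: ac_eval_mult)

text \<open>A nonconstant \<open>f\<close> has a root in the closure; by hypothesis it comes from
  the base field, so a linear factor can be removed there.\<close>

lemma split_if_roots_in_base:
  fixes f :: "'a::field poly"
  assumes "lead_coeff f = 1" "\<And>x. ac_eval f x = 0 \<Longrightarrow> x \<in> range to_ac"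
  shows "\<exists>xs. f = (\<Prod>x\<leftarrow>xs. [:- x, 1:])"
  using assms
proof (induction "degree f" arbitrary: f rule: less_induct)
  case less
  show ?case
  proof (cases "degree f = 0")
    case True
    then have "f = 1" using less.prems(1) by (rule monic_degree_0[THEN iffD1, rotated])
    then show ?thesis by (intro exI[of _ "[]"]) simp
  next
    case False
    then have "degree (map_poly to_ac f) > 0" by (simp add: degree_map_poly)
    then obtain x where x: "ac_eval f x = 0" using alg_closed_imp_poly_has_root by blast
    then obtain c where c: "x = to_ac c" using less.prems(2) by blast
    with x have "poly f c = 0" by (simp add: ac_eval_to_ac)
    then obtain g where g: "f = [:- c, 1:] * g" by (metis dvdE poly_eq_0_iff_dvd)
    have g1: "lead_coeff g = 1" using less.prems(1) unfolding g lead_coeff_mult by simp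
    then have "g \<noteq> 0" by auto
    then have "degree f = Suc (degree g)" unfolding g by (subst degree_mult_eq) auto
    moreover have "ac_eval f x = 0" if "ac_eval g x = 0" for x
      using that unfolding g ac_eval_mult by simp
    ultimately obtain xs where "g = (\<Prod>x\<leftarrow>xs. [:- x, 1:])"
      using less.hyps[of g] g1 less.prems(2) by auto
    then show ?thesis by (intro exI[of _ "c # xs"]) (simp add: g)
  qed
qed

text \<open>Synthetic division by \<open>[:- z, 1:]\<close> leaves the nonzero constant
  \<open>poly t z\<close>, which is a Bezout identity up to scaling.\<close>

lemma comaximal_linear_iff:
  fixes t :: "'a::field poly"
  assumes "poly t z \<noteq> 0"
  shows "comaximal t [:- z, 1:]"
proof -
  define c where "c = poly t z"
  define h where "h = synthetic_div t z"
  have "c \<noteq> 0" using assms by (simp add: c_def)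
  have t: "t = [:- z, 1:] * h + [:c:]"
    unfolding h_def c_def by (rule synthetic_div_correct'[symmetric])
  have "[:inverse c:] * t + smult (- inverse c) h * [:- z, 1:] = [:inverse c * c:]"
    by (subst t) (simp add: algebra_simps smult_add_right)
  also have "\<dots> = 1" using \<open>c \<noteq> 0\<close> by (simp add: one_pCons)
  finally show ?thesis unfolding comaximal_def by blast
qed

section \<open>Kernels of the powers of \<open>u - z\<close> in terms of a cyclic
  decomposition\<close>

context fd_endo
begin

text \<open>The kernel is computed summand by summand. In a cyclic summand with annihilator
  \<open>r\<close>, it is generated by \<open>r / (t - z)^m\<close> applied to the generator, where
  \<open>m\<close> is the smaller of \<open>k\<close> and the order of \<open>r\<close> at
  \<open>z\<close>, and it has dimension \<open>m\<close>.\<close>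

lemma act_linear_factors_kernel:
  assumes d: "dec ers UNIV"
  shows "dim {v. act ([:- z, 1:] ^ k) v = 0} = (\<Sum>i<length ers. min k (Polynomial.order z (snd (ers ! i))))"
proof -
  let ?L = "[:- z, 1:]" and ?e = "\<lambda>i. fst (ers ! i)" and ?r = "\<lambda>i. snd (ers ! i)" and ?N = "length ers"
  define m where "m i = min k (Polynomial.order z (?r i))" for i
  \<comment> \<open>If \<open>m i = k\<close>, the cofactor \<open>s\<close> may still contain
    \<open>?L\<close>; it is prime to \<open>?L\<close> only when \<open>m i\<close> is the full
    order.\<close>
  have "\<exists>s. ?r i = ?L ^ m i * s \<and> (m i < k \<longrightarrow> poly s z \<noteq> 0)" if "i < ?N" for i
  proof -
    obtain t where t: "?r i = ?L ^ Polynomial.order z (?r i) * t" "\<not> ?L dvd t"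
      using order_decomp[OF decD(3)[OF d \<open>i < ?N\<close>]] by blast
    let ?s = "?L ^ (Polynomial.order z (?r i) - m i) * t"
    have "?L ^ m i * ?s = ?L ^ (m i + (Polynomial.order z (?r i) - m i)) * t"
      by (simp only: power_add mult.assoc)
    then have "?r i = ?L ^ m i * ?s" using t(1) by (simp add: m_def)
    moreover have "poly ?s z \<noteq> 0" if "m i < k"
      using that t(2) by (simp add: m_def poly_eq_0_iff_dvd)
    ultimately show ?thesis by blast
  qed
  then obtain s where s: "\<And>i. i < ?N \<Longrightarrow> ?r i = ?L ^ m i * s i"
    and co: "\<And>i. i < ?N \<Longrightarrow> m i < k \<Longrightarrow> poly (s i) z \<noteq> 0"
    by metis
  define I where "I = (SIGMA i:{..<?N}. {..<m i})"
  define g where "g = (\<lambda>(i, j). (u ^^ j) (act (s i) (?e i)))"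
  define K where "K = {v. act (?L ^ k) v = 0}"
  have kill: "act (?L ^ m i) (act (s i) (?e i)) = 0" if "i < ?N" for i
    using decD(2)[OF d that] by (simp add: s[OF that] flip: act_mult)
  have sum: "(\<Sum>x\<in>I. c x *s g x) = (\<Sum>i<?N. act ((\<Sum>j<m i. Polynomial.monom (c (i, j)) j) * s i) (?e i))" for c
  proof -
    have "(\<Sum>x\<in>I. c x *s g x) = (\<Sum>i<?N. \<Sum>j<m i. c (i, j) *s (u ^^ j) (act (s i) (?e i)))"
      unfolding I_def by (subst sum.Sigma) (auto simp: g_def intro!: sum.cong)
    then show ?thesis by (simp add: act_mult act_sum_monom)
  qed
  have "dim K = card I"
  proof (rule family_dim)
    show "finite I" by (simp add: I_def)
    show "\<forall>x\<in>I. c x = 0" if c: "(\<Sum>x\<in>I. c x *s g x) = 0" for c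
    proof (safe)
      fix i j assume ij: "(i, j) \<in> I"
      then have i: "i < ?N" and j: "j < m i" by (auto simp: I_def)
      let ?h = "\<Sum>j<m i. Polynomial.monom (c (i, j)) j"
      have "?r i dvd ?h * s i" using dec_indep[OF d c[unfolded sum] i] .
      then have "?L ^ m i * s i dvd ?h * s i" using s[OF i] by simp
      moreover have "s i \<noteq> 0" using decD(3)[OF d i] s[OF i] by auto
      ultimately have "?L ^ m i dvd ?h" by simp
      then have "?h = 0"
        by (rule monic_dvd_eq) (use degree_sum_monom_less[of "\<lambda>j. c (i, j)" "m i"] in \<open>simp add: degree_linear_power\<close>)
      then show "c (i, j) = 0" using coeff_sum_monom_less[of "\<lambda>j. c (i, j)" "m i" j] j by simp
    qed
    show "span (g ` I) = K"
    proof
      have "g x \<in> K" if x: "x \<in> I" for x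
      proof -
        obtain i j where ij: "x = (i, j)" "i < ?N" using x by (auto simp: I_def)
        have "act (?L ^ k) (act (s i) (?e i)) = 0"
          by (rule act_dvd[OF _ kill[OF ij(2)]]) (simp add: m_def le_imp_power_dvd)
        then have "act (Polynomial.monom 1 j) (act (?L ^ k) (act (s i) (?e i))) = 0" by simp
        then have "act (?L ^ k) (act (Polynomial.monom 1 j) (act (s i) (?e i))) = 0"
          by (subst act_mult_commute)
        then show ?thesis by (simp add: K_def ij g_def act_monom)
      qed
      moreover have "subspace K" unfolding K_def by (rule module_hom.subspace_kernel[OF act_linear])
      ultimately show "span (g ` I) \<subseteq> K" by (intro span_minimal) auto
    next
      show "K \<subseteq> span (g ` I)"
      proof
        fix v assume v: "v \<in> K"
        obtain f where f: "v = (\<Sum>i<?N. act (f i) (?e i))" using dec_ex_coeffs[OF d] by blast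
        have "(\<Sum>i<?N. act (?L ^ k * f i) (?e i)) = 0"
          using v by (simp add: K_def f act_sum act_mult)
        then have dv: "?r i dvd ?L ^ k * f i" if "i < ?N" for i
          using dec_indep[OF d _ that, where f = "\<lambda>i. ?L ^ k * f i"] by simp
        have "act (f i) (?e i) \<in> span (g ` I)" if i: "i < ?N" for i
        proof -
          have mk: "m i \<le> k" by (simp add: m_def)
          have "?L ^ m i * s i dvd ?L ^ m i * (?L ^ (k - m i) * f i)"
            using dv[OF i] s[OF i] mk by (simp flip: mult.assoc power_add)
          then have sf: "s i dvd ?L ^ (k - m i) * f i" by simp
          \<comment> \<open>Either the surplus power of \<open>?L\<close> is coprime to
            \<open>s i\<close>, or its exponent \<open>k - m i\<close> is 0.\<close>
          have "s i dvd f i"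
          proof (cases "m i < k")
            case True
            then have "comaximal (s i) (?L ^ (k - m i))"
              using co[OF i] comaximal_linear_iff comaximal_power by blast
            then show ?thesis using sf comaximal_dvd_mult by blast
          qed (use sf mk in simp)
          then obtain q where "f i = q * s i" by (metis dvdE mult.commute)
          then have "act (f i) (?e i) = act q (act (s i) (?e i))" by (simp add: act_mult)
          also have "\<dots> \<in> span ((\<lambda>j. (u ^^ j) (act (s i) (?e i))) ` {..<degree (?L ^ m i)})"
            by (rule act_in_span_powers[OF kill[OF i]]) simp
          also have "\<dots> \<subseteq> span (g ` I)"
          proof (rule span_mono, safe)
            fix j assume "j < degree (?L ^ m i)"
            then have "(i, j) \<in> I" using i by (simp add: I_def degree_linear_power)
            moreover have "(u ^^ j) (act (s i) (?e i)) = g (i, j)" by (simp add: g_def)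
            ultimately show "(u ^^ j) (act (s i) (?e i)) \<in> g ` I" by blast
          qed
          finally show ?thesis .
        qed
        then show "v \<in> span (g ` I)" unfolding f by (intro span_sum) auto
      qed
    qed
  qed
  then show ?thesis by (simp add: K_def I_def m_def)
qed

lemma n_seq_act:
  "n_seq scale u z k = dim {v. act ([:- z, 1:] ^ k) v = 0} - dim {v. act ([:- z, 1:] ^ (k - 1)) v = 0}"
  by (simp add: n_seq_def act_lin_power)

text \<open>Passing from \<open>k - 1\<close> to \<open>k\<close> raises \<open>min k m\<close> by
  one exactly when \<open>k \<le> m\<close>, so the difference of kernel dimensions is a count of
  summands.\<close>

lemma n_seq_dec:
  assumes "dec ers UNIV" "k \<ge> 1"
  shows "n_seq scale u z k = card {i. i < length ers \<and> k \<le> Polynomial.order z (snd (ers ! i))}"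
proof -
  let ?m = "\<lambda>i. Polynomial.order z (snd (ers ! i))"
  have "(\<Sum>i<length ers. min k (?m i)) = (\<Sum>i<length ers. min (k - 1) (?m i) + (if k \<le> ?m i then 1 else 0))"
    using assms(2) by (intro sum.cong) auto
  also have "\<dots> = (\<Sum>i<length ers. min (k - 1) (?m i)) + card ({..<length ers} \<inter> {i. k \<le> ?m i})"
    by (simp add: sum.distrib sum.If_cases)
  also have "{..<length ers} \<inter> {i. k \<le> ?m i} = {i. i < length ers \<and> k \<le> ?m i}" by auto
  finally show ?thesis
    by (simp add: n_seq_act act_linear_factors_kernel[OF assms(1)])
qed

text \<open>Such a map is the restriction to the original space of a linear form on the space with
  scalars extended to the closure, and it is an eigenvector there for the dual of
  \<open>u\<close>.\<close>

definition ac_functional :: "('b \<Rightarrow> 'a alg_closure) \<Rightarrow> 'a alg_closure \<Rightarrow> bool" where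
  "ac_functional \<phi> x \<longleftrightarrow> (\<forall>v w. \<phi> (v + w) = \<phi> v + \<phi> w) \<and> (\<forall>c v. \<phi> (c *s v) = to_ac c * \<phi> v) \<and>
     (\<forall>v. \<phi> (u v) = x * \<phi> v) \<and> (\<exists>v. \<phi> v \<noteq> 0)"

lemma ac_functional_sum:
  assumes "ac_functional \<phi> x"
  shows "\<phi> (\<Sum>i\<in>I. c i *s g i) = (\<Sum>i\<in>I. to_ac (c i) * \<phi> (g i))"
proof -
  have "\<phi> (0 *s 0) = 0" using assms unfolding ac_functional_def by (metis mult_zero_left to_ac_0)
  then show ?thesis using assms unfolding ac_functional_def
    by (induction I rule: infinite_finite_induct) simp_all
qed

lemma ac_functional_act:
  assumes "ac_functional \<phi> x"
  shows "\<phi> (act f v) = ac_eval f x * \<phi> v"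
proof (induction f arbitrary: v)
  case 0
  have "\<phi> (0 *s 0) = 0" using assms unfolding ac_functional_def by (metis mult_zero_left to_ac_0)
  then show ?case by simp
next
  case (pCons c f)
  then show ?case using assms unfolding ac_functional_def
    by (simp add: act_pCons ac_eval_pCons algebra_simps)
qed

text \<open>A functional as above is a left eigenvector, i.e. an eigenvector of the transpose.\<close>

lemma eigenvalue_iff_functional:
  assumes rep: "rep_on bs M" and sp: "span (set bs) = UNIV" and len: "length bs = dim (UNIV :: 'b set)"
  shows "eigenvalue (map_mat to_ac M) x \<longleftrightarrow> (\<exists>\<phi>. ac_functional \<phi> x)"
proof -
  define n where "n = length bs"
  let ?A = "map_mat to_ac M"
  have M: "M \<in> carrier_mat n n" using rep unfolding rep_on_def n_def by blast
  then have A: "?A \<in> carrier_mat n n" "transpose_mat ?A \<in> carrier_mat n n" by auto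
  have u: "u (bs ! j) = (\<Sum>i<n. M $$ (i, j) *s bs ! i)" if "j < n" for j
    using rep that unfolding rep_on_def n_def by blast
  have entry: "(transpose_mat ?A *\<^sub>v w) $ j = (\<Sum>i<n. to_ac (M $$ (i, j)) * w $ i)"
    if "j < n" "w \<in> carrier_vec n" for w j
    using that M by (auto simp: scalar_prod_def atLeast0LessThan intro!: sum.cong)
  \<comment> \<open>Both sides say that \<open>x\<close> is a root of the characteristic polynomial,
    which transposition preserves.\<close>
  have "eigenvalue ?A x \<longleftrightarrow> eigenvalue (transpose_mat ?A) x"
    using A by (simp add: eigenvalue_root_char_poly[of _ n])
  also have "\<dots> \<longleftrightarrow> (\<exists>\<phi>. ac_functional \<phi> x)"
  proof
    assume "eigenvalue (transpose_mat ?A) x"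
    then obtain w where w: "w \<in> carrier_vec n" "w \<noteq> 0\<^sub>v n" "transpose_mat ?A *\<^sub>v w = x \<cdot>\<^sub>v w"
      using M by (auto simp: eigenvalue_def eigenvector_def)
    have ind: "independent (set bs)" "distinct bs" using list_basis[OF sp len] by auto
    define \<phi> where "\<phi> v = (\<Sum>i<n. to_ac (representation (set bs) v (bs ! i)) * w $ i)" for v
    have add: "\<phi> (v + v') = \<phi> v + \<phi> v'" and scl: "\<phi> (c *s v) = to_ac c * \<phi> v" for v v' c
      using ind sp by (simp_all add: \<phi>_def representation_add representation_scale sum.distrib
          sum_distrib_left algebra_simps)
    have basis: "\<phi> (bs ! j) = w $ j" if "j < n" for j
    proof -
      have "\<phi> (bs ! j) = (\<Sum>i<n. if i = j then w $ j else 0)"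
        unfolding \<phi>_def using that ind
        by (intro sum.cong) (auto simp: representation_basis n_def nth_eq_iff_index_eq)
      then show ?thesis using that by simp
    qed
    have sum: "\<phi> (\<Sum>i\<in>I. c i *s g i) = (\<Sum>i\<in>I. to_ac (c i) * \<phi> (g i))" for I c and g :: "nat \<Rightarrow> 'b"
    proof -
      have "\<phi> 0 = 0" using scl[of 0 0] by simp
      then show ?thesis by (induction I rule: infinite_finite_induct) (simp_all add: add scl)
    qed
    have eig: "\<phi> (u (bs ! j)) = x * \<phi> (bs ! j)" if "j < n" for j
    proof -
      have "\<phi> (u (bs ! j)) = (\<Sum>i<n. to_ac (M $$ (i, j)) * w $ i)"
        using that by (simp add: u sum basis)
      also have "\<dots> = (x \<cdot>\<^sub>v w) $ j" using entry[OF that w(1)] w(3) by simp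
      finally show ?thesis using that w(1) by (simp add: basis)
    qed
    have "\<phi> (u v) = x * \<phi> v" for v
    proof -
      have "(!) bs ` {..<n} = set bs" by (auto simp: n_def set_conv_nth)
      then have "v \<in> span ((!) bs ` {..<n})" using sp by simp
      then obtain c where c: "v = (\<Sum>i<n. c i *s bs ! i)" using span_family[of "{..<n}" v "(!) bs"] by auto
      then have "u v = (\<Sum>i<n. c i *s u (bs ! i))" by (simp add: u_sum u_scale)
      then show ?thesis by (simp add: c sum eig sum_distrib_left mult_ac)
    qed
    moreover have "\<exists>j<n. w $ j \<noteq> 0"
    proof (rule ccontr)
      assume "\<not> ?thesis"
      then have "w = 0\<^sub>v n" using w(1) by (intro eq_vecI) auto
      with w(2) show False ..
    qed
    ultimately have "ac_functional \<phi> x" using add scl basis unfolding ac_functional_def by metis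
    then show "\<exists>\<phi>. ac_functional \<phi> x" by blast
  next
    assume "\<exists>\<phi>. ac_functional \<phi> x"
    then obtain \<phi> where \<phi>: "ac_functional \<phi> x" ..
    define w where "w = vec n (\<lambda>i. \<phi> (bs ! i))"
    have "w \<noteq> 0\<^sub>v n"
    proof
      assume "w = 0\<^sub>v n"
      then have "\<phi> (bs ! i) = 0" if "i < n" for i
        using that by (metis index_vec index_zero_vec(1) w_def)
      then have 0: "\<phi> b = 0" if "b \<in> set bs" for b using that by (auto simp: in_set_conv_nth n_def)
      have "\<phi> v = 0" if "v \<in> span (set bs)" for v
        using that
      proof (induction rule: span_induct_alt)
        case base
        show ?case using ac_functional_sum[OF \<phi>, of _ _ "{}"] by simp
      next
        case (step c y z)
        then show ?case using 0 \<phi> by (simp add: ac_functional_def)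
      qed
      then show False using \<phi> sp by (auto simp: ac_functional_def)
    qed
    moreover have "transpose_mat ?A *\<^sub>v w = x \<cdot>\<^sub>v w"
    proof (rule eq_vecI)
      show "dim_vec (transpose_mat ?A *\<^sub>v w) = dim_vec (x \<cdot>\<^sub>v w)" using M by (simp add: w_def)
      fix j assume "j < dim_vec (x \<cdot>\<^sub>v w)"
      then have j: "j < n" by (simp add: w_def)
      have "(transpose_mat ?A *\<^sub>v w) $ j = (\<Sum>i<n. to_ac (M $$ (i, j)) * \<phi> (bs ! i))"
        using entry[OF j, of w] by (simp add: w_def)
      also have "\<dots> = \<phi> (u (bs ! j))" using j by (simp add: u ac_functional_sum[OF \<phi>])
      also have "\<dots> = x * \<phi> (bs ! j)" using \<phi> by (simp add: ac_functional_def)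
      finally show "(transpose_mat ?A *\<^sub>v w) $ j = (x \<cdot>\<^sub>v w) $ j" using j by (simp add: w_def)
    qed
    ultimately show "eigenvalue (transpose_mat ?A) x"
      unfolding eigenvalue_def eigenvector_def using M by (intro exI[of _ w]) (simp add: w_def)
  qed
  finally show ?thesis .
qed

lemma ac_eigenvalue_functional:
  "ac_eigenvalue scale u x \<Longrightarrow> \<exists>\<phi>. ac_functional \<phi> x"
  unfolding ac_eigenvalue_def represents_iff using eigenvalue_iff_functional by blast

text \<open>Applying an eigenfunctional to \<open>act f v = 0\<close> gives
  \<open>ac_eval f x * \<phi> v = 0\<close>, and \<open>v\<close> can be chosen with
  \<open>\<phi> v \<noteq> 0\<close>.\<close>

lemma ac_eigenvalue_root:
  assumes "\<And>v. act f v = 0" "ac_eigenvalue scale u x"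
  shows "ac_eval f x = 0"
proof -
  obtain \<phi> where \<phi>: "ac_functional \<phi> x" using ac_eigenvalue_functional[OF assms(2)] by blast
  then obtain v where v: "\<phi> v \<noteq> 0" by (auto simp: ac_functional_def)
  have "\<phi> 0 = 0" using ac_functional_sum[OF \<phi>, of _ _ "{}"] by simp
  then show ?thesis using ac_functional_act[OF \<phi>, of f v] assms(1) v by simp
qed

lemma dec_represents:
  assumes d: "dec ers UNIV"
  shows "represents scale u (diag_block_mat (map (\<lambda>x. companion_mat (snd x)) ers))"
proof -
  let ?bss = "map (\<lambda>(e, r). powers e (degree r)) ers"
  have mon: "lead_coeff r = 1" "act r e = 0" if "(e, r) \<in> set ers" for e r
    using d that by (auto simp: dec_def)
  have "list_all2 (\<lambda>(e, r) bs. gspan {e} \<subseteq> span (set bs) \<and> length bs = degree r) ers ?bss"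
  proof (simp add: list_all2_map2 list_all2_same, intro ballI, clarsimp)
    fix e r x assume er: "(e, r) \<in> set ers" and x: "x \<in> gspan {e}"
    have "r \<noteq> 0" using mon(1)[OF er] by auto
    then show "x \<in> span (set (powers e (degree r)))"
      using gspan_single[OF mon(2)[OF er]] x by (simp add: set_powers)
  qed
  note sp = dec_to_blocks[OF d this]
  moreover have "list_all2 rep_on ?bss (map (\<lambda>x. companion_mat (snd x)) ers)"
    using rep_on_companion mon by (auto simp: list_all2_map1 list_all2_map2 list_all2_same)
  ultimately show ?thesis unfolding represents_iff using rep_on_diag_block by blast
qed

text \<open>This turns a statement about an arbitrary sequence of invariant factors into one about a
  decomposition with these annihilators.\<close>

lemma represents_dec:
  assumes rep: "represents scale u (diag_block_mat (map companion_mat rs))"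
    and mon: "\<And>r. r \<in> set rs \<Longrightarrow> lead_coeff r = 1"
  shows "\<exists>ers. map snd ers = rs \<and> dec ers UNIV"
proof -
  have "square_mat B" if "B \<in> set (map companion_mat rs)" for B
    using that by (auto simp: companion_mat_def)
  then obtain bss where bss: "list_all2 rep_on bss (map companion_mat rs)"
    and sp: "span (set (concat bss)) = UNIV" "length (concat bss) = dim (UNIV :: 'b set)"
    using rep represents_diag_block_iff by blast
  then have len: "length bss = length rs" using list_all2_lengthD by fastforce
  have "\<exists>e. bss ! i = powers e (degree (rs ! i)) \<and> act (rs ! i) e = 0" if "i < length rs" for i
    using bss that mon by (intro rep_on_companionD) (auto simp: list_all2_conv_all_nth)
  then obtain e where e: "\<And>i. i < length rs \<Longrightarrow> bss ! i = powers (e i) (degree (rs ! i)) \<and> act (rs ! i) (e i) = 0"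
    by metis
  have "dec (map (\<lambda>i. (e i, rs ! i)) [0..<length bss]) UNIV"
    by (rule dec_from_blocks[OF sp]) (use e len mon powers_subset_gspan in simp)
  moreover have "map snd (map (\<lambda>i. (e i, rs ! i)) [0..<length bss]) = rs"
    by (simp add: len comp_def map_nth)
  ultimately show ?thesis by blast
qed

text \<open>The eigenfunctional sends a vector to the value at \<open>x\<close> of its coefficient
  polynomial in the summand \<open>i0\<close>. That polynomial is determined modulo the annihilator
  of the summand, which vanishes at \<open>x\<close>, so the choice made in \<open>C\<close> does
  not matter.\<close>

lemma dec_root_ac_eigenvalue:
  assumes d: "dec ers UNIV" and i0: "i0 < length ers" and x: "ac_eval (snd (ers ! i0)) x = 0"
  shows "ac_eigenvalue scale u x"
proof -
  let ?e = "\<lambda>i. fst (ers ! i)" and ?N = "length ers"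
  define C where "C v = (SOME f. v = (\<Sum>i<?N. act (f i) (?e i)))" for v
  have C: "v = (\<Sum>i<?N. act (C v i) (?e i))" for v
    unfolding C_def by (rule someI_ex[OF dec_ex_coeffs[OF d]])
  define \<phi> where "\<phi> v = ac_eval (C v i0) x" for v
  have \<phi>: "\<phi> v = ac_eval (g i0) x" if "v = (\<Sum>i<?N. act (g i) (?e i))" for v g
  proof -
    have "(\<Sum>i<?N. act (C v i - g i) (?e i)) = 0"
      using C[of v] that by (simp add: act_diff sum_subtractf)
    then have "snd (ers ! i0) dvd C v i0 - g i0" by (rule dec_indep[OF d _ i0])
    then have "ac_eval (C v i0 - g i0) x = 0" using x by (rule ac_eval_dvd)
    then show ?thesis by (simp add: \<phi>_def ac_eval_diff)
  qed
  have "\<phi> (v + w) = \<phi> v + \<phi> w" for v w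
  proof -
    have "v + w = (\<Sum>i<?N. act (C v i + C w i) (?e i))"
      using C[of v] C[of w] by (simp add: act_add sum.distrib)
    from \<phi>[OF this] show ?thesis by (simp add: ac_eval_add \<phi>_def)
  qed
  moreover have "\<phi> (c *s v) = to_ac c * \<phi> v" for c v
  proof -
    have "c *s v = (\<Sum>i<?N. act (smult c (C v i)) (?e i))"
      using C[of v] by (simp add: act_smult flip: scale_sum_right)
    from \<phi>[OF this] show ?thesis by (simp add: ac_eval_smult \<phi>_def)
  qed
  moreover have "\<phi> (u v) = x * \<phi> v" for v
  proof -
    have "u v = u (\<Sum>i<?N. act (C v i) (?e i))" using C[of v] by simp
    also have "\<dots> = (\<Sum>i<?N. act (pCons 0 (C v i)) (?e i))" by (simp add: u_sum act_pCons act_u)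
    finally have "u v = (\<Sum>i<?N. act (pCons 0 (C v i)) (?e i))" .
    from \<phi>[OF this] show ?thesis by (simp add: ac_eval_pCons \<phi>_def)
  qed
  moreover have "\<phi> (?e i0) = 1"
  proof -
    have "?e i0 = (\<Sum>i<?N. act (if i = i0 then 1 else 0) (?e i))"
      using i0 by (subst sum.mono_neutral_right[of _ "{i0}"]) auto
    from \<phi>[OF this] show ?thesis by (simp add: ac_eval_1)
  qed
  ultimately have "ac_functional \<phi> x" unfolding ac_functional_def by (metis zero_neq_one)
  moreover obtain bs where bs: "rep_on bs (diag_block_mat (map (\<lambda>x. companion_mat (snd x)) ers))"
    "span (set bs) = UNIV" "length bs = dim (UNIV :: 'b set)"
    using dec_represents[OF d] unfolding represents_iff by blast
  ultimately have "eigenvalue (map_mat to_ac (diag_block_mat (map (\<lambda>x. companion_mat (snd x)) ers))) x"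
    using eigenvalue_iff_functional[OF bs] by blast
  then show ?thesis unfolding ac_eigenvalue_def using dec_represents[OF d] by blast
qed

section \<open>Triangular form from Newton bases of the cyclic summands\<close>

definition flag :: "'b list \<Rightarrow> bool" where
  "flag bs \<longleftrightarrow> (\<forall>j<length bs. u (bs ! j) \<in> span (set (take (Suc j) bs)))"

text \<open>The iterated products of factors \<open>u - x\<close> applied to \<open>e\<close>,
  listed with \<open>e\<close> last: \<open>u\<close> sends each vector to a multiple of itself plus
  the vector before it, as an upper triangular matrix requires.\<close>

fun newton :: "'b \<Rightarrow> 'a list \<Rightarrow> 'b list" where
  "newton e [] = []"
| "newton e (x # xs) = newton (u e - x *s e) xs @ [e]"

lemma flag_append:
  assumes "flag bs" "flag cs"
  shows "flag (bs @ cs)"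
  unfolding flag_def
proof (intro allI impI)
  fix j assume j: "j < length (bs @ cs)"
  show "u ((bs @ cs) ! j) \<in> span (set (take (Suc j) (bs @ cs)))"
  proof (cases "j < length bs")
    case True
    then show ?thesis using assms(1) by (simp add: flag_def nth_append)
  next
    case False
    then have "u (cs ! (j - length bs)) \<in> span (set (take (Suc (j - length bs)) cs))"
      using assms(2) j by (simp add: flag_def)
    also have "\<dots> \<subseteq> span (set (take (Suc j) (bs @ cs)))"
      using False by (intro span_mono) (auto simp: Suc_diff_le)
    finally show ?thesis using False by (simp add: nth_append)
  qed
qed

lemma flag_concat: "(\<And>bs. bs \<in> set bss \<Longrightarrow> flag bs) \<Longrightarrow> flag (concat bss)"
  by (induction bss) (auto intro: flag_append simp: flag_def[of "[]"])

lemma flag_snoc: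
  assumes "flag bs" "u e \<in> span (set (bs @ [e]))"
  shows "flag (bs @ [e])"
  using assms by (auto simp: flag_def nth_append less_Suc_eq)

lemma newton:
  assumes "act (\<Prod>x\<leftarrow>xs. [:- x, 1:]) e = 0"
  shows "flag (newton e xs) \<and> length (newton e xs) = length xs \<and> e \<in> span (set (newton e xs))"
  using assms
proof (induction xs arbitrary: e)
  case Nil
  then show ?case by (simp add: flag_def span_zero)
next
  case (Cons x xs)
  let ?e = "u e - x *s e" and ?f = "\<Prod>x\<leftarrow>xs. [:- x, 1:]"
  have "act ?f ?e = act (?f * [:- x, 1:]) e" by (simp only: act_mult act_lin)
  also have "\<dots> = act (\<Prod>x\<leftarrow>x # xs. [:- x, 1:]) e" by (simp only: list.map prod_list.Cons mult.commute)
  finally have IH: "flag (newton ?e xs)" "length (newton ?e xs) = length xs" "?e \<in> span (set (newton ?e xs))"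
    using Cons by auto
  have "?e \<in> span (set (newton ?e xs @ [e]))"
    using IH(3) span_mono[of "set (newton ?e xs)" "set (newton ?e xs @ [e])"] by auto
  moreover have "e \<in> span (set (newton ?e xs @ [e]))" by (rule span_base) simp
  ultimately have "?e + x *s e \<in> span (set (newton ?e xs @ [e]))" by (intro span_add span_scale)
  then have "u e \<in> span (set (newton ?e xs @ [e]))" by simp
  then have "flag (newton e (x # xs))" using flag_snoc[OF IH(1)] by simp
  then show ?case using IH(2) \<open>e \<in> span _\<close> by simp
qed

lemma gspan_flag:
  assumes "flag bs" "e \<in> span (set bs)"
  shows "gspan {e} \<subseteq> span (set bs)"
proof (rule gspan_minimal)
  have base: "u b \<in> span (set bs)" if b: "b \<in> set bs" for b
  proof -
    obtain j where "j < length bs" "b = bs ! j" using b by (auto simp: in_set_conv_nth)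
    then have "u b \<in> span (set (take (Suc j) bs))" using assms(1) by (simp add: flag_def)
    then show ?thesis using span_mono[OF set_take_subset] by blast
  qed
  have "u v \<in> span (set bs)" if "v \<in> span (set bs)" for v
    using that
  proof (induction rule: span_induct_alt)
    case base
    show ?case by (simp add: u_0 span_zero)
  next
    case (step c y z)
    then show ?case using base by (simp add: u_add u_scale span_add span_scale)
  qed
  then show "invariant (span (set bs))" by (simp add: invariant_def)
qed (use assms in simp)

lemma flag_triangularizable:
  assumes fl: "flag bs" and sp: "span (set bs) = UNIV" and len: "length bs = dim (UNIV :: 'b set)"
  shows "triangularizable scale u"
proof -
  let ?n = "length bs"
  have "\<exists>c. u (bs ! j) = (\<Sum>i<Suc j. c i *s bs ! i)" if "j < ?n" for j
  proof -
    have "u (bs ! j) \<in> span ((!) bs ` {..<Suc j})"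
      using fl that by (simp add: flag_def nth_image lessThan_atLeast0 Suc_leI)
    then show ?thesis using span_family[of "{..<Suc j}"] by blast
  qed
  then obtain c where c: "\<And>j. j < ?n \<Longrightarrow> u (bs ! j) = (\<Sum>i<Suc j. c j i *s bs ! i)" by metis
  define M where "M = mat ?n ?n (\<lambda>(i, j). if i \<le> j then c j i else 0)"
  have "u (bs ! j) = (\<Sum>i<?n. M $$ (i, j) *s bs ! i)" if "j < ?n" for j
  proof -
    have "(\<Sum>i<?n. M $$ (i, j) *s bs ! i) = (\<Sum>i<Suc j. M $$ (i, j) *s bs ! i)"
      using that by (intro sum.mono_neutral_right) (auto simp: M_def)
    also have "\<dots> = (\<Sum>i<Suc j. c j i *s bs ! i)"
      using that by (intro sum.cong) (auto simp: M_def)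
    finally show ?thesis using c[OF that] by simp
  qed
  then have "rep_on bs M" by (simp add: rep_on_def M_def)
  then have "represents scale u M" unfolding represents_iff using sp len by blast
  moreover have "upper_triangular M" by (auto simp: M_def)
  ultimately show ?thesis unfolding triangularizable_def by blast
qed

lemma dec_split_triangularizable:
  assumes d: "dec ers UNIV"
    and split: "\<And>e r. (e, r) \<in> set ers \<Longrightarrow> \<exists>xs. r = (\<Prod>x\<leftarrow>xs. [:- x, 1:])"
  shows "triangularizable scale u"
proof -
  define xs where "xs r = (SOME xs. r = (\<Prod>x\<leftarrow>xs. [:- x, 1:]))" for r :: "'a poly"
  have xs: "r = (\<Prod>x\<leftarrow>xs r. [:- x, 1:])" if "(e, r) \<in> set ers" for e r
    unfolding xs_def using split[OF that] by (rule someI_ex)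
  have deg: "degree (\<Prod>x\<leftarrow>ys. [:- x, 1:]) = length ys" for ys :: "'a list"
    by (rule degree_linear_factors)
  let ?bss = "map (\<lambda>(e, r). newton e (xs r)) ers"
  have new: "flag (newton e (xs r)) \<and> length (newton e (xs r)) = degree r \<and> e \<in> span (set (newton e (xs r)))"
    if "(e, r) \<in> set ers" for e r
  proof -
    have "act r e = 0" using d that by (auto simp: dec_def)
    then have "act (\<Prod>x\<leftarrow>xs r. [:- x, 1:]) e = 0" using xs[OF that] by simp
    moreover have "length (xs r) = degree r" using xs[OF that] deg by metis
    ultimately show ?thesis using newton by metis
  qed
  have "gspan {e} \<subseteq> span (set (newton e (xs r)))" if "(e, r) \<in> set ers" for e r
    using new[OF that] gspan_flag by blast
  then have "list_all2 (\<lambda>(e, r) bs. gspan {e} \<subseteq> span (set bs) \<and> length bs = degree r) ers ?bss"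
    unfolding list_all2_map2 list_all2_same using new by auto
  note sp = dec_to_blocks[OF d this]
  moreover have "flag (concat ?bss)" using new by (intro flag_concat) auto
  ultimately show ?thesis using flag_triangularizable by blast
qed

end

section \<open>Exchanging paired eigenspaces of a quotient\<close>

context finite_dimensional_vector_space
begin

text \<open>\<open>T\<close> induces an injective map from \<open>A / A0\<close> to
  \<open>B / B0\<close>; the comparison of dimensions is written additively to avoid quotient spaces
  and subtraction of natural numbers.\<close>

lemma dim_injection_mod_le:
  assumes sub: "subspace A" "subspace A0" "A0 \<subseteq> A" "subspace B" "subspace B0" "B0 \<subseteq> B"
    and T: "module_hom scale scale T" and TA: "\<And>x. x \<in> A \<Longrightarrow> T x \<in> B"
    and inj: "\<And>x. x \<in> A \<Longrightarrow> T x \<in> B0 \<Longrightarrow> x \<in> A0"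
  shows "dim A + dim B0 \<le> dim A0 + dim B"
proof -
  obtain I0 where I0: "I0 \<subseteq> A0" "independent I0" "A0 \<subseteq> span I0" "card I0 = dim A0"
    using basis_exists[of A0] by blast
  obtain I where I: "I0 \<subseteq> I" "I \<subseteq> A" "independent I" "A \<subseteq> span I"
    using maximal_independent_subset_extend[of I0 A] I0 sub(3) by blast
  obtain J where J: "J \<subseteq> B0" "independent J" "B0 \<subseteq> span J" "card J = dim B0"
    using basis_exists[of B0] by blast
  have fin: "finite I" "finite I0" "finite J" using I I0 J finiteI_independent by auto
  have cI: "card I = dim A" using I basis_card_eq_dim by blast
  \<comment> \<open>The images of basis vectors of \<open>A\<close> outside \<open>A0\<close>,
    together with a basis of \<open>B0\<close>, are to be independent in \<open>B\<close>. The sum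
    type keeps the two sorts apart as long as they might coincide.\<close>
  define K where "K = Inl ` (I - I0) \<union> Inr ` J"
  define g where "g = case_sum T (\<lambda>x. x)"
  have sum: "(\<Sum>k\<in>K. scale (c k) (g k)) = T (\<Sum>i\<in>I - I0. scale (c (Inl i)) i) + (\<Sum>j\<in>J. scale (c (Inr j)) j)" for c
  proof -
    have "(\<Sum>k\<in>K. scale (c k) (g k)) = (\<Sum>k\<in>Inl ` (I - I0). scale (c k) (g k)) + (\<Sum>k\<in>Inr ` J. scale (c k) (g k))"
      unfolding K_def using fin by (intro sum.union_disjoint) auto
    then show ?thesis
      by (simp add: sum.reindex g_def module_hom.sum[OF T] module_hom.scale[OF T])
  qed
  have "inj_on g K \<and> independent (g ` K)"
  proof (rule family_indepI)
    show "finite K" using fin by (simp add: K_def)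
    fix c assume c: "(\<Sum>k\<in>K. scale (c k) (g k)) = 0"
    let ?x = "\<Sum>i\<in>I - I0. scale (c (Inl i)) i" and ?y = "\<Sum>j\<in>J. scale (c (Inr j)) j"
    have "?y \<in> B0" using J sub by (intro subspace_sum subspace_scale) auto
    moreover have Tx: "T ?x = - ?y" using c sum by (simp add: eq_neg_iff_add_eq_0)
    ultimately have "T ?x \<in> B0" using sub by (simp add: subspace_neg)
    moreover have "?x \<in> A" using I sub by (intro subspace_sum subspace_scale) auto
    ultimately have "?x \<in> span I0" using inj I0 by blast
    then obtain d where d: "?x = (\<Sum>i\<in>I0. scale (d i) i)" using span_finite[OF fin(2)] by auto
    have "(\<Sum>i\<in>I. scale (if i \<in> I0 then - d i else c (Inl i)) i)
        = (\<Sum>i\<in>I0. scale (if i \<in> I0 then - d i else c (Inl i)) i)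
          + (\<Sum>i\<in>I - I0. scale (if i \<in> I0 then - d i else c (Inl i)) i)"
      by (subst sum.subset_diff[OF I(1) fin(1)]) (rule add.commute)
    also have "\<dots> = 0" using d by (simp add: sum_negf)
    finally have z: "(\<Sum>i\<in>I. scale (if i \<in> I0 then - d i else c (Inl i)) i) = 0" .
    have "(if i \<in> I0 then - d i else c (Inl i)) = 0" if "i \<in> I" for i
      by (rule independentD[OF I(3) fin(1) subset_refl z that])
    then have c1: "c (Inl i) = 0" if "i \<in> I - I0" for i using that by (metis DiffD1 DiffD2)
    then have y: "?y = 0" using Tx by (simp add: module_hom.zero[OF T])
    have "c (Inr j) = 0" if "j \<in> J" for j
      by (rule independentD[OF J(2) fin(3) subset_refl y that])
    with c1 show "\<forall>k\<in>K. c k = 0" by (auto simp: K_def)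
  qed
  then have "card K = card (g ` K)" "independent (g ` K)" by (auto simp: card_image)
  moreover have "g ` K \<subseteq> B" using I J sub TA by (auto simp: K_def g_def)
  ultimately have "card K \<le> dim B" using independent_card_le_dim by metis
  moreover have "card K = card (I - I0) + card J"
    unfolding K_def using fin by (subst card_Un_disjoint) (auto simp: card_image)
  moreover have "card (I - I0) + card I0 = card I"
    using fin I(1) card_Diff_subset card_mono by (metis le_add_diff_inverse2)
  ultimately show ?thesis using cI I0 J by linarith
qed

lemma ex_linear_on_family:
  assumes "inj_on g I" "independent (g ` I)"
  shows "\<exists>T. module_hom scale scale T \<and> (\<forall>i\<in>I. T (g i) = F i)"
proof -
  interpret vector_space_pair scale scale by unfold_locales
  obtain T where "Vector_Spaces.linear scale scale T" "\<forall>x\<in>g ` I. T x = F (the_inv_into I g x)"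
    using linear_independent_extend[OF assms(2), of "\<lambda>x. F (the_inv_into I g x)"] by blast
  then show ?thesis using the_inv_into_f_f[OF assms(1)]
    by (intro exI[of _ T]) (simp add: linear_iff_module_hom)
qed

end

context fd_endo
begin

lemma act_comaximal_zero:
  assumes "comaximal f g" "act f y = 0" "act g y = 0"
  shows "y = 0"
proof -
  obtain s t where "s * f + t * g = 1" using assms(1) by (auto simp: comaximal_def)
  then have "y = act (s * f + t * g) y" by simp
  then show ?thesis using assms(2,3) by (simp only: act_add act_mult) simp
qed

text \<open>Here \<open>c\<close> exchanges the generalized eigenspaces of \<open>z\<close> and \<open>z'\<close>, and \<open>c\<^sup>2\<close> lowers the height
  by exactly one, so \<open>c\<close> behaves like a square root of the nilpotent part. Filtering by the
  kernels of the odd powers of \<open>c\<close> as well, each step of the filtration at \<open>z\<close> embeds, via \<open>c\<close>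
  or \<open>c\<^sup>3\<close>, into one at \<open>z'\<close>.\<close>

lemma exchange_n_seq_le:
  fixes z z' :: 'a
  defines "K \<equiv> \<lambda>j. {v. act ([:- z, 1:] ^ j) v = 0}"
  defines "K' \<equiv> \<lambda>j. {v. act ([:- z', 1:] ^ j) v = 0}"
  assumes c: "module_hom scale scale c"
    and A: "\<And>j x. x \<in> K j \<Longrightarrow> c x \<in> K' j" and A': "\<And>j x. x \<in> K' j \<Longrightarrow> c x \<in> K j"
    and B: "\<And>j m x. x \<in> K m \<Longrightarrow> c (c x) \<in> K j \<longleftrightarrow> x \<in> K (Suc j)"
    and B': "\<And>j m x. x \<in> K' m \<Longrightarrow> c (c x) \<in> K' j \<longleftrightarrow> x \<in> K' (Suc j)"
    and k: "k \<ge> 1"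
  shows "n_seq scale u z (k + 1) \<le> n_seq scale u z' k"
proof -
  obtain j where j: "k = Suc j" using k by (cases k) auto
  have sub: "subspace (K i)" "subspace (K' i)" for i
    unfolding K_def K'_def by (rule module_hom.subspace_kernel[OF act_linear])+
  have mono: "K i \<subseteq> K (Suc i)" "K' i \<subseteq> K' (Suc i)" for i
    by (auto simp: K_def K'_def act_mult simp del: mult_pCons_left)
  \<comment> \<open>On the generalized eigenspaces, \<open>K j\<close> and \<open>K' j\<close> are
    the kernels of the \<open>2j\<close>-th power of \<open>c\<close>. So \<open>L\<close> is the
    kernel of the power \<open>2k + 1\<close> at \<open>z\<close>, between \<open>K k\<close> and
    \<open>K (Suc k)\<close>, and \<open>M\<close> that of the power \<open>2k - 1\<close> at
    \<open>z'\<close>, between \<open>K' j\<close> and \<open>K' k\<close>.\<close>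
  define L where "L = {x \<in> K (Suc k). c x \<in> K' k}"
  define M where "M = {x \<in> K' k. c x \<in> K j}"
  have "L = K (Suc k) \<inter> {x. c x \<in> K' k}" "M = K' k \<inter> {x. c x \<in> K j}"
    by (auto simp: L_def M_def)
  then have subL: "subspace L" "subspace M"
    using sub module_hom.subspace_linear_preimage[OF c] by (simp_all add: subspace_inter)
  have c3: "module_hom scale scale (\<lambda>x. c (c (c x)))"
    using module_hom_compose[OF module_hom_compose[OF c c] c] by (simp add: comp_def)
  have "dim L + dim M \<le> dim (K k) + dim (K' k)"
  proof (rule dim_injection_mod_le[OF _ _ _ _ _ _ c])
    show "K k \<subseteq> L" using mono A by (auto simp: L_def)
    show "M \<subseteq> K' k" by (auto simp: M_def)
    show "c x \<in> K' k" if "x \<in> L" for x using that by (simp add: L_def)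
    show "x \<in> K k" if "x \<in> L" "c x \<in> M" for x
      using that B by (auto simp: L_def M_def j)
  qed (use sub subL in auto)
  \<comment> \<open>The layer at height \<open>2k + 2\<close> is sent to the one at height
    \<open>2k - 1\<close>. The drop must be odd, because \<open>c\<close> switches the eigenspaces;
    for the other layer, from \<open>2k + 1\<close> to \<open>2k\<close>, a single \<open>c\<close>
    suffices.\<close>
  moreover have "dim (K (Suc k)) + dim (K' j) \<le> dim L + dim M"
  proof (rule dim_injection_mod_le[OF _ _ _ _ _ _ c3])
    show "K' j \<subseteq> M" using mono(2)[of j] A' by (auto simp: M_def j)
    show "L \<subseteq> K (Suc k)" by (auto simp: L_def)
    show "c (c (c x)) \<in> M" if "x \<in> K (Suc k)" for x
    proof -
      have "c (c (c x)) \<in> K' k" using B' A[OF that] by blast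
      moreover have "c (c x) \<in> K k" using B that by blast
      then have "c (c (c (c x))) \<in> K j" using B by (simp add: j)
      ultimately show ?thesis by (simp add: M_def)
    qed
    show "x \<in> L" if "x \<in> K (Suc k)" "c (c (c x)) \<in> K' j" for x
      using that B'[OF A[OF that(1)]] by (simp add: L_def j)
  qed (use sub subL in auto)
  ultimately have "dim (K (Suc k)) + dim (K' j) \<le> dim (K k) + dim (K' k)" by linarith
  then show ?thesis by (simp add: n_seq_act j K_def K'_def)
qed

end

section \<open>The commutator of \<open>u\<close> and \<open>a\<close>\<close>

lemma quartic_identity:
  fixes x1 x2 y1 y2 :: "'a::field"
  assumes y: "y1 \<noteq> 0" "y2 \<noteq> 0" and d: "d = x1 * x2 / (y1 * y2)"
  shows "[:x1 * x2 * d * d, - ((x1 + x2) * d * d * (y1 + y2)),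
      d * d * (y1 + y2) * (y1 + y2) + (x1 + x2) * (x1 + x2) * d - x1 * x2 * d - x1 * x2 * d,
      - ((x1 + x2) * d * (y1 + y2)), x1 * x2:] =
    smult (x1 * x2) ([:- (x1 / y1), 1:] * ([:- (x2 / y2), 1:] * ([:- (x1 / y2), 1:] * [:- (x2 / y1), 1:])))"
proof -
  \<comment> \<open>The inverses become variables with the rules \<open>y1 * y1i = 1\<close> and
    \<open>y2 * y2i = 1\<close>, so the comparison of coefficients is plain ring arithmetic.\<close>
  define y1i y2i where "y1i = inverse y1" and "y2i = inverse y2"
  have i: "y1 * y1i = 1" "y2 * y2i = 1" using y by (simp_all add: y1i_def y2i_def)
  then have i': "y1 * (y1i * r) = r" "y2 * (y2i * r) = r" for r by (simp_all flip: mult.assoc)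
  have "d = x1 * x2 * y1i * y2i" "x1 / y1 = x1 * y1i" "x2 / y2 = x2 * y2i" "x1 / y2 = x1 * y2i" "x2 / y1 = x2 * y1i"
    by (simp_all add: d y1i_def y2i_def divide_inverse)
  then show ?thesis by (simp add: algebra_simps i i')
qed

locale quadratic_quotient = fd_endo scale Basis u
  for scale :: "'a::field \<Rightarrow> 'b::ab_group_add \<Rightarrow> 'b" (infixr "*s" 75) and Basis and u +
  fixes a b :: "'b \<Rightarrow> 'b" and x1 x2 y1 y2 :: 'a
  assumes a: "module_hom scale scale a" and b: "module_hom scale scale b"
    and aa: "\<And>v. a (a v) = (x1 + x2) *s a v - (x1 * x2) *s v"
    and bb: "\<And>v. b (b v) = (y1 + y2) *s b v - (y1 * y2) *s v"
    and ub: "\<And>v. u (b v) = a v"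
    and x0: "x1 \<noteq> 0" "x2 \<noteq> 0" and y0: "y1 \<noteq> 0" "y2 \<noteq> 0"
    and xne: "x1 \<noteq> x2" and yne: "y1 \<noteq> y2"
begin

definition d where "d = x1 * x2 / (y1 * y2)"
definition s where "s = x1 + x2"
definition t where "t = y1 + y2"
definition P where "P = x1 * x2"
definition Q where "Q = y1 * y2"
definition k where "k = inverse Q"

lemma aa': "a (a v) = s *s a v - P *s v" and bb': "b (b v) = t *s b v - Q *s v"
  by (simp_all add: s_def t_def P_def Q_def aa bb)

text \<open>\<open>us = \<delta> u\<^sup>-\<^sup>1\<close> is the conjugate of \<open>u\<close>, and \<open>u + us\<close> commutes with \<open>a\<close>.\<close>

definition us where "us v = k *s (s *s b v - b (a v))"
definition c where "c v = u (a v) - a (u v)"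

lemmas a_simps = module_hom.add[OF a] module_hom.scale[OF a] module_hom.diff[OF a] module_hom.zero[OF a]
lemmas b_simps = module_hom.add[OF b] module_hom.scale[OF b] module_hom.diff[OF b] module_hom.zero[OF b]
lemmas u_simps = u_add u_scale u_diff u_0

lemma kd: "k * Q = 1" "d = P * k" "d \<noteq> 0" "P \<noteq> 0"
proof -
  show "k * Q = 1" unfolding k_def by (rule left_inverse) (use y0 in \<open>simp add: Q_def\<close>)
qed (use x0 y0 in \<open>simp_all add: k_def d_def P_def Q_def divide_inverse\<close>)

text \<open>The inverse of \<open>b\<close> is \<open>k (t - b)\<close>, so \<open>u\<close> is a
  polynomial in \<open>a\<close> and \<open>b\<close>. Identities can then be checked on words in
  \<open>a\<close> and \<open>b\<close>, with \<open>aa'\<close> and \<open>bb'\<close> as reduction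
  rules.\<close>

lemma u_eq: "u v = k *s (t *s a v - a (b v))"
proof -
  have "v = k *s (Q *s v)" using kd by simp
  also have "Q *s v = t *s b v - b (b v)" by (simp add: bb')
  finally have "u v = u (k *s (t *s b v - b (b v)))" by simp
  also have "\<dots> = k *s (t *s a v - a (b v))" by (simp only: u_simps ub)
  finally show ?thesis .
qed

lemma b_surj: "\<exists>w. v = b w"
proof -
  have "v = k *s (Q *s v)" using kd by simp
  also have "Q *s v = t *s b v - b (b v)" by (simp add: bb')
  finally have "v = b (k *s (t *s v - b v))" by (simp only: b_simps)
  then show ?thesis ..
qed

lemma us_hom: "module_hom scale scale us"
  by (intro module_hom.intro module_hom_axioms.intro module_axioms)
     (simp_all add: us_def a_simps b_simps algebra_simps)

lemmas us_simps = module_hom.add[OF us_hom] module_hom.scale[OF us_hom] module_hom.diff[OF us_hom]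

text \<open>Here \<open>u\<close> cancels \<open>b\<close> and leaves \<open>k\<close> times
  \<open>a (s - a) = P\<close>.\<close>

lemma u_us: "u (us v) = d *s v"
  by (simp add: us_def u_simps ub aa' kd algebra_simps)

lemma us_u: "us (u v) = d *s v"
proof -
  obtain w where "v = b w" using b_surj by blast
  then show ?thesis by (simp add: us_def ub aa' b_simps kd algebra_simps)
qed

text \<open>Up to the factor \<open>k\<close>, both sides reduce to
  \<open>t a a - a b a + P b\<close>.\<close>

lemma trace_commute: "a (u v) + a (us v) = u (a v) + us (a v)"
  by (simp add: u_eq us_def a_simps b_simps aa' algebra_simps)

lemma a_us: "a (us v) = u (a v) + (d * t) *s v - s *s u v"
  by (simp add: u_eq us_def a_simps b_simps aa' kd algebra_simps)

lemma c_hom: "module_hom scale scale c"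
  by (intro module_hom.intro module_hom_axioms.intro module_axioms)
     (simp_all add: c_def a_simps u_simps algebra_simps)

lemmas c_simps = module_hom.add[OF c_hom] module_hom.scale[OF c_hom] module_hom.diff[OF c_hom]

lemma c_eq: "c v = u (a v) - us (a v) + (d * t) *s v - s *s u v"
proof -
  have "a (u v) = u (a v) + us (a v) - a (us v)"
    using trace_commute[of v] by (simp add: algebra_simps)
  then show ?thesis by (simp add: c_def a_us)
qed

text \<open>By \<open>trace_commute\<close>, \<open>a u u = u a u + us a u - d a\<close>. Hence
  \<open>c u = d a - us a u\<close>, which is \<open>us (u a - a u)\<close> since
  \<open>us u = d\<close>.\<close>

lemma c_u: "c (u v) = us (c v)"
proof -
  have "a (u (u v)) = u (a (u v)) + us (a (u v)) - a (us (u v))"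
    using trace_commute[of "u v"] by (simp add: algebra_simps)
  then show ?thesis by (simp add: c_def us_simps us_u a_simps)
qed

lemma c_us: "c (us v) = u (c v)"
proof -
  have "us (c (us v)) = d *s c v" by (simp add: u_us c_simps flip: c_u)
  then have "u (us (c (us v))) = d *s u (c v)" by (simp add: u_simps)
  then show ?thesis using kd by (simp add: u_us)
qed

text \<open>The square of \<open>c\<close> is symmetric in \<open>u\<close> and \<open>us\<close>,
  and \<open>a\<close> has disappeared. As \<open>u us = d\<close>, applying \<open>u\<close> twice
  clears \<open>us\<close> and leaves a polynomial of degree 4 in \<open>u\<close>.\<close>

lemma cc: "c (c v) = P *s us (us v) + P *s u (u v) - (P * d) *s v - (P * d) *s v
    + (d * t * d * t) *s v - (s * d * t) *s u v - (s * d * t) *s us v + (s * s * d) *s v"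
proof -
  have ca: "c (a v) = (d * t) *s a v - s *s us (a v) - P *s u v + P *s us v"
    by (simp add: c_eq[of "a v"] aa' u_simps us_simps algebra_simps)
  \<comment> \<open>The outer \<open>c\<close> is pushed through the expansion of the inner one with
    \<open>c_u\<close> and \<open>c_us\<close>; the copies of \<open>c v\<close> that remain stay
    folded as \<open>w\<close> until the end.\<close>
  define w where "w = c v"
  have w: "w = u (a v) - us (a v) + (d * t) *s v - s *s u v" unfolding w_def by (rule c_eq)
  have "c (c v) = c (u (a v) - us (a v) + (d * t) *s v - s *s u v)"
    by (rule arg_cong[OF c_eq])
  also have "\<dots> = us (c (a v)) - u (c (a v)) + (d * t) *s w - s *s us w"
    by (simp only: c_simps c_u c_us w_def)
  finally show ?thesis
    by (simp add: w ca u_simps us_simps u_us us_u algebra_simps)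
qed

lemma uucc: "u (u (c (c v))) = act (smult P ([:- (x1 / y1), 1:] * ([:- (x2 / y2), 1:] * ([:- (x1 / y2), 1:] * [:- (x2 / y1), 1:])))) v"
proof -
  have "u (u (c (c v))) = act [:P * d * d, - (s * d * d * t), d * d * t * t + s * s * d - P * d - P * d, - (s * d * t), P:] v"
  proof -
    have "act [:c0, c1, c2, c3, c4:] v = c0 *s v + c1 *s u v + c2 *s u (u v) + c3 *s u (u (u v)) + c4 *s u (u (u (u v)))"
      for c0 c1 c2 c3 c4 by (simp add: act_pCons)
    then show ?thesis
      by (simp only: scale_left_diff_distrib scale_left_distrib) (simp add: cc u_simps u_us algebra_simps)
  qed
  then show ?thesis
    using quartic_identity[OF y0 d_def, folded s_def t_def P_def] by simp
qed

lemma u_inj: "u v = 0 \<Longrightarrow> v = 0"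
  using us_u[of v] kd module_hom.zero[OF us_hom] by simp

text \<open>Two relations drive the induction: \<open>c (us - z') = (u - z') c\<close>, and
  \<open>u (us - z') = - z' (u - z)\<close>, so that \<open>us - z'\<close> also lowers the height
  at \<open>z\<close>.\<close>

lemma c_exchanges:
  assumes "z * z' = d" "act ([:- z, 1:] ^ j) v = 0"
  shows "act ([:- z', 1:] ^ j) (c v) = 0"
  using assms(2)
proof (induction j arbitrary: v)
  case 0
  then show ?case by (simp add: module_hom.zero[OF c_hom])
next
  case (Suc j)
  let ?D = "us v - z' *s v"
  have "u (act ([:- z, 1:] ^ j) ?D) = act ([:- z, 1:] ^ j) (u ?D)" by (simp only: act_u)
  also have "u ?D = - z' *s act [:- z, 1:] v"
    by (simp add: u_simps u_us act_lin algebra_simps flip: assms(1))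
  also have "act ([:- z, 1:] ^ j) (- z' *s act [:- z, 1:] v) = - z' *s act ([:- z, 1:] ^ Suc j) v"
    by (simp only: act_scale power_Suc2 act_mult)
  finally have "u (act ([:- z, 1:] ^ j) ?D) = 0" by (simp only: Suc.prems scale_zero_right)
  then have "act ([:- z, 1:] ^ j) ?D = 0" by (rule u_inj)
  then have "act ([:- z', 1:] ^ j) (c ?D) = 0" by (rule Suc.IH)
  also have "c ?D = act [:- z', 1:] (c v)" by (simp add: c_simps c_us act_lin)
  finally show ?case by (simp only: power_Suc2 act_mult)
qed

lemma act_uu: "act f (u (u v)) = u (u (act f v))"
  by (simp add: act_u)

text \<open>\<open>u^2 c^2\<close> is \<open>P (u - z) h(u)\<close>. Here \<open>u\<close> is
  injective, and \<open>h(u)\<close> is injective on the generalized eigenspace of \<open>z\<close>,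
  where \<open>v\<close> lies by the last hypothesis.\<close>

lemma cc_lowers:
  assumes F: "smult P ([:- (x1 / y1), 1:] * ([:- (x2 / y2), 1:] * ([:- (x1 / y2), 1:] * [:- (x2 / y1), 1:])))
      = smult P ([:- z, 1:] * h)"
    and h: "comaximal [:- z, 1:] h" and m: "act ([:- z, 1:] ^ m) v = 0"
  shows "act ([:- z, 1:] ^ j) (c (c v)) = 0 \<longleftrightarrow> act ([:- z, 1:] ^ Suc j) v = 0"
proof -
  let ?L = "[:- z, 1:]"
  have "act (?L ^ j) (c (c v)) = 0 \<longleftrightarrow> act (?L ^ j) (u (u (c (c v)))) = 0"
    unfolding act_uu using u_inj u_0 by auto
  also have "\<dots> \<longleftrightarrow> act h (act (?L ^ Suc j) v) = 0"
  proof -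
    have "?L ^ j * smult P (?L * h) = smult P (h * ?L ^ Suc j)"
      by (simp only: mult_smult_right power_Suc mult_ac)
    then have "act (?L ^ j) (u (u (c (c v)))) = act (smult P (h * ?L ^ Suc j)) v"
      unfolding uucc F by (metis act_mult)
    also have "\<dots> = P *s act h (act (?L ^ Suc j) v)" by (simp only: act_smult act_mult)
    finally show ?thesis using kd by simp
  qed
  also have "\<dots> \<longleftrightarrow> act (?L ^ Suc j) v = 0"
  proof
    assume "act h (act (?L ^ Suc j) v) = 0"
    moreover have "act (?L ^ m) (act (?L ^ Suc j) v) = 0"
      using m by (subst act_mult_commute) (simp del: power_Suc)
    moreover have "comaximal h (?L ^ m)" using h comaximal_commute comaximal_power by blast
    ultimately show "act (?L ^ Suc j) v = 0" using act_comaximal_zero by blast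
  qed simp
  finally show ?thesis .
qed

lemma quotient_n_seq_le:
  assumes ne: "x1 / y1 \<noteq> x2 / y2" and "n \<ge> 1"
  shows "n_seq scale u (x1 / y1) (n + 1) \<le> n_seq scale u (x2 / y2) n"
proof (rule exchange_n_seq_le[OF c_hom _ _ _ _ \<open>n \<ge> 1\<close>])
  let ?h = "[:- (x1 / y2), 1:] * [:- (x2 / y1), 1:]"
  have w: "x1 / y1 \<noteq> x1 / y2" "x1 / y1 \<noteq> x2 / y1" "x2 / y2 \<noteq> x1 / y2" "x2 / y2 \<noteq> x2 / y1"
    using x0 y0 xne yne by (auto simp: frac_eq_eq)
  have d: "x1 / y1 * (x2 / y2) = d" "x2 / y2 * (x1 / y1) = d" by (simp_all add: d_def mult.commute)
  fix j m v
  show "c v \<in> {v. act ([:- (x2 / y2), 1:] ^ j) v = 0}" if "v \<in> {v. act ([:- (x1 / y1), 1:] ^ j) v = 0}"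
    using that c_exchanges[OF d(1)] by blast
  show "c v \<in> {v. act ([:- (x1 / y1), 1:] ^ j) v = 0}" if "v \<in> {v. act ([:- (x2 / y2), 1:] ^ j) v = 0}"
    using that c_exchanges[OF d(2)] by blast
  let ?A = "[:- (x1 / y1), 1:]" and ?B = "[:- (x2 / y2), 1:]"
  have "comaximal ?A (?B * ?h)"
    using ne w by (intro comaximal_mult comaximal_linear) auto
  from cc_lowers[OF refl this, of m v j]
  show "c (c v) \<in> {v. act (?A ^ j) v = 0} \<longleftrightarrow> v \<in> {v. act (?A ^ Suc j) v = 0}"
    if "v \<in> {v. act (?A ^ m) v = 0}"
    using that by (simp only: mem_Collect_eq)
  have "comaximal ?B (?A * ?h)"
    using ne w by (intro comaximal_mult comaximal_linear) auto
  from cc_lowers[OF arg_cong[OF mult.left_commute[of ?A ?B ?h], where f = "smult P"] this, of m v j]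
  show "c (c v) \<in> {v. act (?B ^ j) v = 0} \<longleftrightarrow> v \<in> {v. act (?B ^ Suc j) v = 0}"
    if "v \<in> {v. act (?B ^ m) v = 0}"
    using that by (simp only: mem_Collect_eq)
qed

end

section \<open>Quotients from cyclic summands\<close>

lemma (in finite_dimensional_vector_space) fd_endoI:
  assumes "Vector_Spaces.linear scale scale f"
  shows "fd_endo scale Basis f"
  by (intro fd_endo.intro fd_endo_axioms.intro finite_dimensional_vector_space_axioms assms)

context fd_endo
begin

lemma dec_annihilates:
  assumes d: "dec ers UNIV" and f: "\<And>e r. (e, r) \<in> set ers \<Longrightarrow> r dvd f"
  shows "act f v = 0"
proof -
  obtain g where g: "v = (\<Sum>i<length ers. act (g i) (fst (ers ! i)))" using dec_ex_coeffs[OF d] by blast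
  have "act f (fst (ers ! i)) = 0" if "i < length ers" for i
  proof (rule act_dvd[OF _ decD(2)[OF d that]])
    show "snd (ers ! i) dvd f" using f[of "fst (ers ! i)" "snd (ers ! i)"] that by simp
  qed
  then have "act f (act (g i) (fst (ers ! i))) = 0" if "i < length ers" for i
    using that by (subst act_mult_commute) simp
  then show ?thesis by (simp add: g act_sum)
qed

lemma dec_annihilating_prod:
  assumes d: "dec ers UNIV"
  shows "act (\<Prod>i<length ers. snd (ers ! i)) v = 0"
proof (rule dec_annihilates[OF d])
  fix e r assume "(e, r) \<in> set ers"
  then obtain i where "i < length ers" "snd (ers ! i) = r" by (metis in_set_conv_nth snd_conv)
  then show "r dvd (\<Prod>i<length ers. snd (ers ! i))" by (auto intro: dvd_prodI)
qed

text \<open>With \<open>z = x / y\<close> and \<open>z' = x' / y'\<close>, the chain makes \<open>b\<close> and \<open>a = u b\<close> block diagonal with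
  blocks of size at most 2, the two block structures being shifted against each other by one.\<close>

lemma ex_chain:
  assumes U: "module_hom scale scale U" "\<And>v. u (U v) = v" "\<And>v. U (u v) = v"
    and \<epsilon>: "\<epsilon> \<le> 1" and r: "r = [:- z, 1:] ^ (n + \<epsilon>) * [:- z', 1:] ^ n"
    and e: "act r e = 0" and y: "y \<noteq> 0" "y' \<noteq> 0"
  shows "\<exists>g. g 0 = 0 \<and> gspan {e} \<subseteq> span ((\<lambda>j. g (Suc j)) ` {..<degree r}) \<and>
    (\<forall>j<degree r. even j \<longrightarrow> g j = y *s (u (g (Suc j)) - z *s g (Suc j))) \<and>
    (\<forall>j<degree r. odd j \<longrightarrow> u (g j) = - y' *s (u (g (Suc j)) - z' *s g (Suc j)))"
proof -
  let ?L = "[:- z, 1:]" and ?L' = "[:- z', 1:]"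
  define N where "N = degree r"
  have "degree r = degree (?L ^ (n + \<epsilon>)) + degree (?L' ^ n)"
    unfolding r by (rule degree_mult_eq) simp_all
  then have N: "N = (n + \<epsilon>) + n" by (simp only: N_def degree_linear_power)
  \<comment> \<open>\<open>h\<close> is \<open>g\<close> read backwards from \<open>e\<close>. With
    \<open>w = g (Suc j)\<close>, an even step solves \<open>b w = y w\<close>,
    \<open>a w = x w + g j\<close>, and an odd step solves \<open>b w = y' w + g j\<close>,
    \<open>a w = x' w\<close>, each time under \<open>a = u b\<close>. In the odd case
    \<open>u\<close> falls on \<open>g j\<close>, hence the inverse \<open>U\<close>.\<close>
  define h where "h = rec_nat e (\<lambda>i v. if even (N - Suc i) then y *s act ?L v else - y' *s U (act ?L' v))"
  define g where "g j = h (N - j)" for j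
  have h0: "h 0 = e" by (simp add: h_def)
  have step: "g j = (if even j then y *s act ?L (g (Suc j)) else - y' *s U (act ?L' (g (Suc j))))"
    if "j < N" for j
  proof -
    have "N - j = Suc (N - Suc j)" "N - Suc (N - Suc j) = j" using that by auto
    then show ?thesis by (simp only: g_def h_def nat.rec)
  qed
  have gN: "g N = e" by (simp add: g_def h0)
  have even: "g j = y *s (u (g (Suc j)) - z *s g (Suc j))" if "j < N" "even j" for j
    using step[OF that(1)] that(2) by (simp only: act_lin if_True)
  have odd: "u (g j) = - y' *s (u (g (Suc j)) - z' *s g (Suc j))" if "j < N" "odd j" for j
    using step[OF that(1)] that(2) by (simp only: act_lin if_False u_scale U)
  \<comment> \<open>Every step down removes one factor, \<open>?L\<close> for even and
    \<open>?L'\<close> for odd \<open>j\<close>. Since \<open>\<epsilon> \<le> 1\<close>,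
    \<open>Q N\<close> is exactly \<open>r\<close>, and \<open>Q 0 = 1\<close> forces the chain to
    end in \<open>g 0 = 0\<close>.\<close>
  define Q where "Q j = ?L ^ (Suc j div 2) * ?L' ^ (j div 2)" for j
  have kill: "act (Q (N - i)) (g (N - i)) = 0" if "i \<le> N" for i
    using that
  proof (induction i)
    case 0
    have "Suc N div 2 = n + \<epsilon>" "N div 2 = n" using N \<epsilon> by auto
    then show ?case using e by (simp only: Q_def diff_zero gN flip: r)
  next
    case (Suc i)
    define j where "j = N - Suc i"
    have j: "j < N" "N - i = Suc j" using Suc.prems by (auto simp: j_def)
    have IH: "act (Q (Suc j)) (g (Suc j)) = 0" using Suc by (simp flip: j(2))
    show ?case
    proof (cases "even j")
      case True
      then have "Suc (Suc j) div 2 = Suc (j div 2)" "Suc j div 2 = j div 2" by simp_all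
      then have "Q (Suc j) = Q j * ?L" by (simp only: Q_def power_Suc mult_ac)
      then have "act (Q j) (act ?L (g (Suc j))) = 0" using IH by (simp only: act_mult)
      then have "act (Q j) (g j) = 0" using step[OF j(1)] True by (simp only: act_scale scale_zero_right if_True)
      then show ?thesis by (simp only: j_def)
    next
      case False
      then have "Suc (Suc j) div 2 = Suc (j div 2)" "Suc j div 2 = Suc (j div 2)" by simp_all
      then have "Q (Suc j) = Q j * ?L'" by (simp only: Q_def power_Suc mult_ac)
      then have "act (Q j) (act ?L' (g (Suc j))) = 0" using IH by (simp only: act_mult)
      moreover have "U (u v) = u (U v)" for v by (simp add: U)
      then have "act (Q j) (U w) = U (act (Q j) w)" for w
        by (rule act_commute[OF U(1), symmetric])
      ultimately have "act (Q j) (g j) = 0" using step[OF j(1)] False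
        by (simp only: act_scale module_hom.zero[OF U(1)] scale_zero_right if_False)
      then show ?thesis by (simp only: j_def)
    qed
  qed
  have g0: "g 0 = 0" using kill[of N] by (simp add: Q_def)
  let ?S = "span ((\<lambda>j. g (Suc j)) ` {..<N})"
  have mem: "g j \<in> ?S" if "j \<le> N" for j
    using that g0 by (cases j) (auto intro: span_base span_zero)
  have ueven: "u (g (Suc j)) \<in> ?S" if "j < N" "even j" for j
  proof -
    have "u (g (Suc j)) = inverse y *s g j + z *s g (Suc j)"
      using even[OF that] y by simp
    then show ?thesis using mem that by (simp add: span_add span_scale)
  qed
  \<comment> \<open>For odd \<open>j\<close> the defining equation involves \<open>u (g j)\<close>,
    which is already known to lie in the span because the step before \<open>j\<close> is
    even.\<close>
  have "u (g (Suc j)) \<in> ?S" if "j < N" for j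
  proof (cases "even j")
    case False
    then obtain i where i: "j = Suc i" "even i" by (cases j) auto
    then have "u (g j) \<in> ?S" using ueven[of i] that by simp
    moreover have "g (Suc j) \<in> ?S" using that by (intro mem) simp
    ultimately have "- inverse y' *s u (g j) + z' *s g (Suc j) \<in> ?S"
      by (intro span_add span_scale)
    moreover have "u (g (Suc j)) = - inverse y' *s u (g j) + z' *s g (Suc j)"
      using odd[OF that False] y by simp
    ultimately show ?thesis by simp
  qed (use ueven that in simp)
  then have base: "u v \<in> ?S" if "v \<in> (\<lambda>j. g (Suc j)) ` {..<N}" for v using that by auto
  have "u v \<in> ?S" if "v \<in> ?S" for v
    using that
  proof (induction rule: span_induct_alt)
    case base
    show ?case by (simp add: u_0 span_zero)
  next
    case (step c y z)
    then show ?case using base by (simp add: u_add u_scale span_add span_scale)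
  qed
  then have "invariant ?S" by (simp add: invariant_def)
  moreover have "e \<in> ?S" using mem[of N] gN by simp
  ultimately have "gspan {e} \<subseteq> ?S" by (intro gspan_minimal) auto
  then show ?thesis using g0 even odd unfolding N_def by blast
qed

lemma dec_pq_quotient:
  assumes d: "dec ers UNIV" and p0: "poly p 0 \<noteq> 0" and q0: "poly q 0 \<noteq> 0"
    and blocks: "\<And>e r. (e, r) \<in> set ers \<Longrightarrow> \<exists>x x' y y' n \<epsilon>. p = [:x * x', - (x + x'), 1:] \<and>
      q = [:y * y', - (y + y'), 1:] \<and> \<epsilon> \<le> (1::nat) \<and>
      r = [:- (x / y), 1:] ^ (n + \<epsilon>) * [:- (x' / y'), 1:] ^ n"
  shows "pq_quotient scale p q u"
proof -
  let ?K = "length ers"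
  have mem: "(fst (ers ! i), snd (ers ! i)) \<in> set ers" if "i < ?K" for i using that by simp
  have "poly (snd (ers ! i)) 0 \<noteq> 0" if i: "i < ?K" for i
  proof -
    obtain x x' y y' n \<epsilon> where "p = [:x * x', - (x + x'), 1:]" "q = [:y * y', - (y + y'), 1:]"
      and r: "snd (ers ! i) = [:- (x / y), 1:] ^ (n + \<epsilon>) * [:- (x' / y'), 1:] ^ n"
      using blocks[OF mem[OF i]] by blast
    then have "x \<noteq> 0" "x' \<noteq> 0" "y \<noteq> 0" "y' \<noteq> 0" using p0 q0 by auto
    then show ?thesis unfolding r by simp
  qed
  then have "poly (\<Prod>i<?K. snd (ers ! i)) 0 \<noteq> 0" by (simp add: poly_prod)
  then have bij: "bij u" using bij_if_annihilated dec_annihilating_prod[OF d] by blast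
  define U where "U = inv_into UNIV u"
  have U: "u (U v) = v" "U (u v) = v" for v
    using bij by (simp_all add: U_def bij_is_surj surj_f_inv_f bij_is_inj inv_f_f)
  have "Vector_Spaces.linear scale scale U"
    unfolding U_def using lin bij bij_module_hom_imp_inv_module_hom[of scale scale u]
    by (simp add: linear_iff_module_hom)
  then have U_hom: "module_hom scale scale U" by (simp add: linear_iff_module_hom)
  \<comment> \<open>One predicate for all data of a summand, so that the chain and the labelling of
    the roots are chosen together; the labelling may change from summand to summand.\<close>
  define ok where "ok i g x x' y y' \<longleftrightarrow> p = [:x * x', - (x + x'), 1:] \<and> q = [:y * y', - (y + y'), 1:] \<and>
      g 0 = 0 \<and> gspan {fst (ers ! i)} \<subseteq> span ((\<lambda>j. g (Suc j)) ` {..<degree (snd (ers ! i))}) \<and>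
      (\<forall>j<degree (snd (ers ! i)). even j \<longrightarrow> g j = y *s (u (g (Suc j)) - (x / y) *s g (Suc j))) \<and>
      (\<forall>j<degree (snd (ers ! i)). odd j \<longrightarrow> u (g j) = - y' *s (u (g (Suc j)) - (x' / y') *s g (Suc j)))" for i g x x' y y'
  have "\<exists>g x x' y y'. ok i g x x' y y'" if i: "i < ?K" for i
  proof -
    obtain x x' y y' n \<epsilon> where pq: "p = [:x * x', - (x + x'), 1:]" "q = [:y * y', - (y + y'), 1:]"
      and \<epsilon>: "\<epsilon> \<le> (1::nat)" and r: "snd (ers ! i) = [:- (x / y), 1:] ^ (n + \<epsilon>) * [:- (x' / y'), 1:] ^ n"
      using blocks[OF mem[OF i]] by blast
    then have "y \<noteq> 0" "y' \<noteq> 0" using q0 by auto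
    from ex_chain[OF U_hom U \<epsilon> r decD(2)[OF d i] this] show ?thesis unfolding ok_def using pq by blast
  qed
  then obtain g x x' y y' where ok: "\<And>i. i < ?K \<Longrightarrow> ok i (g i) (x i) (x' i) (y i) (y' i)"
    by metis
  have pq: "\<And>i. i < ?K \<Longrightarrow> p = [:x i * x' i, - (x i + x' i), 1:]"
      "\<And>i. i < ?K \<Longrightarrow> q = [:y i * y' i, - (y i + y' i), 1:]"
    and g0: "\<And>i. i < ?K \<Longrightarrow> g i 0 = 0"
    and sp: "\<And>i. i < ?K \<Longrightarrow> gspan {fst (ers ! i)} \<subseteq> span ((\<lambda>j. g i (Suc j)) ` {..<degree (snd (ers ! i))})"
    and even: "\<And>i j. i < ?K \<Longrightarrow> j < degree (snd (ers ! i)) \<Longrightarrow> even j \<Longrightarrow>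
      g i j = y i *s (u (g i (Suc j)) - (x i / y i) *s g i (Suc j))"
    and odd: "\<And>i j. i < ?K \<Longrightarrow> j < degree (snd (ers ! i)) \<Longrightarrow> odd j \<Longrightarrow>
      u (g i j) = - y' i *s (u (g i (Suc j)) - (x' i / y' i) *s g i (Suc j))"
    using ok unfolding ok_def by blast+
  have y0: "y i \<noteq> 0" "y' i \<noteq> 0" if "i < ?K" for i using pq(2)[OF that] q0 by auto
  define I where "I = pow_index ers"
  define G where "G = (\<lambda>(i, j). g i (Suc j))"
  have I: "k \<in> I \<longleftrightarrow> (\<exists>i j. k = (i, j) \<and> i < ?K \<and> j < degree (snd (ers ! i)))" for k
    by (auto simp: I_def pow_index_def)
  have finI: "finite I" by (simp add: I_def finite_pow_index)
  have span: "span (G ` I) = UNIV"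
  proof -
    have "act f e \<in> span (G ` I)" if e: "e \<in> fst ` set ers" for f e
    proof -
      obtain i where i: "i < ?K" "e = fst (ers ! i)" using e by (metis imageE in_set_conv_nth)
      have "act f e \<in> span ((\<lambda>j. g i (Suc j)) ` {..<degree (snd (ers ! i))})"
        using sp[OF i(1)] gspan_base[of e "{e}" f] i(2) by auto
      also have "\<dots> \<subseteq> span (G ` I)"
      proof (rule span_mono, safe)
        fix j assume "j < degree (snd (ers ! i))"
        then have "(i, j) \<in> I" using i by (simp add: I)
        then show "g i (Suc j) \<in> G ` I" by (force simp: G_def)
      qed
      finally show ?thesis .
    qed
    then have "gspan (fst ` set ers) \<subseteq> span (G ` I)"
      unfolding gspan_def by (intro span_minimal) auto
    then show ?thesis using d by (auto simp: dec_def)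
  qed
  have GI: "inj_on G I \<and> independent (G ` I)"
    by (rule family_basis[OF finI, where W = UNIV]) (use span card_pow_index[OF d] in \<open>simp_all add: I_def\<close>)
  \<comment> \<open>The blocks of \<open>b\<close> join \<open>g i j\<close> and
    \<open>g i (Suc j)\<close> for odd \<open>j\<close>, those of \<open>a = u b\<close> do so for
    even \<open>j\<close>. The first block of \<open>a\<close> has size one because
    \<open>g i 0 = 0\<close>.\<close>
  obtain b where b: "module_hom scale scale b"
    and bG: "\<And>k. k \<in> I \<Longrightarrow> b (G k) = (case k of (i, j) \<Rightarrow>
      if even j then y i *s g i (Suc j) else y' i *s g i (Suc j) + g i j)"
    using ex_linear_on_family[of G I "\<lambda>(i, j). if even j then y i *s g i (Suc j) else y' i *s g i (Suc j) + g i j"] GI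
    by blast
  have b1: "b (g i (Suc j)) = y i *s g i (Suc j)" if "i < ?K" "j < degree (snd (ers ! i))" "even j" for i j
    using bG[of "(i, j)"] that by (simp add: I G_def)
  have b2: "b (g i (Suc j)) = y' i *s g i (Suc j) + g i j" if "i < ?K" "j < degree (snd (ers ! i))" "odd j" for i j
    using bG[of "(i, j)"] that by (simp add: I G_def)
  define a where "a v = u (b v)" for v
  have a: "module_hom scale scale a"
    using module_hom_compose[OF b hom] by (simp add: a_def[abs_def] comp_def)
  have a1: "a (g i (Suc j)) = x i *s g i (Suc j) + g i j" if "i < ?K" "j < degree (snd (ers ! i))" "even j" for i j
    using even[OF that] y0[OF that(1)] by (simp add: a_def b1[OF that] u_scale scale_right_diff_distrib)
  have a2: "a (g i (Suc j)) = x' i *s g i (Suc j)" if "i < ?K" "j < degree (snd (ers ! i))" "odd j" for i j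
    using odd[OF that] y0[OF that(1)] by (simp add: a_def b2[OF that] u_add u_scale scale_right_diff_distrib)
  interpret a: fd_endo scale Basis a by (rule fd_endoI) (use a in \<open>simp add: linear_iff_module_hom\<close>)
  interpret b: fd_endo scale Basis b by (rule fd_endoI) (use b in \<open>simp add: linear_iff_module_hom\<close>)
  have extend: "T v = 0" if T: "module_hom scale scale T" "\<And>k. k \<in> I \<Longrightarrow> T (G k) = 0" for T v
  proof -
    have "v \<in> span (G ` I)" using span by simp
    then obtain c where "v = (\<Sum>k\<in>I. c k *s G k)" using span_family[OF finI] by blast
    then show ?thesis using T(2) by (simp add: module_hom.sum[OF T(1)] module_hom.scale[OF T(1)])
  qed
  have qb: "b.act q v = 0" for v
  proof (rule extend[OF b.act_linear])
    fix k assume "k \<in> I"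
    then obtain i j where k: "k = (i, j)" and ij: "i < ?K" "j < degree (snd (ers ! i))" by (auto simp: I)
    have q: "b.act q w = b (b w) - (y i + y' i) *s b w + (y i * y' i) *s w" for w
      unfolding pq(2)[OF ij(1)] by (simp add: b.act_pCons algebra_simps)
    show "b.act q (G k) = 0"
    proof (cases "even j")
      case True
      then show ?thesis by (simp add: q k G_def b1[OF ij] b.u_scale algebra_simps)
    next
      case False
      \<comment> \<open>The predecessor \<open>g i j\<close> is an eigenvector of \<open>b\<close>
        for \<open>y i\<close>, so on this plane \<open>b\<close> is triangular with diagonal
        \<open>y i\<close>, \<open>y' i\<close> and \<open>q\<close> kills it.\<close>
      then obtain l where l: "j = Suc l" "even l" by (cases j) auto
      then have "b (g i j) = y i *s g i j" using b1[of i l] ij by simp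
      then show ?thesis using False
        by (simp add: q k G_def b2[OF ij] b.u_scale b.u_add algebra_simps)
    qed
  qed
  have pa: "a.act p v = 0" for v
  proof (rule extend[OF a.act_linear])
    fix k assume "k \<in> I"
    then obtain i j where k: "k = (i, j)" and ij: "i < ?K" "j < degree (snd (ers ! i))" by (auto simp: I)
    have p: "a.act p w = a (a w) - (x i + x' i) *s a w + (x i * x' i) *s w" for w
      unfolding pq(1)[OF ij(1)] by (simp add: a.act_pCons algebra_simps)
    show "a.act p (G k) = 0"
    proof (cases "even j")
      case False
      then show ?thesis by (simp add: p k G_def a2[OF ij] a.u_scale algebra_simps)
    next
      case True
      \<comment> \<open>The same for \<open>a\<close> with shifted parity; at the end
        \<open>j = 0\<close> of the chain the equation holds because the vector is 0.\<close>
      have "a (g i j) = x' i *s g i j"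
      proof (cases j)
        case 0
        then show ?thesis using g0[OF ij(1)] by (simp add: a.u_0)
      next
        case (Suc l)
        then show ?thesis using a2[of i l] ij True by simp
      qed
      then show ?thesis using True
        by (simp add: p k G_def a1[OF ij] a.u_scale a.u_add algebra_simps)
    qed
  qed
  have "bij a" using a.bij_if_annihilated[OF pa p0] .
  moreover have bb: "bij b" using b.bij_if_annihilated[OF qb q0] .
  moreover have "u = a \<circ> inv_into UNIV b"
  proof
    fix v
    have "b (inv_into UNIV b v) = v" using bb by (simp add: bij_is_surj surj_f_inv_f)
    then show "u v = (a \<circ> inv_into UNIV b) v" by (simp add: a_def)
  qed
  ultimately show ?thesis
    unfolding pq_quotient_def automorphism_def using a.lin b.lin pa qb by blast
qed

end

section \<open>The four conditions\<close>

lemma all_equivalent_cycleI: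
  assumes "P \<Longrightarrow> Q" "Q \<Longrightarrow> R" "R \<Longrightarrow> S" "S \<Longrightarrow> P"
  shows "all_equivalent [P, Q, R, S]"
  using assms by (auto simp: all_equivalent_def)

lemma split_quadratic_obtain:
  fixes p :: "'a::field poly"
  assumes "lead_coeff p = 1" "degree p = 2" "split_poly p" "rsquarefree p"
  obtains x1 x2 where "p = [:x1 * x2, - (x1 + x2), 1:]" "x1 \<noteq> x2"
proof -
  obtain xs where xs: "p = (\<Prod>x\<leftarrow>xs. [:- x, 1:])"
    using assms by (auto simp: split_poly_def)
  have "degree (\<Prod>x\<leftarrow>xs. [:- x, 1:]) = length xs"
    by (rule degree_linear_factors)
  then have "length xs = 2" using xs assms(2) by simp
  then obtain x1 x2 where "xs = [x1, x2]"
    by (auto simp: numeral_2_eq_2 length_Suc_conv)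
  then have p: "p = [:- x1, 1:] * [:- x2, 1:]" using xs by simp
  have "x1 \<noteq> x2"
  proof
    assume "x1 = x2"
    then have "p = [:- x1, 1:] ^ 2" using p by (simp only: power2_eq_square)
    then have "Polynomial.order x1 p = 2" by (simp only: order_power_n_n)
    moreover have "Polynomial.order x1 p = 0 \<or> Polynomial.order x1 p = 1"
      using assms(4) by (simp add: rsquarefree_def)
    ultimately show False by simp
  qed
  moreover have "p = [:x1 * x2, - (x1 + x2), 1:]" using p by simp
  ultimately show ?thesis using that by blast
qed

text \<open>Points of \<open>S\<close> that are not roots contribute exponent 0, so one fixed
  \<open>S\<close>, later the set of all root quotients, serves every invariant factor.\<close>

lemma split_monic_eq_prod_order:
  fixes r :: "'a::field poly"
  assumes r: "lead_coeff r = 1" "split_poly r" and S: "finite S" "\<And>x. poly r x = 0 \<Longrightarrow> x \<in> S"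
  shows "r = (\<Prod>x\<in>S. [:- x, 1:] ^ Polynomial.order x r)"
proof -
  obtain xs where xs: "r = (\<Prod>x\<leftarrow>xs. [:- x, 1:])"
    using r by (auto simp: split_poly_def)
  have ord: "Polynomial.order x (\<Prod>y\<leftarrow>ys. [:- y, 1:]) = count_list ys x" for x :: 'a and ys
  proof (induction ys)
    case (Cons y ys)
    have nz: "(\<Prod>y\<leftarrow>ys. [:- y, 1:]) \<noteq> 0" by (auto simp: prod_list_zero_iff)
    have "[:- y, 1:] * (\<Prod>y\<leftarrow>ys. [:- y, 1:]) \<noteq> 0" using nz by (simp only: mult_eq_0_iff) simp
    then have "Polynomial.order x (\<Prod>y\<leftarrow>y # ys. [:- y, 1:])
        = Polynomial.order x [:- y, 1:] + Polynomial.order x (\<Prod>y\<leftarrow>ys. [:- y, 1:])"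
      unfolding list.map prod_list.Cons by (rule order_mult)
    moreover have "Polynomial.order x [:- y, 1:] = (if x = y then 1 else 0)"
      using order_power_n_n[of y 1] by (auto intro: order_0I)
    ultimately show ?case unfolding Cons by (simp only: count_list.simps) simp
  qed simp
  have prod: "(\<Prod>y\<leftarrow>ys. [:- y, 1:]) = (\<Prod>x\<in>S. [:- x, 1:] ^ count_list ys x)" if "set ys \<subseteq> S" for ys
    using that
  proof (induction ys)
    case (Cons y ys)
    have "(\<Prod>x\<in>S. [:- x, 1:] ^ count_list (y # ys) x)
        = (\<Prod>x\<in>S. (if x = y then [:- y, 1:] else 1) * [:- x, 1:] ^ count_list ys x)"
      by (intro prod.cong) (auto simp del: mult_pCons_left)
    also have "\<dots> = [:- y, 1:] * (\<Prod>x\<in>S. [:- x, 1:] ^ count_list ys x)"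
      using Cons.prems S(1) by (subst prod.distrib) (simp add: prod.delta del: mult_pCons_left)
    finally show ?case using Cons by (simp del: mult_pCons_left)
  qed simp
  have "poly r x = 0" if "x \<in> set xs" for x
    using that unfolding xs by (induction xs) auto
  then have "set xs \<subseteq> S" using S(2) by blast
  from prod[OF this] show ?thesis unfolding xs ord .
qed

section \<open>The root quotients and their pairing\<close>

locale pq_endo = fd_endo scale Basis u
  for scale :: "'a::field \<Rightarrow> 'b::ab_group_add \<Rightarrow> 'b" (infixr "*s" 75) and Basis and u +
  fixes x1 x2 y1 y2 :: 'a and p q :: "'a poly" and \<delta> :: 'a
  assumes p: "p = [:x1 * x2, - (x1 + x2), 1:]" and q: "q = [:y1 * y2, - (y1 + y2), 1:]"
    and \<delta>: "\<delta> = x1 * x2 / (y1 * y2)"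
    and x0: "x1 \<noteq> 0" "x2 \<noteq> 0" and y0: "y1 \<noteq> 0" "y2 \<noteq> 0"
    and xne: "x1 \<noteq> x2" and yne: "y1 \<noteq> y2"
begin

definition Z where "Z = {x1 / y1, x2 / y2, x1 / y2, x2 / y1}"

lemma Root_p: "Root p = {to_ac x1, to_ac x2}" and Root_q: "Root q = {to_ac y1, to_ac y2}"
proof -
  have "ac_eval [:c * d, - (c + d), 1:] x = (x - to_ac c) * (x - to_ac d)" for c d :: 'a and x
    by (simp add: ac_eval_pCons algebra_simps)
  then show "Root p = {to_ac x1, to_ac x2}" "Root q = {to_ac y1, to_ac y2}"
    by (auto simp: Root_def p q)
qed

lemma Root_quot_eq: "Root_quot p q = to_ac ` Z"
  unfolding Root_quot_def Root_p Root_q Z_def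
  by (auto simp: divide_inverse)

lemma to_ac_Root_quot: "to_ac z \<in> Root_quot p q \<longleftrightarrow> z \<in> Z"
  by (auto simp: Root_quot_eq)

text \<open>Renaming the roots of \<open>p\<close> and of \<open>q\<close> brings any
  \<open>z\<close> into the form \<open>x / y\<close> with partner \<open>x' / y'\<close>, so
  results about one labelled pair apply to every \<open>z\<close>.\<close>

lemma Z_pair:
  assumes "z \<in> Z"
  shows "\<exists>x x' y y'. p = [:x * x', - (x + x'), 1:] \<and> q = [:y * y', - (y + y'), 1:] \<and>
    z = x / y \<and> \<delta> * inverse z = x' / y' \<and> x \<noteq> 0 \<and> x' \<noteq> 0 \<and> y \<noteq> 0 \<and> y' \<noteq> 0 \<and> x \<noteq> x' \<and> y \<noteq> y'"
proof -
  have "\<exists>x x' y y'. (x = x1 \<and> x' = x2 \<or> x = x2 \<and> x' = x1) \<and> (y = y1 \<and> y' = y2 \<or> y = y2 \<and> y' = y1) \<and> z = x / y"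
    using assms unfolding Z_def by blast
  then obtain x x' y y' where x: "x = x1 \<and> x' = x2 \<or> x = x2 \<and> x' = x1"
    and y: "y = y1 \<and> y' = y2 \<or> y = y2 \<and> y' = y1" and z: "z = x / y" by blast
  have "p = [:x * x', - (x + x'), 1:]" "q = [:y * y', - (y + y'), 1:]" and d: "\<delta> = x * x' / (y * y')"
    using x y by (auto simp: p q \<delta> mult.commute)
  moreover have nz: "x \<noteq> 0" "x' \<noteq> 0" "y \<noteq> 0" "y' \<noteq> 0" "x \<noteq> x'" "y \<noteq> y'"
    using x y x0 y0 xne yne by auto
  moreover have "\<delta> * inverse z = x' / y'" unfolding d z using nz by (simp add: field_simps)
  ultimately show ?thesis using z by blast
qed

lemma Z_partner:
  assumes "z \<in> Z"
  shows "\<delta> * inverse z \<in> Z" "\<delta> * inverse (\<delta> * inverse z) = z" "z \<noteq> 0"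
proof -
  have \<delta>0: "\<delta> \<noteq> 0" using x0 y0 by (simp add: \<delta>)
  show "z \<noteq> 0" using assms x0 y0 by (auto simp: Z_def)
  then show "\<delta> * inverse (\<delta> * inverse z) = z" using \<delta>0 by (simp add: field_simps)
  have "\<delta> * inverse (x1 / y1) = x2 / y2" "\<delta> * inverse (x2 / y2) = x1 / y1"
    "\<delta> * inverse (x1 / y2) = x2 / y1" "\<delta> * inverse (x2 / y1) = x1 / y2"
    using x0 y0 by (simp_all add: \<delta> field_simps)
  then show "\<delta> * inverse z \<in> Z" using assms unfolding Z_def by auto
qed

text \<open>The cyclic summands that the blocks of (iv) amount to, up to the Chinese remainder theorem.\<close>

definition alternating :: "'a poly \<Rightarrow> bool" where
  "alternating r \<longleftrightarrow> (\<exists>z n \<epsilon>. z \<in> Z \<and> \<epsilon> \<le> 1 \<and>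
     r = [:- z, 1:] ^ (n + \<epsilon>) * [:- (\<delta> * inverse z), 1:] ^ n)"

text \<open>Literally the condition on a block in (iv), so that the theorem can be restated by
  folding it.\<close>

definition good_block :: "'a mat \<Rightarrow> bool" where
  "good_block B \<longleftrightarrow>
     (\<exists>z n. to_ac z \<in> Root_quot p q \<and> z = \<delta> * inverse z \<and> 0 < n \<and>
        B = companion_mat ([:- z, 1:] ^ n)) \<or>
     (\<exists>z n \<epsilon>. to_ac z \<in> Root_quot p q \<and> z \<noteq> \<delta> * inverse z \<and> \<epsilon> \<in> {0, 1} \<and>
        B = diag_block_mat
              [companion_mat ([:- z, 1:] ^ (n + \<epsilon>)),
               companion_mat ([:- (\<delta> * inverse z), 1:] ^ n)])"

lemma alternating_monic:
  assumes "alternating r"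
  shows "lead_coeff r = 1"
proof -
  obtain z w m n where "r = [:- z, 1:] ^ m * [:- w, 1:] ^ n" using assms by (auto simp: alternating_def)
  then show ?thesis by (simp add: lead_coeff_mult lead_coeff_power)
qed

lemma alternating_root:
  assumes "alternating r" "ac_eval r x = 0"
  shows "x \<in> Root_quot p q"
proof -
  obtain z m n where z: "z \<in> Z" and r: "r = [:- z, 1:] ^ m * [:- (\<delta> * inverse z), 1:] ^ n"
    using assms(1) by (auto simp: alternating_def)
  have "x = to_ac z \<or> x = to_ac (\<delta> * inverse z)"
    using assms(2) unfolding r ac_eval_mult ac_eval_power ac_eval_linear by auto
  then show ?thesis using z Z_partner(1) to_ac_Root_quot by blast
qed

text \<open>When \<open>z\<close> is its own partner, the exponent is halved, with
  \<open>\<epsilon>\<close> the parity of \<open>n\<close>; hence such a \<open>z\<close> imposes no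
  condition.\<close>

lemma alternating_powerI: "z \<in> Z \<Longrightarrow> z = \<delta> * inverse z \<Longrightarrow> alternating ([:- z, 1:] ^ n)"
  unfolding alternating_def
proof (intro exI conjI)
  assume z: "z = \<delta> * inverse z"
  have "[:- z, 1:] ^ n = [:- z, 1:] ^ (n div 2 + n mod 2) * [:- z, 1:] ^ (n div 2)"
    unfolding power_add[symmetric] by (rule arg_cong[where f = "power _"]) presburger
  then show "[:- z, 1:] ^ n = [:- z, 1:] ^ (n div 2 + n mod 2) * [:- (\<delta> * inverse z), 1:] ^ (n div 2)"
    using z by metis
qed auto

text \<open>The larger exponent must stand at the first point of the pair; if it belongs to the
  partner, the two points swap roles.\<close>

lemma alternating_pairI:
  assumes z: "z \<in> Z" and mn: "\<bar>int m - int n\<bar> \<le> 1"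
  shows "alternating ([:- z, 1:] ^ m * [:- (\<delta> * inverse z), 1:] ^ n)"
proof (cases "n \<le> m")
  case True
  then have "m - n \<le> 1" "m = n + (m - n)" using mn by auto
  then show ?thesis unfolding alternating_def using z by metis
next
  case False
  let ?w = "\<delta> * inverse z"
  have "n - m \<le> 1" "n = m + (n - m)" using mn False by auto
  moreover have "[:- z, 1:] ^ m * [:- ?w, 1:] ^ n = [:- ?w, 1:] ^ n * [:- (\<delta> * inverse ?w), 1:] ^ m"
    using Z_partner(2)[OF z] by (simp only: mult.commute)
  ultimately show ?thesis unfolding alternating_def using Z_partner(1)[OF z] by metis
qed

lemma alternating_decomposition_pq_quotient:
  assumes d: "dec ers UNIV" and alt: "\<And>e r. (e, r) \<in> set ers \<Longrightarrow> alternating r"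
  shows "q_exceptional scale p q u" "pq_quotient scale p q u"
proof -
  show "q_exceptional scale p q u"
    unfolding q_exceptional_def
  proof (intro allI impI)
    fix x assume "ac_eigenvalue scale u x"
    then have root: "ac_eval (\<Prod>i<length ers. snd (ers ! i)) x = 0"
      by (rule ac_eigenvalue_root[OF dec_annihilating_prod[OF d]])
    have "ac_eval (\<Prod>i\<in>I. f i) x = (\<Prod>i\<in>I. ac_eval (f i) x)" for I and f :: "nat \<Rightarrow> 'a poly"
      by (induction I rule: infinite_finite_induct) (simp_all add: ac_eval_mult ac_eval_1)
    with root obtain i where "i < length ers" "ac_eval (snd (ers ! i)) x = 0" by auto
    then show "x \<in> Root_quot p q"
      using alt[of "fst (ers ! i)" "snd (ers ! i)"] alternating_root by simp
  qed
  show "pq_quotient scale p q u"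
  proof (rule dec_pq_quotient[OF d])
    show "poly p 0 \<noteq> 0" "poly q 0 \<noteq> 0" using x0 y0 by (simp_all add: p q)
    fix e r assume "(e, r) \<in> set ers"
    then obtain z n \<epsilon> where z: "z \<in> Z" and r: "\<epsilon> \<le> 1" "r = [:- z, 1:] ^ (n + \<epsilon>) * [:- (\<delta> * inverse z), 1:] ^ n"
      using alt unfolding alternating_def by blast
    obtain x x' y y' where pq: "p = [:x * x', - (x + x'), 1:]" "q = [:y * y', - (y + y'), 1:]"
      and "z = x / y" "\<delta> * inverse z = x' / y'" using Z_pair[OF z] by blast
    then have "r = [:- (x / y), 1:] ^ (n + \<epsilon>) * [:- (x' / y'), 1:] ^ n" using r by simp
    with pq r(1) show "\<exists>x x' y y' n \<epsilon>. p = [:x * x', - (x + x'), 1:] \<and> q = [:y * y', - (y + y'), 1:] \<and>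
        \<epsilon> \<le> 1 \<and> r = [:- (x / y), 1:] ^ (n + \<epsilon>) * [:- (x' / y'), 1:] ^ n" by blast
  qed
qed

lemma invariant_UNIV: "invariant UNIV"
  by (simp add: invariant_def)

text \<open>Roots of the annihilators are eigenvalues of \<open>u\<close>, and all elements of
  \<open>Root_quot p q\<close> come from the base field.\<close>

lemma exceptional_split:
  assumes d: "dec ers UNIV" and ev: "\<And>x. ac_eigenvalue scale u x \<Longrightarrow> x \<in> Root_quot p q"
    and i: "i < length ers"
  shows "\<exists>xs. snd (ers ! i) = (\<Prod>x\<leftarrow>xs. [:- x, 1:])" "Root (snd (ers ! i)) \<subseteq> Root_quot p q"
proof -
  have root: "x \<in> Root_quot p q" if "ac_eval (snd (ers ! i)) x = 0" for x
    using ev dec_root_ac_eigenvalue[OF d i that] by blast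
  then show "Root (snd (ers ! i)) \<subseteq> Root_quot p q" by (auto simp: Root_def)
  show "\<exists>xs. snd (ers ! i) = (\<Prod>x\<leftarrow>xs. [:- x, 1:])"
    by (rule split_if_roots_in_base[OF decD(1)[OF d i]]) (use root Root_quot_eq in auto)
qed

lemma exceptional_quotient_intertwined:
  assumes ex: "q_exceptional scale p q u" and pq: "pq_quotient scale p q u"
  shows "triangularizable scale u"
    and "z \<in> Z \<Longrightarrow> z \<noteq> \<delta> * inverse z \<Longrightarrow> intertwined 1 (n_seq scale u z) (n_seq scale u (\<delta> * inverse z))"
proof -
  have ev: "\<And>x. ac_eigenvalue scale u x \<Longrightarrow> x \<in> Root_quot p q"
    using ex by (simp add: q_exceptional_def)
  obtain ers where d: "dec ers UNIV" using ex_invariant_decomposition[OF invariant_UNIV] by blast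
  show "triangularizable scale u"
  proof (rule dec_split_triangularizable[OF d])
    fix e r assume "(e, r) \<in> set ers"
    then obtain i where "i < length ers" "snd (ers ! i) = r" by (metis in_set_conv_nth snd_conv)
    then show "\<exists>xs. r = (\<Prod>x\<leftarrow>xs. [:- x, 1:])" using exceptional_split(1)[OF d ev] by blast
  qed
  obtain a b where ab: "automorphism scale a" "automorphism scale b"
    and pa: "\<And>v. poly_endo scale p a v = 0" and qb: "\<And>v. poly_endo scale q b v = 0"
    and u: "u = a \<circ> inv_into UNIV b"
    using pq unfolding pq_quotient_def by blast
  have ub: "u (b v) = a v" for v
    using ab(2) by (simp add: u automorphism_def bij_is_inj)
  interpret a: fd_endo scale Basis a by (rule fd_endoI) (use ab(1) in \<open>simp add: automorphism_def\<close>)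
  interpret b: fd_endo scale Basis b by (rule fd_endoI) (use ab(2) in \<open>simp add: automorphism_def\<close>)
  \<comment> \<open>One of the two inequalities, for all \<open>z\<close>; the other is its instance
    at the partner of \<open>z\<close>.\<close>
  have le: "n_seq scale u z (n + 1) \<le> n_seq scale u (\<delta> * inverse z) n"
    if z: "z \<in> Z" and ne: "z \<noteq> \<delta> * inverse z" and n: "n \<ge> 1" for z n
  proof -
    obtain x x' y y' where pq: "p = [:x * x', - (x + x'), 1:]" "q = [:y * y', - (y + y'), 1:]"
      and z': "z = x / y" "\<delta> * inverse z = x' / y'"
      and nz: "x \<noteq> 0" "x' \<noteq> 0" "y \<noteq> 0" "y' \<noteq> 0" "x \<noteq> x'" "y \<noteq> y'" using Z_pair[OF z] by blast
    have "a (a v) = a.act p v + ((x + x') *s a v - (x * x') *s v)" for v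
      by (simp add: pq a.act_pCons algebra_simps)
    then have aa: "a (a v) = (x + x') *s a v - (x * x') *s v" for v by (simp add: pa)
    have "b (b v) = b.act q v + ((y + y') *s b v - (y * y') *s v)" for v
      by (simp add: pq b.act_pCons algebra_simps)
    then have bb: "b (b v) = (y + y') *s b v - (y * y') *s v" for v by (simp add: qb)
    interpret quadratic_quotient scale Basis u a b x x' y y'
      by (intro quadratic_quotient.intro quadratic_quotient_axioms.intro fd_endo_axioms
          a.hom b.hom aa bb ub nz)
    show ?thesis using quotient_n_seq_le[OF _ n] ne z' by simp
  qed
  show "intertwined 1 (n_seq scale u z) (n_seq scale u (\<delta> * inverse z))"
    if z: "z \<in> Z" and ne: "z \<noteq> \<delta> * inverse z"
    unfolding intertwined_def
    using le[OF z ne] le[OF Z_partner(1)[OF z]] Z_partner(2)[OF z] ne by metis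
qed

text \<open>The orders do not increase along the divisibility chain. With \<open>k\<close> one more
  than the order at \<open>w\<close> of factor \<open>i\<close>, a failure would give at least
  \<open>i + 1\<close> factors of order at least \<open>k + 1\<close> at \<open>z\<close>, but at
  most \<open>i\<close> factors of order at least \<open>k\<close> at \<open>w\<close>, as indices
  start at 0.\<close>

lemma order_le_if_n_seq_le:
  assumes d: "dec ers UNIV" and anti: "\<And>i j. i \<le> j \<Longrightarrow> j < length ers \<Longrightarrow> snd (ers ! j) dvd snd (ers ! i)"
    and le: "\<And>k. k \<ge> 1 \<Longrightarrow> n_seq scale u z (k + 1) \<le> n_seq scale u w k" and i: "i < length ers"
  shows "Polynomial.order z (snd (ers ! i)) \<le> Polynomial.order w (snd (ers ! i)) + 1"
proof (rule ccontr)
  let ?o = "\<lambda>z i. Polynomial.order z (snd (ers ! i))"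
  define k where "k = ?o w i + 1"
  assume "\<not> ?thesis"
  then have k: "k + 1 \<le> ?o z i" by (simp add: k_def)
  have mono: "?o c j \<le> ?o c j'" if "j' \<le> j" "j < length ers" for c j j'
    using anti[OF that] decD(3)[OF d] that by (intro dvd_imp_order_le) auto
  have "{..i} \<subseteq> {j. j < length ers \<and> k + 1 \<le> ?o z j}"
  proof
    fix j assume "j \<in> {..i}"
    then show "j \<in> {j. j < length ers \<and> k + 1 \<le> ?o z j}" using mono[of j i z] i k by auto
  qed
  then have "card {..i} \<le> card {j. j < length ers \<and> k + 1 \<le> ?o z j}" by (intro card_mono) auto
  then have "card {..i} \<le> n_seq scale u z (k + 1)" using n_seq_dec[OF d, of "k + 1" z] by simp
  moreover have "{j. j < length ers \<and> k \<le> ?o w j} \<subseteq> {..<i}"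
  proof
    fix j assume j: "j \<in> {j. j < length ers \<and> k \<le> ?o w j}"
    show "j \<in> {..<i}"
    proof (rule ccontr)
      assume "j \<notin> {..<i}"
      then have "?o w j \<le> ?o w i" using j by (intro mono) auto
      with j show False by (simp add: k_def)
    qed
  qed
  then have "card {j. j < length ers \<and> k \<le> ?o w j} \<le> card {..<i}" by (intro card_mono) auto
  then have "n_seq scale u w k \<le> card {..<i}" using n_seq_dec[OF d, of k w] by (simp add: k_def)
  ultimately show False using le[of k] by (simp add: k_def)
qed

lemma intertwined_invariant_factor:
  assumes ev: "\<And>x. ac_eigenvalue scale u x \<Longrightarrow> x \<in> Root_quot p q"
    and int: "\<And>z. z \<in> Z \<Longrightarrow> z \<noteq> \<delta> * inverse z \<Longrightarrow>
      intertwined 1 (n_seq scale u z) (n_seq scale u (\<delta> * inverse z))"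
    and r: "invariant_factor scale u r"
  shows "split_poly r \<and> Root r \<subseteq> Root_quot p q \<and>
    (\<forall>z. z \<in> Z \<and> z \<noteq> \<delta> * inverse z \<longrightarrow>
       \<bar>int (Polynomial.order z r) - int (Polynomial.order (\<delta> * inverse z) r)\<bar> \<le> 1)"
proof -
  obtain rs i where seq: "invariant_factor_seq scale u rs" and ri: "r = rs i"
    using r by (auto simp: invariant_factor_def)
  then obtain N where mon: "\<And>i. lead_coeff (rs i) = 1" and chain: "\<And>i. rs (Suc i) dvd rs i"
    and N: "\<And>i. i \<ge> N \<Longrightarrow> rs i = 1"
    and rep: "represents scale u (diag_block_mat (map (\<lambda>i. companion_mat (rs i)) [0..<N]))"
    unfolding invariant_factor_seq_def by blast
  have "map (\<lambda>i. companion_mat (rs i)) [0..<N] = map companion_mat (map rs [0..<N])" by simp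
  from represents_dec[OF rep[unfolded this]]
  have "\<exists>ers. map snd ers = map rs [0..<N] \<and> dec ers UNIV" using mon by auto
  then obtain ers where ers: "map snd ers = map rs [0..<N]" and d: "dec ers UNIV" by blast
  have len: "length ers = N" using arg_cong[OF ers, of length] by simp
  have nth: "snd (ers ! j) = rs j" if "j < N" for j
    using arg_cong[OF ers, of "\<lambda>l. l ! j"] that len by simp
  have anti: "rs j dvd rs i" if "i \<le> j" for i j
    using that by (induction j rule: dec_induct) (auto intro: dvd_trans[OF chain])
  show ?thesis
  proof (cases "i < N")
    case True
    then have i: "i < length ers" "snd (ers ! i) = r" by (simp_all add: len nth ri)
    have "split_poly r"
      using exceptional_split(1)[OF d ev i(1)] mon[of i] by (auto simp: split_poly_def i(2) ri)
    moreover have "Root r \<subseteq> Root_quot p q" using exceptional_split(2)[OF d ev i(1)] i(2) by simp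
    moreover have "\<bar>int (Polynomial.order z r) - int (Polynomial.order (\<delta> * inverse z) r)\<bar> \<le> 1"
      if "z \<in> Z" "z \<noteq> \<delta> * inverse z" for z
    proof -
      have *: "snd (ers ! j) dvd snd (ers ! i)" if "i \<le> j" "j < length ers" for i j
        using that anti by (simp add: len nth)
      have "n_seq scale u z (k + 1) \<le> n_seq scale u (\<delta> * inverse z) k"
        "n_seq scale u (\<delta> * inverse z) (k + 1) \<le> n_seq scale u z k" if "k \<ge> 1" for k
        using int[OF \<open>z \<in> Z\<close> \<open>z \<noteq> _\<close>] that unfolding intertwined_def by blast+
      then have "Polynomial.order z r \<le> Polynomial.order (\<delta> * inverse z) r + 1"
        "Polynomial.order (\<delta> * inverse z) r \<le> Polynomial.order z r + 1"
        using order_le_if_n_seq_le[OF d * _ i(1)] i(2) by metis+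
      then show ?thesis by linarith
    qed
    ultimately show ?thesis by blast
  next
    case False
    then have r1: "r = 1" using N by (simp add: ri)
    have "split_poly (1 :: 'a poly)" unfolding split_poly_def by (auto intro: exI[of _ "[]"])
    moreover have "Root (1 :: 'a poly) = {}" by (simp add: Root_def ac_eval_1)
    ultimately show ?thesis by (simp add: r1)
  qed
qed

text \<open>A product over a set, so that the factor is taken only once when \<open>z\<close> is its
  own partner.\<close>

definition pair_part :: "'a \<Rightarrow> 'a poly \<Rightarrow> 'a poly" where
  "pair_part z r = (\<Prod>x\<in>{z, \<delta> * inverse z}. [:- x, 1:] ^ Polynomial.order x r)"

lemma pair_part_alternating:
  assumes z: "z \<in> Z"
    and r: "z \<noteq> \<delta> * inverse z \<Longrightarrow>
      \<bar>int (Polynomial.order z r) - int (Polynomial.order (\<delta> * inverse z) r)\<bar> \<le> 1"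
  shows "alternating (pair_part z r)"
proof (cases "z = \<delta> * inverse z")
  case True
  then have "pair_part z r = [:- z, 1:] ^ Polynomial.order z r" by (simp add: pair_part_def)
  then show ?thesis using alternating_powerI[OF z True] by simp
next
  case False
  then have "pair_part z r = [:- z, 1:] ^ Polynomial.order z r
      * [:- (\<delta> * inverse z), 1:] ^ Polynomial.order (\<delta> * inverse z) r"
    by (simp add: pair_part_def del: mult_pCons_left)
  then show ?thesis using alternating_pairI[OF z r[OF False]] by simp
qed

lemma comaximal_prod:
  "(\<And>i. i \<in> I \<Longrightarrow> comaximal f (g i)) \<Longrightarrow> comaximal f (prod g I)"
  by (induction I rule: infinite_finite_induct) (auto intro: comaximal_mult)

text \<open>\<open>x1 / y1\<close> and \<open>x1 / y2\<close> represent the two pairs, whose union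
  is \<open>Z\<close> and which are disjoint even if one of them collapses to a point.\<close>

lemma pair_part_split:
  assumes "lead_coeff r = 1" "split_poly r" "Root r \<subseteq> Root_quot p q"
  shows "r = pair_part (x1 / y1) r * pair_part (x1 / y2) r"
    and "comaximal (pair_part (x1 / y1) r) (pair_part (x1 / y2) r)"
proof -
  have partner: "\<delta> * inverse (x1 / y1) = x2 / y2" "\<delta> * inverse (x1 / y2) = x2 / y1"
    using x0 y0 by (simp_all add: \<delta> field_simps)
  have ne: "x1 / y1 \<noteq> x1 / y2" "x1 / y1 \<noteq> x2 / y1" "x2 / y2 \<noteq> x1 / y2" "x2 / y2 \<noteq> x2 / y1"
    using x0 y0 xne yne by (auto simp: frac_eq_eq)
  have "x \<in> Z" if "poly r x = 0" for x
  proof -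
    have "to_ac x \<in> Root r" using that by (simp add: Root_def ac_eval_to_ac)
    then show ?thesis using assms(3) to_ac_Root_quot by blast
  qed
  then have "r = (\<Prod>x\<in>Z. [:- x, 1:] ^ Polynomial.order x r)"
    by (intro split_monic_eq_prod_order assms) (simp_all add: Z_def)
  also have "Z = {x1 / y1, x2 / y2} \<union> {x1 / y2, x2 / y1}" by (auto simp: Z_def)
  also have "(\<Prod>x\<in>\<dots>. [:- x, 1:] ^ Polynomial.order x r) = pair_part (x1 / y1) r * pair_part (x1 / y2) r"
    unfolding pair_part_def partner using ne by (intro prod.union_disjoint) auto
  finally show "r = pair_part (x1 / y1) r * pair_part (x1 / y2) r" .
  show "comaximal (pair_part (x1 / y1) r) (pair_part (x1 / y2) r)"
    unfolding pair_part_def partner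
  proof (rule comaximal_prod)
    fix i assume i: "i \<in> {x1 / y2, x2 / y1}"
    have "comaximal ([:- i, 1:] ^ Polynomial.order i r) (\<Prod>x\<in>{x1 / y1, x2 / y2}. [:- x, 1:] ^ Polynomial.order x r)"
      using i ne by (intro comaximal_prod comaximal_powers comaximal_linear) auto
    then show "comaximal (\<Prod>x\<in>{x1 / y1, x2 / y2}. [:- x, 1:] ^ Polynomial.order x r) ([:- i, 1:] ^ Polynomial.order i r)"
      by (simp only: comaximal_commute)
  qed
qed

lemma ex_alternating_decomposition:
  assumes inv: "\<And>r. invariant_factor scale u r \<Longrightarrow>
    split_poly r \<and> Root r \<subseteq> Root_quot p q \<and>
    (\<forall>z. z \<in> Z \<and> z \<noteq> \<delta> * inverse z \<longrightarrow>
       \<bar>int (Polynomial.order z r) - int (Polynomial.order (\<delta> * inverse z) r)\<bar> \<le> 1)"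
  shows "\<exists>ers. dec ers UNIV \<and> (\<forall>(e, r)\<in>set ers. alternating r)"
proof -
  obtain ers where d: "dec ers UNIV" and sorted: "sorted_wrt (\<lambda>x y. snd y dvd snd x) ers"
    using ex_invariant_decomposition[OF invariant_UNIV] by blast
  let ?N = "length ers"
  define rs where "rs i = (if i < ?N then snd (ers ! i) else 1)" for i
  have seq: "invariant_factor_seq scale u rs"
    unfolding invariant_factor_seq_def
  proof (intro conjI allI exI[of _ ?N] impI)
    show "lead_coeff (rs i) = 1" for i using decD(1)[OF d] by (simp add: rs_def)
    show "rs (Suc i) dvd rs i" for i using sorted_wrt_nth_less[OF sorted, of i "Suc i"] by (simp add: rs_def)
    show "rs i = 1" if "i \<ge> ?N" for i using that by (simp add: rs_def)
    have "map (\<lambda>i. companion_mat (rs i)) [0..<?N] = map (\<lambda>x. companion_mat (snd x)) ers"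
      by (rule nth_equalityI) (simp_all add: rs_def)
    then show "represents scale u (diag_block_mat (map (\<lambda>i. companion_mat (rs i)) [0..<?N]))"
      using dec_represents[OF d] by simp
  qed
  have factor: "invariant_factor scale u r" if "(e, r) \<in> set ers" for e r
  proof -
    obtain i where "i < ?N" "snd (ers ! i) = r" using \<open>(e, r) \<in> set ers\<close> by (metis in_set_conv_nth snd_conv)
    then have "r = rs i" by (simp add: rs_def)
    then show ?thesis unfolding invariant_factor_def using seq by blast
  qed
  \<comment> \<open>\<open>?w\<close> is not the partner of \<open>?z\<close> but represents the
    other pair. The part of \<open>r\<close> at one pair, applied to \<open>e\<close>, gives the
    generator for the part at the other.\<close>
  let ?z = "x1 / y1" and ?w = "x1 / y2"
  have zw: "?z \<in> Z" "?w \<in> Z" by (auto simp: Z_def)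
  define F where "F = (\<lambda>(e, r). [(act (pair_part ?w r) e, pair_part ?z r), (act (pair_part ?z r) e, pair_part ?w r)])"
  have alt: "alternating (pair_part ?z r)" "alternating (pair_part ?w r)" if "(e, r) \<in> set ers" for e r
    using inv[OF factor[OF that]] zw by (auto intro!: pair_part_alternating)
  have "dec (concat (map F ers)) UNIV"
  proof (rule dec_refine[OF d])
    fix e r assume er: "(e, r) \<in> set ers"
    then have r: "lead_coeff r = 1" "act r e = 0" using d by (auto simp: dec_def)
    let ?A = "pair_part ?z r" and ?B = "pair_part ?w r"
    note split = pair_part_split[OF r(1)] inv[OF factor[OF er]]
    then have AB: "r = ?A * ?B" and co: "comaximal ?A ?B" by blast+
    have kill: "act ?A (act ?B e) = 0" "act ?B (act ?A e) = 0"
      using r(2) AB act_mult act_mult_commute by metis+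
    have "?A \<noteq> 0" "?B \<noteq> 0" using alternating_monic[OF alt(1)[OF er]] alternating_monic[OF alt(2)[OF er]] by auto
    then have "degree ?A + degree ?B = degree r" using degree_mult_eq AB by metis
    moreover have "e \<in> gspan {act ?B e, act ?A e}" by (rule gspan_comaximal_split[OF co])
    ultimately show "(\<forall>(e', r')\<in>set (F (e, r)). lead_coeff r' = 1 \<and> act r' e' = 0 \<and> e' \<in> gspan {e}) \<and>
      e \<in> gspan (fst ` set (F (e, r))) \<and> (\<Sum>(e', r')\<leftarrow>F (e, r). degree r') = degree r"
      using kill alternating_monic alt[OF er] by (simp add: F_def gspan_base)
  qed
  moreover have "\<forall>(e, r)\<in>set (concat (map F ers)). alternating r"
    using alt by (auto simp: F_def)
  ultimately show ?thesis by blast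
qed

text \<open>If \<open>z\<close> is its own partner, \<open>r\<close> is a single power of
  \<open>t - z\<close>, of positive exponent by \<open>deg\<close>; otherwise its two coprime powers
  are separated by the Chinese remainder theorem.\<close>

lemma alternating_block:
  assumes alt: "alternating r" and e: "act r e = 0" and deg: "degree r \<noteq> 0"
  shows "\<exists>bs B. rep_on bs B \<and> good_block B \<and> gspan {e} \<subseteq> span (set bs) \<and> length bs = degree r"
proof -
  obtain z n \<epsilon> where z: "z \<in> Z" and \<epsilon>: "\<epsilon> \<le> 1"
    and r: "r = [:- z, 1:] ^ (n + \<epsilon>) * [:- (\<delta> * inverse z), 1:] ^ n"
    using alt by (auto simp: alternating_def)
  let ?w = "\<delta> * inverse z"
  have mon: "lead_coeff ([:- c, 1:] ^ m) = 1" for c :: 'a and m by (simp add: lead_coeff_power)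
  have nz: "[:- c, 1:] ^ m \<noteq> 0" for c :: 'a and m by simp
  show ?thesis
  proof (cases "z = ?w")
    case True
    have rp: "r = [:- z, 1:] ^ (n + \<epsilon> + n)" unfolding r True[symmetric] by (simp only: power_add)
    then have "degree r = n + \<epsilon> + n" by (simp only: degree_linear_power)
    then have "good_block (companion_mat r)"
      unfolding good_block_def using True z to_ac_Root_quot deg rp by (metis neq0_conv)
    moreover have "rep_on (powers e (degree r)) (companion_mat r)"
      by (rule rep_on_companion[OF alternating_monic[OF alt] e])
    moreover have "r \<noteq> 0" using deg by auto
    then have "gspan {e} \<subseteq> span (set (powers e (degree r)))"
      using gspan_single[OF e] by (simp add: set_powers)
    ultimately show ?thesis by (intro exI conjI) auto
  next
    case False
    let ?A = "[:- z, 1:] ^ (n + \<epsilon>)" and ?B = "[:- ?w, 1:] ^ n"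
    define e1 e2 where "e1 = act ?B e" and "e2 = act ?A e"
    have kill: "act ?A e1 = 0" "act ?B e2 = 0"
      unfolding e1_def e2_def using e r act_mult act_mult_commute by metis+
    have co: "comaximal ?A ?B" using False by (intro comaximal_powers comaximal_linear)
    let ?bs = "powers e1 (degree ?A) @ powers e2 (degree ?B)"
    let ?M = "diag_block_mat [companion_mat ?A, companion_mat ?B]"
    have "rep_on (concat [powers e1 (degree ?A), powers e2 (degree ?B)]) ?M"
      by (rule rep_on_diag_block) (use rep_on_companion[OF mon kill(1)] rep_on_companion[OF mon kill(2)] in simp)
    then have "rep_on ?bs ?M" by simp
    moreover have "\<epsilon> \<in> {0, 1}" using \<epsilon> by auto
    then have "good_block ?M" unfolding good_block_def using z to_ac_Root_quot False by blast
    moreover have "gspan {e} \<subseteq> span (set ?bs)"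
    proof -
      have "act f e1 \<in> span (set ?bs)" "act f e2 \<in> span (set ?bs)" for f
        using act_in_span_powers[OF kill(1) nz, of f] act_in_span_powers[OF kill(2) nz, of f]
          span_mono[of "set (powers e1 (degree ?A))" "set ?bs"] span_mono[of "set (powers e2 (degree ?B))" "set ?bs"]
        by (auto simp only: set_powers set_append Un_upper1 Un_upper2)
      then have "gspan {e1, e2} \<subseteq> span (set ?bs)"
        unfolding gspan_def by (intro span_minimal) auto
      moreover have "e \<in> gspan {e1, e2}" unfolding e1_def e2_def by (rule gspan_comaximal_split[OF co])
      ultimately show ?thesis using gspan_le[of "{e}" "{e1, e2}"] by blast
    qed
    moreover have "length ?bs = degree r"
      unfolding length_append length_powers r using nz by (rule degree_mult_eq[OF nz, symmetric])
    ultimately show ?thesis by blast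
  qed
qed

lemma alternating_decomposition_blocks:
  assumes d: "dec ers UNIV" and alt: "\<forall>(e, r)\<in>set ers. alternating r"
  shows "\<exists>Bs. represents scale u (diag_block_mat Bs) \<and> (\<forall>B\<in>set Bs. good_block B)"
proof -
  \<comment> \<open>Summands of degree 0, whose generator is 0, are dropped, because a block at a
    point that is its own partner must have positive size.\<close>
  define F where "F = (\<lambda>x :: 'b \<times> 'a poly. if degree (snd x) = 0 then [] else [x])"
  define ers' where "ers' = concat (map F ers)"
  have d': "dec ers' UNIV"
    unfolding ers'_def
  proof (rule dec_refine[OF d])
    fix e r assume "(e, r) \<in> set ers"
    then have r: "lead_coeff r = 1" "act r e = 0" using d by (auto simp: dec_def)
    have "e = 0" if "degree r = 0"
    proof -
      have "r = 1" using that r(1) by (rule monic_degree_0[THEN iffD1, rotated])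
      then show ?thesis using r(2) by simp
    qed
    then show "(\<forall>(e', r')\<in>set (F (e, r)). lead_coeff r' = 1 \<and> act r' e' = 0 \<and> e' \<in> gspan {e}) \<and>
      e \<in> gspan (fst ` set (F (e, r))) \<and> (\<Sum>(e', r')\<leftarrow>F (e, r). degree r') = degree r"
      using r gspan_superset[of "{e}"] gspan_invariant[of "{}"]
      by (auto simp: F_def invariant_def subspace_0)
  qed
  have "\<exists>bs B. rep_on bs B \<and> good_block B \<and> gspan {fst x} \<subseteq> span (set bs) \<and> length bs = degree (snd x)"
    if x: "x \<in> set ers'" for x
  proof -
    obtain e r where er: "x = (e, r)" by (cases x)
    then have "(e, r) \<in> set ers" "degree r \<noteq> 0" using x by (auto simp: ers'_def F_def split: if_splits)
    moreover from this have "alternating r" "act r e = 0" using alt d by (auto simp: dec_def)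
    ultimately show ?thesis using alternating_block[of r e] by (simp add: er)
  qed
  then obtain bs B where B: "\<And>x. x \<in> set ers' \<Longrightarrow> rep_on (bs x) (B x) \<and> good_block (B x) \<and>
      gspan {fst x} \<subseteq> span (set (bs x)) \<and> length (bs x) = degree (snd x)"
    by metis
  have "list_all2 (\<lambda>(e, r) bs. gspan {e} \<subseteq> span (set bs) \<and> length bs = degree r) ers' (map bs ers')"
    unfolding list_all2_map2 list_all2_same
    by (rule ballI, drule B, simp add: case_prod_beta)
  note sp = dec_to_blocks[OF d' this]
  moreover have "list_all2 rep_on (map bs ers') (map B ers')"
    unfolding list_all2_map1 list_all2_map2 list_all2_same using B by blast
  ultimately have "represents scale u (diag_block_mat (map B ers'))"
    unfolding represents_iff using rep_on_diag_block by blast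
  moreover have "\<forall>B\<in>set (map B ers'). good_block B" using B by auto
  ultimately show ?thesis by blast
qed

text \<open>In the two-cell case the sum of the cyclic generators generates both cells, since their
  annihilators are coprime.\<close>

lemma good_block_alternating:
  assumes g: "good_block B" and rep: "rep_on bs B"
  shows "\<exists>e r. alternating r \<and> act r e = 0 \<and> set bs \<subseteq> gspan {e} \<and> degree r = length bs"
  using g unfolding good_block_def
proof (elim disjE exE conjE)
  have mon: "lead_coeff ([:- c, 1:] ^ m) = 1" for c :: 'a and m by (simp add: lead_coeff_power)
  {
    fix z n assume z: "to_ac z \<in> Root_quot p q" "z = \<delta> * inverse z" and B: "B = companion_mat ([:- z, 1:] ^ n)"
    obtain e where e: "bs = powers e (degree ([:- z, 1:] ^ n))" "act ([:- z, 1:] ^ n) e = 0"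
      using rep_on_companionD[OF mon] rep B by blast
    have "alternating ([:- z, 1:] ^ n)" using z by (intro alternating_powerI) (simp_all add: to_ac_Root_quot)
    then show ?thesis using e powers_subset_gspan length_powers by metis
  next
    fix z n \<epsilon> assume z: "to_ac z \<in> Root_quot p q" "z \<noteq> \<delta> * inverse z" and \<epsilon>: "\<epsilon> \<in> {0, 1 :: nat}"
      and B: "B = diag_block_mat [companion_mat ([:- z, 1:] ^ (n + \<epsilon>)), companion_mat ([:- (\<delta> * inverse z), 1:] ^ n)]"
    let ?A = "[:- z, 1:] ^ (n + \<epsilon>)" and ?B = "[:- (\<delta> * inverse z), 1:] ^ n"
    have "\<exists>bss. bs = concat bss \<and> list_all2 rep_on bss [companion_mat ?A, companion_mat ?B]"
      by (rule rep_on_diag_blockD) (use rep B in \<open>auto simp: companion_mat_def\<close>)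
    then obtain c1 c2 where bs: "bs = c1 @ c2" and c: "rep_on c1 (companion_mat ?A)" "rep_on c2 (companion_mat ?B)"
      by (auto simp: list_all2_Cons2)
    obtain e1 where e1: "c1 = powers e1 (degree ?A)" "act ?A e1 = 0" using rep_on_companionD[OF mon c(1)] by blast
    obtain e2 where e2: "c2 = powers e2 (degree ?B)" "act ?B e2 = 0" using rep_on_companionD[OF mon c(2)] by blast
    have co: "comaximal ?A ?B" using z(2) by (intro comaximal_powers comaximal_linear)
    have "alternating (?A * ?B)" unfolding alternating_def using z \<epsilon> to_ac_Root_quot by auto
    moreover have "act (?A * ?B) (e1 + e2) = 0"
    proof -
      have "act (?A * ?B) e1 = act ?B (act ?A e1)" "act (?A * ?B) e2 = act ?A (act ?B e2)"
        by (simp_all only: act_mult act_mult_commute[of ?A ?B])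
      then show ?thesis by (simp only: act_plus e1 e2 act_zero add_0)
    qed
    moreover have "set bs \<subseteq> gspan {e1 + e2}"
    proof -
      have "gspan {e1} \<subseteq> gspan {e1 + e2}" "gspan {e2} \<subseteq> gspan {e1 + e2}"
        using gspan_comaximal_merge[OF co e1(2) e2(2)] by (simp_all add: gspan_le)
      then show ?thesis using powers_subset_gspan unfolding bs e1(1) e2(1) set_append by blast
    qed
    moreover have "degree (?A * ?B) = length bs"
      unfolding bs e1(1) e2(1) length_append length_powers by (rule degree_mult_eq) simp_all
    ultimately show ?thesis by blast
  }
qed

lemma blocks_alternating_decomposition:
  assumes rep: "represents scale u (diag_block_mat Bs)" and good: "\<And>B. B \<in> set Bs \<Longrightarrow> good_block B"
  shows "\<exists>ers. dec ers UNIV \<and> (\<forall>(e, r)\<in>set ers. alternating r)"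
proof -
  have "square_mat B" if B: "B \<in> set Bs" for B
  proof -
    have "square_mat (companion_mat r)" for r :: "'a poly" by (simp add: companion_mat_def)
    moreover from this have "square_mat (diag_block_mat [companion_mat r, companion_mat r'])"
      for r r' :: "'a poly" by (intro diag_block_mat_square) auto
    ultimately show ?thesis using good[OF B] unfolding good_block_def by metis
  qed
  then obtain bss where bss: "list_all2 rep_on bss Bs"
    and sp: "span (set (concat bss)) = UNIV" "length (concat bss) = dim (UNIV :: 'b set)"
    using rep represents_diag_block_iff by blast
  have "\<exists>e r. alternating r \<and> act r e = 0 \<and> set (bss ! i) \<subseteq> gspan {e} \<and> degree r = length (bss ! i)"
    if "i < length bss" for i
    using bss that good by (intro good_block_alternating[of "Bs ! i"]) (auto simp: list_all2_conv_all_nth)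
  then obtain e r where er: "\<And>i. i < length bss \<Longrightarrow> alternating (r i) \<and> act (r i) (e i) = 0 \<and>
      set (bss ! i) \<subseteq> gspan {e i} \<and> degree (r i) = length (bss ! i)"
    by metis
  have "dec (map (\<lambda>i. (e i, r i)) [0..<length bss]) UNIV"
    by (rule dec_from_blocks[OF sp]) (use er alternating_monic in blast)
  moreover have "\<forall>(e, r)\<in>set (map (\<lambda>i. (e i, r i)) [0..<length bss]). alternating r"
    using er by auto
  ultimately show ?thesis by blast
qed

end

theorem theorem4p11:
  fixes scale :: "'a::field \<Rightarrow> 'b::ab_group_add \<Rightarrow> 'b"
    and Basis :: "'b set"
    and u :: "'b \<Rightarrow> 'b"
    and p q :: "'a poly"
    and \<delta> :: 'a
  assumes V: "finite_dimensional_vector_space scale Basis"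
    and u: "Vector_Spaces.linear scale scale u"
    and p: "lead_coeff p = 1" "degree p = 2" "split_poly p" "rsquarefree p"
    and q: "lead_coeff q = 1" "degree q = 2" "split_poly q" "rsquarefree q"
    and nz: "poly p 0 * poly q 0 \<noteq> 0"
    and \<delta>: "\<delta> = poly p 0 * inverse (poly q 0)"
  shows "all_equivalent
    [q_exceptional scale p q u \<and> pq_quotient scale p q u,

     triangularizable scale u \<and>
     (\<forall>x. ac_eigenvalue scale u x \<longrightarrow> x \<in> Root_quot p q) \<and>
     (\<forall>z. to_ac z \<in> Root_quot p q \<and> z \<noteq> \<delta> * inverse z \<longrightarrow>
        intertwined 1 (n_seq scale u z) (n_seq scale u (\<delta> * inverse z))),

     \<forall>r. invariant_factor scale u r \<longrightarrow>
       split_poly r \<and> Root r \<subseteq> Root_quot p q \<and>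
       (\<forall>z. to_ac z \<in> Root_quot p q \<and> z \<noteq> \<delta> * inverse z \<longrightarrow>
          \<bar>int (Polynomial.order z r) - int (Polynomial.order (\<delta> * inverse z) r)\<bar> \<le> 1),

     \<exists>Bs. represents scale u (diag_block_mat Bs) \<and>
       (\<forall>B\<in>set Bs.
          (\<exists>z n. to_ac z \<in> Root_quot p q \<and> z = \<delta> * inverse z \<and> 0 < n \<and>
             B = companion_mat ([:- z, 1:] ^ n)) \<or>
          (\<exists>z n \<epsilon>. to_ac z \<in> Root_quot p q \<and> z \<noteq> \<delta> * inverse z \<and> \<epsilon> \<in> {0, 1} \<and>
             B = diag_block_mat
                   [companion_mat ([:- z, 1:] ^ (n + \<epsilon>)),
                    companion_mat ([:- (\<delta> * inverse z), 1:] ^ n)]))]"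
    (is "all_equivalent [?i, ?ii, ?iii, ?iv]")
proof -
  obtain x1 x2 where x: "p = [:x1 * x2, - (x1 + x2), 1:]" "x1 \<noteq> x2"
    using split_quadratic_obtain[OF p] by blast
  obtain y1 y2 where y: "q = [:y1 * y2, - (y1 + y2), 1:]" "y1 \<noteq> y2"
    using split_quadratic_obtain[OF q] by blast
  interpret finite_dimensional_vector_space scale Basis by (rule V)
  interpret pq_endo scale Basis u x1 x2 y1 y2 p q \<delta>
    by (intro pq_endo.intro pq_endo_axioms.intro fd_endoI u) (use x y nz \<delta> in \<open>auto simp: divide_inverse\<close>)
  have good: "?iv \<longleftrightarrow> (\<exists>Bs. represents scale u (diag_block_mat Bs) \<and> (\<forall>B\<in>set Bs. good_block B))"
    unfolding good_block_def ..
  have 1: ?ii if i: ?i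
  proof (intro conjI allI impI)
    show "triangularizable scale u" using exceptional_quotient_intertwined(1) i by blast
    show "x \<in> Root_quot p q" if "ac_eigenvalue scale u x" for x
      using i that unfolding q_exceptional_def by blast
    show "intertwined 1 (n_seq scale u z) (n_seq scale u (\<delta> * inverse z))"
      if "to_ac z \<in> Root_quot p q \<and> z \<noteq> \<delta> * inverse z" for z
      using exceptional_quotient_intertwined(2) i that unfolding to_ac_Root_quot by blast
  qed
  have 2: ?iii if ii: ?ii
    unfolding to_ac_Root_quot
  proof (intro allI impI)
    fix r assume "invariant_factor scale u r"
    then show "split_poly r \<and> Root r \<subseteq> Root_quot p q \<and> (\<forall>z. z \<in> Z \<and> z \<noteq> \<delta> * inverse z \<longrightarrow>
      \<bar>int (Polynomial.order z r) - int (Polynomial.order (\<delta> * inverse z) r)\<bar> \<le> 1)"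
      using ii unfolding to_ac_Root_quot by (intro intertwined_invariant_factor) auto
  qed
  have 3: ?iv if iii: ?iii
  proof -
    obtain ers where "dec ers UNIV" "\<forall>(e, r)\<in>set ers. alternating r"
      using ex_alternating_decomposition iii unfolding to_ac_Root_quot by blast
    then show ?thesis unfolding good by (rule alternating_decomposition_blocks)
  qed
  have 4: ?i if iv: ?iv
  proof -
    obtain ers where "dec ers UNIV" "\<forall>(e, r)\<in>set ers. alternating r"
      using iv blocks_alternating_decomposition unfolding good by blast
    then show ?thesis using alternating_decomposition_pq_quotient by blast
  qed
  show ?thesis by (rule all_equivalent_cycleI[OF 1 2 3 4])
qed

end
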